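(* Suppose that for every $\varepsilon>0$ and every set $A$ of at most $n$ sources, a value between $\mathrm{cost}(A)$ and $(1+\varepsilon)\,\mathrm{cost}(A)$ (together with a corresponding placement of the Steiner vertex) can be computed in time $T_{\mathrm{Weber}}(n,\varepsilon)$, where $\mathrm{cost}(A)$ is the minimum cost of connecting all sources of $A$ to the sink through a single Steiner vertex. Then convex instances of FLaMECaST with one intermediate layer, one sink, unlimited capacity and $\alpha=0$, with $n$ sources, can be approximated within a factor of $1+\varepsilon$ (i.e., a layout of cost at most $(1+\varepsilon)$ times the minimum can be computed) in $O(n^6\cdot T_{\mathrm{Weber}}(n,\varepsilon))$ time.
   Context: FLaMECaST: an instance $I=(S,T,C,\alpha)$ consists of a finite set $S$ of sources and a finite set $T$ of sinks, each with a fixed position in $\mathbb{R}^2$, capacities $C=(c_0,\dots,c_{\lambda+1})$ ($\lambda$ = number of intermediate layers; here $\lambda=1$, $T=\{t\}$, and all capacities are $\infty$, i.e., no capacity constraints), and $\alpha\in[0,1]$ (here $\alpha=0$). A layout consists of a rooted forest (edges directed from child to parent) of height at most $\lambda+1$ whose leaves are exactly $S$ and whose roots lie in $T$ (other vertices are Steiner vertices), together with an embedding mapping sources and sinks to their positions and Steiner vertices to arbitrary points of $\mathbb{R}^2$. The cost of an edge $uv$ ($u$ child of $v$) is $\|\mathrm{pos}(u)-\mathrm{pos}(v)\|\cdot\ell(uv)^\alpha$, where $\ell(uv)$ is the number of sources in the subtree of $u$; for $\alpha=0$ this is the edge length. The cost of a layout is the sum of its edge costs; the goal is a layout of minimum cost.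 An instance is convex if all sources lie on the boundary of the convex hull of $S\cup T$. *)

theory Defs
  imports "HOL-Analysis.Analysis"
begin

type_synonym point = "real \<times> real"

text \<open>
  Sources and sinks are list positions, so distinct sources may share a point.  Capacities are not
  part of the record: only the uncapacitated problem is considered.
\<close>

record flamecast =
  sources :: "point list"
  sinks :: "point list"
  layers :: nat
  alpha :: real

datatype vertex = Source nat | Sink nat | Steiner nat

record layout =
  verts :: "vertex set"
  parent :: "vertex \<Rightarrow> vertex option"
  pos :: "vertex \<Rightarrow> point"

definition arcs :: "layout \<Rightarrow> (vertex \<times> vertex) set" where
  "arcs L = {(u, v). u \<in> verts L \<and> parent L u = Some v}"

definition rooted_forest :: "layout \<Rightarrow> bool" where
  "rooted_forest L \<longleftrightarrow> finite (verts L) \<and> arcs L \<subseteq> verts L \<times> verts L \<and> acyclic (arcs L)"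

definition leaves :: "layout \<Rightarrow> vertex set" where
  "leaves L = {v \<in> verts L. \<forall>u. (u, v) \<notin> arcs L}"

definition roots :: "layout \<Rightarrow> vertex set" where
  "roots L = {v \<in> verts L. parent L v = None}"

definition height_at_most :: "layout \<Rightarrow> nat \<Rightarrow> bool" where
  "height_at_most L h \<longleftrightarrow> (\<forall>u v d. (u, v) \<in> arcs L ^^ d \<longrightarrow> d \<le> h)"

definition is_layout :: "flamecast \<Rightarrow> layout \<Rightarrow> bool" where
  "is_layout I L \<longleftrightarrow>
     rooted_forest L \<and>
     height_at_most L (layers I + 1) \<and>
     leaves L = Source ` {..<length (sources I)} \<and>
     roots L \<subseteq> Sink ` {..<length (sinks I)} \<and>
     verts L - leaves L - roots L \<subseteq> range Steiner \<and>
     (\<forall>i<length (sources I). pos L (Source i) = sources I ! i) \<and>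
     (\<forall>j<length (sinks I). pos L (Sink j) = sinks I ! j)"

definition load :: "layout \<Rightarrow> vertex \<Rightarrow> nat" where
  "load L u = card {w \<in> leaves L. (w, u) \<in> (arcs L)\<^sup>*}"

definition layout_cost :: "flamecast \<Rightarrow> layout \<Rightarrow> real" where
  "layout_cost I L =
     (\<Sum>(u, v)\<in>arcs L. dist (pos L u) (pos L v) * real (load L u) powr alpha I)"

definition min_cost :: "flamecast \<Rightarrow> real" where
  "min_cost I = Inf {layout_cost I L |L. is_layout I L}"

definition convex_instance :: "flamecast \<Rightarrow> bool" where
  "convex_instance I \<longleftrightarrow>
     set (sources I) \<subseteq> frontier (convex hull (set (sources I) \<union> set (sinks I)))"

definition star_cost :: "point \<Rightarrow> point list \<Rightarrow> point \<Rightarrow> real" where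
  "star_cost t A p = dist p t + (\<Sum>a\<leftarrow>A. dist a p)"

definition weber_cost :: "point \<Rightarrow> point list \<Rightarrow> real" where
  "weber_cost t A = (INF p. star_cost t A p)"


text \<open>
  The real RAM, as a structured language over arrays of naturals (used for control and indirect
  addressing) and arrays of exact reals.  Arrays are numbered and unbounded; a scalar is cell 0 of
  an array.  Reals support the field operations, square roots and comparison, but there is no
  rounding from reals to naturals and there are no real constants other than naturals.
\<close>

datatype nexp =
    NConst nat
  | NCell nat nexp
  | NAdd nexp nexp
  | NSub nexp nexp
  | NMul nexp nexp

datatype rexp =
    RNat nexp
  | RCell nat nexp
  | RAdd rexp rexp
  | RSub rexp rexp
  | RMul rexp rexp
  | RDiv rexp rexp
  | RSqrt rexp

datatype bexp =
    NLess nexp nexp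
  | RLess rexp rexp
  | BNot bexp
  | BAnd bexp bexp

datatype com =
    SKIP
  | NAssign nat nexp nexp
  | RAssign nat nexp rexp
  | Seq com com
  | If bexp com com
  | While bexp com

record state =
  nmem :: "nat \<Rightarrow> nat \<Rightarrow> nat"
  rmem :: "nat \<Rightarrow> nat \<Rightarrow> real"

fun nval :: "nexp \<Rightarrow> state \<Rightarrow> nat" where
  "nval (NConst k) s = k"
| "nval (NCell a i) s = nmem s a (nval i s)"
| "nval (NAdd e f) s = nval e s + nval f s"
| "nval (NSub e f) s = nval e s - nval f s"
| "nval (NMul e f) s = nval e s * nval f s"

fun rval :: "rexp \<Rightarrow> state \<Rightarrow> real" where
  "rval (RNat e) s = real (nval e s)"
| "rval (RCell a i) s = rmem s a (nval i s)"
| "rval (RAdd e f) s = rval e s + rval f s"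
| "rval (RSub e f) s = rval e s - rval f s"
| "rval (RMul e f) s = rval e s * rval f s"
| "rval (RDiv e f) s = rval e s / rval f s"
| "rval (RSqrt e) s = sqrt (rval e s)"

fun bval :: "bexp \<Rightarrow> state \<Rightarrow> bool" where
  "bval (NLess e f) s = (nval e s < nval f s)"
| "bval (RLess e f) s = (rval e s < rval f s)"
| "bval (BNot b) s = (\<not> bval b s)"
| "bval (BAnd b c) s = (bval b s \<and> bval c s)"

definition nupd :: "nat \<Rightarrow> nat \<Rightarrow> nat \<Rightarrow> state \<Rightarrow> state" where
  "nupd a i x s = s\<lparr>nmem := (nmem s)(a := (nmem s a)(i := x))\<rparr>"

definition rupd :: "nat \<Rightarrow> nat \<Rightarrow> real \<Rightarrow> state \<Rightarrow> state" where
  "rupd a i x s = s\<lparr>rmem := (rmem s)(a := (rmem s a)(i := x))\<rparr>"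

text \<open>
  \<open>exec c s k s'\<close>: started in \<open>s\<close>, program \<open>c\<close> halts in \<open>s'\<close> after \<open>k\<close> steps.  Every assignment and
  every test is one step; as the expressions of a given program have bounded size, this agrees with
  unit cost per operation up to a constant factor.
\<close>

inductive exec :: "com \<Rightarrow> state \<Rightarrow> nat \<Rightarrow> state \<Rightarrow> bool" where
  Skip: "exec SKIP s 1 s"
| NAssign: "exec (NAssign a i e) s 1 (nupd a (nval i s) (nval e s) s)"
| RAssign: "exec (RAssign a i e) s 1 (rupd a (nval i s) (rval e s) s)"
| Seq: "exec c s j s' \<Longrightarrow> exec d s' k s'' \<Longrightarrow> exec (Seq c d) s (j + k) s''"
| IfTrue: "bval b s \<Longrightarrow> exec c s k s' \<Longrightarrow> exec (If b c d) s (k + 1) s'"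
| IfFalse: "\<not> bval b s \<Longrightarrow> exec d s k s' \<Longrightarrow> exec (If b c d) s (k + 1) s'"
| WhileFalse: "\<not> bval b s \<Longrightarrow> exec (While b c) s 1 s"
| WhileTrue: "bval b s \<Longrightarrow> exec c s j s' \<Longrightarrow> exec (While b c) s' k s'' \<Longrightarrow>
    exec (While b c) s (j + k + 1) s''"

text \<open>
  Memory outside the input cells is unconstrained: programs may not rely on it being initialised.
\<close>

definition holds_input :: "real \<Rightarrow> point \<Rightarrow> point list \<Rightarrow> state \<Rightarrow> bool" where
  "holds_input \<epsilon> t A s \<longleftrightarrow>
     nmem s 0 0 = length A \<and>
     rmem s 0 0 = \<epsilon> \<and> rmem s 0 1 = fst t \<and> rmem s 0 2 = snd t \<and>
     (\<forall>i<length A. rmem s 1 i = fst (A ! i) \<and> rmem s 2 i = snd (A ! i))"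

text \<open>
  A Weber program leaves its value and the coordinates of its Steiner vertex in cells 0, 1, 2 of
  real array 3.
\<close>

definition weber_program :: "com \<Rightarrow> (nat \<Rightarrow> real \<Rightarrow> real) \<Rightarrow> bool" where
  "weber_program W T \<longleftrightarrow>
     (\<forall>n. \<forall>\<epsilon>>0. \<forall>t A s. length A \<le> n \<and> holds_input \<epsilon> t A s \<longrightarrow>
        (\<exists>k s'. exec W s k s' \<and> real k \<le> T n \<epsilon> \<and>
           (let v = rmem s' 3 0; p = (rmem s' 3 1, rmem s' 3 2) in
              weber_cost t A \<le> v \<and> v \<le> (1 + \<epsilon>) * weber_cost t A \<and> star_cost t A p \<le> v)))"

text \<open>
  A layout for \<open>n\<close> sources with \<open>m\<close> Steiner vertices is output as a parent array.  The codes are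
  \<open>0, \<dots>, n - 1\<close> for the sources, \<open>n, \<dots>, n + m - 1\<close> for the Steiner vertices and then the sinks.
  Natural array 1 holds \<open>m\<close> in cell 0, natural array 2 maps the code of each source and each Steiner
  vertex to the code of its parent, and real arrays 3 and 4 hold the coordinates of the Steiner
  vertices.
\<close>

definition vertex_of_code :: "nat \<Rightarrow> nat \<Rightarrow> nat \<Rightarrow> vertex" where
  "vertex_of_code n m c =
     (if c < n then Source c else if c < n + m then Steiner (c - n) else Sink (c - n - m))"

definition output_parent :: "nat \<Rightarrow> state \<Rightarrow> vertex \<Rightarrow> vertex option" where
  "output_parent n s v =
     (let m = nmem s 1 0 in
      case v of
        Source i \<Rightarrow> if i < n then Some (vertex_of_code n m (nmem s 2 i)) else None
      | Steiner j \<Rightarrow> if j < m then Some (vertex_of_code n m (nmem s 2 (n + j))) else None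
      | Sink j \<Rightarrow> None)"

definition output_layout :: "flamecast \<Rightarrow> state \<Rightarrow> layout" where
  "output_layout I s =
     (let par = output_parent (length (sources I)) s in
      \<lparr>verts = {v. par v \<noteq> None} \<union> {v. \<exists>u. par u = Some v},
       parent = par,
       pos = (\<lambda>v. case v of
                Source i \<Rightarrow> sources I ! i
              | Sink j \<Rightarrow> sinks I ! j
              | Steiner j \<Rightarrow> (rmem s 3 j, rmem s 4 j))\<rparr>)"

end

theory Submission
  imports Defs
begin

text \<open>
  A layout is a choice of Steiner points (the sink counts as one), and its cost only drops if the
  Steiner points are projected to the hull of the instance and every source moves to its nearest
  Steiner point. The groups are then Voronoi cells of points on a convex curve, so they do not cross
  in the cyclic order of the sources. If the cell of \<open>p\<close> were interrupted four times, by sources of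
  the cells of \<open>q\<^sub>1, \<dots>, q\<^sub>4\<close>, then any two of these would be seen from \<open>p\<close> under an angle of at
  least 90 degrees: otherwise the path from a source of \<open>q\<^sub>i\<close> via \<open>q\<^sub>i\<close> and \<open>q\<^sub>j\<close> to a source of \<open>q\<^sub>j\<close>
  separates two sources of \<open>p\<close> and yet avoids the convex cell of \<open>p\<close>. With lexicographic
  tie-breaking four such points do not exist in the plane, so every group consists of at most three
  cyclic intervals. Hence \<open>O(n\<^sup>6)\<close> calls of the Weber program suffice for an interval dynamic program
  that computes for \<open>u \<le> v\<close> a solution on the positions \<open>u, \<dots>, v - 1\<close>, from one group with at most
  two gaps and solutions on the gaps. The linear overhead of each call is absorbed because a Weber
  program has to read its whole input.
\<close>

section \<open>Orientation and lexicographic order\<close>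

definition det2 :: "point \<Rightarrow> point \<Rightarrow> real" where
  "det2 u v = fst u * snd v - snd u * fst v"

text \<open>Positive iff the path from \<open>a\<close> via \<open>b\<close> to \<open>c\<close> turns left at \<open>b\<close>.\<close>

definition orient :: "point \<Rightarrow> point \<Rightarrow> point \<Rightarrow> real" where
  "orient a b c = det2 (b - a) (c - a)"

definition lex_less :: "point \<Rightarrow> point \<Rightarrow> bool" (infix "<\<^sub>L" 50) where
  "a <\<^sub>L b \<longleftrightarrow> fst a < fst b \<or> fst a = fst b \<and> snd a < snd b"

definition lex_le :: "point \<Rightarrow> point \<Rightarrow> bool" (infix "\<le>\<^sub>L" 50) where
  "a \<le>\<^sub>L b \<longleftrightarrow> a = b \<or> a <\<^sub>L b"

definition lex_between :: "point \<Rightarrow> point \<Rightarrow> point \<Rightarrow> bool" where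
  "lex_between a b c \<longleftrightarrow> a <\<^sub>L b \<and> b <\<^sub>L c \<or> c <\<^sub>L b \<and> b <\<^sub>L a"

interpretation lex: linorder "(\<le>\<^sub>L)" "(<\<^sub>L)"
  by unfold_locales (auto simp: lex_le_def lex_less_def prod_eq_iff)

lemma lex_less_iff_diff: "a <\<^sub>L b \<longleftrightarrow> 0 <\<^sub>L b - a"
  by (auto simp: lex_less_def)

lemma lex_pos_add: "0 <\<^sub>L u \<Longrightarrow> 0 <\<^sub>L v \<Longrightarrow> 0 <\<^sub>L u + v"
  by (auto simp: lex_less_def)

lemma lex_pos_scaleR: "0 <\<^sub>L u \<Longrightarrow> 0 < r \<Longrightarrow> 0 <\<^sub>L r *\<^sub>R u"
  by (auto simp: lex_less_def)

lemma lex_pos_uminus: "u \<noteq> 0 \<Longrightarrow> 0 <\<^sub>L u \<or> 0 <\<^sub>L - u"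
  by (auto simp: lex_less_def prod_eq_iff)

lemma convex_lex_pos: "convex {u. 0 <\<^sub>L u}"
proof (rule convexI)
  fix x y and r s :: real
  assume xy: "x \<in> {u. 0 <\<^sub>L u}" "y \<in> {u. 0 <\<^sub>L u}" and weights: "0 \<le> r" "0 \<le> s" "r + s = 1"
  consider "r = 0" "s = 1" | "r = 1" "s = 0" | "0 < r" "0 < s" using weights by fastforce
  then show "r *\<^sub>R x + s *\<^sub>R y \<in> {u. 0 <\<^sub>L u}"
    by cases (use xy in \<open>auto intro: lex_pos_add lex_pos_scaleR\<close>)
qed

lemma lex_less_line_iff:
  assumes "0 <\<^sub>L d"
  shows "a + r *\<^sub>R d <\<^sub>L a + s *\<^sub>R d \<longleftrightarrow> r < s"
  using assms by (auto simp: lex_less_def)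

lemma det2_eq_0D:
  assumes "det2 u v = 0" "u \<noteq> 0"
  obtains r where "v = r *\<^sub>R u"
proof (cases "fst u = 0")
  case True
  then have "v = (snd v / snd u) *\<^sub>R u"
    using assms by (auto simp: prod_eq_iff det2_def)
  then show ?thesis using that by blast
next
  case False
  then have "v = (fst v / fst u) *\<^sub>R u"
    using assms(1) by (auto simp: prod_eq_iff det2_def field_simps)
  then show ?thesis using that by blast
qed

lemma det2_lex_pos_mono:
  assumes "0 <\<^sub>L d" "0 <\<^sub>L u" "0 <\<^sub>L w" "det2 d u \<ge> 0" "det2 d w \<le> 0"
  shows "det2 w u \<ge> 0"
proof (rule ccontr)
  assume neg: "\<not> 0 \<le> det2 w u"
  have combine: "0 <\<^sub>L x + r *\<^sub>R y" if "0 <\<^sub>L x" "0 <\<^sub>L y" "0 \<le> r" for x y r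
    using that lex_pos_add[OF _ lex_pos_scaleR] by (cases "r = 0") auto
  have "0 <\<^sub>L ((- det2 w u) *\<^sub>R d + det2 d u *\<^sub>R w) + (- det2 d w) *\<^sub>R u"
    using assms neg by (intro combine lex_pos_scaleR) auto
  moreover have "((- det2 w u) *\<^sub>R d + det2 d u *\<^sub>R w) + (- det2 d w) *\<^sub>R u = 0"
    by (simp add: prod_eq_iff det2_def algebra_simps)
  ultimately show False by simp
qed

lemma orient_rotate: "orient a b c = orient b c a"
  and orient_swap: "orient b a c = - orient a b c" "orient a c b = - orient a b c"
  by (simp_all add: orient_def det2_def algebra_simps)

lemma orient_refl [simp]: "orient a b a = 0" "orient a b b = 0" "orient a a b = 0"
  by (simp_all add: orient_def det2_def)

lemma orient_eq_det2_steps: "orient a b c = det2 (b - a) (c - b)"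
  by (simp add: orient_def det2_def algebra_simps)

lemma orient_line:
  "orient a (a + r *\<^sub>R (c - a)) x = r * orient a c x"
  "orient (a + r *\<^sub>R (c - a)) c x = (1 - r) * orient a c x"
  by (simp_all add: orient_def det2_def algebra_simps)

lemma orient_eq_0D:
  assumes "orient a c b = 0" "a \<noteq> c"
  obtains r where "b = a + r *\<^sub>R (c - a)"
  using det2_eq_0D[of "c - a" "b - a"] assms by (metis diff_add_cancel add.commute eq_iff_diff_eq_0 orient_def)

lemma orient_eq_0_trans:
  assumes "orient u v x = 0" "orient u v y = 0" "orient u v z = 0" "u \<noteq> v"
  shows "orient x y z = 0"
proof -
  obtain i j k where "x = u + i *\<^sub>R (v - u)" "y = u + j *\<^sub>R (v - u)" "z = u + k *\<^sub>R (v - u)"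
    using assms orient_eq_0D by metis
  note line = this
  show ?thesis unfolding line by (simp add: orient_def det2_def algebra_simps)
qed

lemma closed_segment_lineI:
  fixes a c :: "'a::real_vector"
  shows "0 \<le> r \<Longrightarrow> r \<le> 1 \<Longrightarrow> a + r *\<^sub>R (c - a) \<in> closed_segment a c"
  by (auto simp: in_segment algebra_simps intro!: exI[of _ r])

lemma collinear_lex_between:
  assumes "orient a b c = 0" "lex_between a b c"
  obtains r where "0 < r" "r < 1" "b = a + r *\<^sub>R (c - a)"
proof -
  have "a \<noteq> c" using assms(2) lex.less_asym unfolding lex_between_def by blast
  moreover have "orient a c b = 0" using assms(1) orient_swap(2)[of a c b] by simp
  ultimately obtain r where r: "b = a + r *\<^sub>R (c - a)" using orient_eq_0D by blast
  have ends: "a = a + 0 *\<^sub>R (c - a)" "c = a + 1 *\<^sub>R (c - a)"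
    "c = c + 0 *\<^sub>R (a - c)" "a = c + 1 *\<^sub>R (a - c)" "b = c + (1 - r) *\<^sub>R (a - c)"
    by (simp_all add: r algebra_simps)
  have "0 < r \<and> r < 1" if "a <\<^sub>L b" "b <\<^sub>L c"
  proof -
    have "0 <\<^sub>L c - a" using that lex_less_iff_diff lex.less_trans by blast
    from lex_less_line_iff[OF this, of a] show ?thesis using that r ends(1,2) by metis
  qed
  moreover have "0 < r \<and> r < 1" if "c <\<^sub>L b" "b <\<^sub>L a"
  proof -
    have "0 <\<^sub>L a - c" using that lex_less_iff_diff lex.less_trans by blast
    from lex_less_line_iff[OF this, of c] have "0 < 1 - r" "1 - r < 1" using that ends(3,4,5) by metis+
    then show ?thesis by simp
  qed
  ultimately show ?thesis using that r assms(2) by (auto simp: lex_between_def)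
qed


section \<open>The order of the points along a convex boundary\<close>

lemma supporting_hyperplane_frontier:
  fixes S :: "'a::euclidean_space set"
  assumes "convex S" "x \<in> S" "x \<in> frontier S"
  obtains a where "a \<noteq> 0" "\<And>y. y \<in> S \<Longrightarrow> a \<bullet> x \<le> a \<bullet> y"
proof (cases "interior S = {}")
  case True
  then obtain a b where a: "a \<noteq> 0" "S \<subseteq> {x. a \<bullet> x = b}"
    using empty_interior_subset_hyperplane assms(1) by metis
  then have "a \<bullet> y = b" if "y \<in> S" for y using that by blast
  then show ?thesis using that a(1) assms(2) by simp
next
  case False
  then have "x \<notin> rel_interior S"
    using assms(3) by (simp add: frontier_def interior_rel_interior_gen split: if_splits)
  then show ?thesis using supporting_hyperplane_rel_boundary assms(1,2) that by metis
qed

text \<open>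
  The boundary is traversed clockwise from its leftmost point: first the points at which no path from
  left to right turns left, from left to right, and then the others, from right to left. A point inside
  an edge of the hull belongs to the lower chain iff the rest of the hull is above that edge.
\<close>

definition lower_chain :: "point set \<Rightarrow> point \<Rightarrow> bool" where
  "lower_chain S b \<longleftrightarrow> (\<exists>a\<in>S. \<exists>c\<in>S. a <\<^sub>L b \<and> b <\<^sub>L c \<and> 0 < orient a b c)"

definition hull_less :: "point set \<Rightarrow> point \<Rightarrow> point \<Rightarrow> bool" where
  "hull_less S a b \<longleftrightarrow>
     (if lower_chain S a then lower_chain S b \<and> b <\<^sub>L a else lower_chain S b \<or> a <\<^sub>L b)"

definition hull_le :: "point set \<Rightarrow> point \<Rightarrow> point \<Rightarrow> bool" where
  "hull_le S a b \<longleftrightarrow> a = b \<or> hull_less S a b"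

interpretation hull: linorder "hull_le S" "hull_less S" for S
proof -
  have trans: "hull_less S a c" if "hull_less S a b" "hull_less S b c" for a b c
    using that by (auto simp: hull_less_def split: if_splits dest: lex.less_trans)
  have asym: "\<not> hull_less S b a" if "hull_less S a b" for a b
    using that by (auto simp: hull_less_def split: if_splits dest: lex.less_asym)
  have total: "hull_less S a b \<or> a = b \<or> hull_less S b a" for a b
    using lex.less_linear[of a b] by (auto simp: hull_less_def)
  show "class.linorder (hull_le S) (hull_less S)"
    by unfold_locales (use trans asym total in \<open>unfold hull_le_def, blast+\<close>)
qed

lemma hull_less_turn:
  assumes "hull_less S a b" "hull_less S b c"
  shows "a <\<^sub>L b \<and> b <\<^sub>L c \<and> \<not> lower_chain S b \<or> a <\<^sub>L c \<and> c <\<^sub>L b \<and> lower_chain S c \<or>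
    c <\<^sub>L a \<and> a <\<^sub>L b \<and> \<not> lower_chain S a \<or> c <\<^sub>L b \<and> b <\<^sub>L a \<and> lower_chain S b"
  using assms lex.less_linear[of a b] lex.less_linear[of a c] lex.less_linear[of b c]
  unfolding hull_less_def by (auto split: if_splits)

locale convex_boundary =
  fixes S H :: "point set"
  assumes convex: "convex H" and subset: "S \<subseteq> H" and boundary: "S \<subseteq> frontier H"
begin

lemma supporting_line:
  assumes "x \<in> S"
  obtains d where "d \<noteq> 0" "\<And>y. y \<in> H \<Longrightarrow> 0 \<le> det2 d (y - x)"
proof -
  obtain a where a: "a \<noteq> 0" "\<And>y. y \<in> H \<Longrightarrow> a \<bullet> x \<le> a \<bullet> y"
    using supporting_hyperplane_frontier[OF convex] subset boundary assms by (metis subsetD)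
  show ?thesis
  proof
    show "(snd a, - fst a) \<noteq> 0" using a(1) by (auto simp: prod_eq_iff)
    show "0 \<le> det2 (snd a, - fst a) (y - x)" if "y \<in> H" for y
      using a(2)[OF that] by (simp add: det2_def inner_prod_def algebra_simps)
  qed
qed

lemma same_turns:
  assumes "b \<in> S"
  shows "(\<forall>a\<in>H. \<forall>c\<in>H. a <\<^sub>L b \<and> b <\<^sub>L c \<longrightarrow> 0 \<le> orient a b c) \<or>
    (\<forall>a\<in>H. \<forall>c\<in>H. a <\<^sub>L b \<and> b <\<^sub>L c \<longrightarrow> orient a b c \<le> 0)"
proof -
  obtain d where d: "d \<noteq> 0" "\<And>y. y \<in> H \<Longrightarrow> 0 \<le> det2 d (y - b)" using supporting_line[OF assms] by blast
  have minus: "det2 (- u) v = - det2 u v" "det2 u (x - y) = - det2 u (y - x)" "det2 u v = - det2 v u"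
    for u v x y
    by (simp_all add: det2_def algebra_simps)
  have pos: "0 <\<^sub>L b - a" "0 <\<^sub>L c - b" if "a <\<^sub>L b" "b <\<^sub>L c" for a c
    using that lex_less_iff_diff by blast+
  from lex_pos_uminus[OF d(1)] show ?thesis
  proof
    assume left: "0 <\<^sub>L d"
    have "0 \<le> orient a b c" if "a \<in> H" "c \<in> H" "a <\<^sub>L b" "b <\<^sub>L c" for a c
      using det2_lex_pos_mono[OF left pos(2,1)[OF that(3,4)]] d(2)[OF that(1)] d(2)[OF that(2)]
        minus(2)[of d b a]
      by (simp add: orient_eq_det2_steps)
    then show ?thesis by blast
  next
    assume right: "0 <\<^sub>L - d"
    have "orient a b c \<le> 0" if "a \<in> H" "c \<in> H" "a <\<^sub>L b" "b <\<^sub>L c" for a c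
      using det2_lex_pos_mono[OF right pos[OF that(3,4)]] d(2)[OF that(1)] d(2)[OF that(2)] minus(2)[of d b a]
        minus(3)[of "c - b" "b - a"]
      by (simp add: orient_eq_det2_steps minus(1))
    then show ?thesis by blast
  qed
qed

lemma orient_lower_chain:
  assumes "a \<in> S" "b \<in> S" "c \<in> S" "a <\<^sub>L b" "b <\<^sub>L c"
  shows "lower_chain S b \<Longrightarrow> 0 \<le> orient a b c" "\<not> lower_chain S b \<Longrightarrow> orient a b c \<le> 0"
  using assms same_turns[OF assms(2)] subset unfolding lower_chain_def by (meson not_le subsetD)+

lemma hull_less_orient:
  assumes "a \<in> S" "b \<in> S" "c \<in> S" "hull_less S a b" "hull_less S b c"
  shows "orient a b c \<le> 0"
proof -
  consider (upper_b) "a <\<^sub>L b" "b <\<^sub>L c" "\<not> lower_chain S b"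
    | (lower_c) "a <\<^sub>L c" "c <\<^sub>L b" "lower_chain S c"
    | (upper_a) "c <\<^sub>L a" "a <\<^sub>L b" "\<not> lower_chain S a"
    | (lower_b) "c <\<^sub>L b" "b <\<^sub>L a" "lower_chain S b"
    using hull_less_turn[OF assms(4,5)] by blast
  then show ?thesis
  proof cases
    case upper_b
    then show ?thesis using orient_lower_chain(2) assms(1-3) by blast
  next
    case lower_c
    then have "0 \<le> orient a c b" using orient_lower_chain(1) assms(1-3) by blast
    then show ?thesis using orient_swap(2)[of a c b] by simp
  next
    case upper_a
    then have "orient c a b \<le> 0" using orient_lower_chain(2) assms(1-3) by blast
    then show ?thesis using orient_rotate[of c a b] by simp
  next
    case lower_b
    then have "0 \<le> orient c b a" using orient_lower_chain(1) assms(1-3) by blast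
    then show ?thesis using orient_rotate[of c a b] orient_swap(2)[of c b a] by simp
  qed
qed

end

section \<open>Alternating points on a convex boundary\<close>

definition separated :: "point \<Rightarrow> point \<Rightarrow> point \<Rightarrow> point \<Rightarrow> bool" where
  "separated a c b d \<longleftrightarrow> b \<in> closed_segment a c \<or> d \<in> closed_segment a c \<or> orient a c b * orient a c d < 0"

definition interleaved :: "point \<Rightarrow> point \<Rightarrow> point \<Rightarrow> point \<Rightarrow> bool" where
  "interleaved a b c d \<longleftrightarrow> a \<noteq> c \<and> b \<noteq> d \<and> separated a c b d \<and> separated b d c a"

lemma separated_commute:
  "separated c a b d = separated a c b d" "separated a c d b = separated a c b d"
proof -
  have "orient c a x = - orient a c x" for x by (rule orient_swap(1))
  then show "separated c a b d = separated a c b d" by (simp add: separated_def closed_segment_commute)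
qed (auto simp: separated_def mult.commute)

lemma interleaved_rotate: "interleaved a b c d = interleaved b c d a"
  using separated_commute by (auto simp: interleaved_def)

lemma in_closed_segment_orient:
  assumes "orient a c b = 0" "a \<noteq> c" "orient a c x \<noteq> 0"
    and "0 \<le> orient a b x * orient a c x" "0 \<le> orient b c x * orient a c x"
  shows "b \<in> closed_segment a c"
proof -
  obtain r where r: "b = a + r *\<^sub>R (c - a)" using orient_eq_0D assms(1,2) by blast
  have "0 \<le> r * (orient a c x * orient a c x)" "0 \<le> (1 - r) * (orient a c x * orient a c x)"
    using assms(4,5) unfolding r orient_line by (simp_all add: mult.assoc)
  moreover have "0 < orient a c x * orient a c x" using assms(3) not_real_square_gt_zero by blast
  ultimately have "0 \<le> r" "r \<le> 1" by (simp_all add: zero_le_mult_iff)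
  then show ?thesis unfolding r by (rule closed_segment_lineI)
qed

lemma clockwise_separated:
  assumes "a \<noteq> c" and turns: "orient a b c \<le> 0" "orient b c d \<le> 0" "orient c d a \<le> 0" "orient d a b \<le> 0"
    and "orient a c b \<noteq> 0 \<or> orient a c d \<noteq> 0"
  shows "separated a c b d"
proof -
  have signs: "0 \<le> orient a c b" "orient a c d \<le> 0" "orient a b d \<le> 0" "0 \<le> orient a d b"
      "0 \<le> orient d c b"
    using turns orient_swap(2)[of a c b] orient_rotate[of a c d] orient_rotate[of d a b]
      orient_swap(2)[of a d b]
      orient_rotate[of b d c] orient_swap(2)[of b d c] by simp_all
  consider (strict) "orient a c b \<noteq> 0" "orient a c d \<noteq> 0"
    | (b_on_line) "orient a c b = 0" "orient a c d \<noteq> 0"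
    | (d_on_line) "orient a c b \<noteq> 0" "orient a c d = 0" using assms(6) by blast
  then show ?thesis
  proof cases
    case strict
    then have "orient a c b * orient a c d < 0" using signs(1,2) by (simp add: mult_less_0_iff)
    then show ?thesis by (simp add: separated_def)
  next
    case b_on_line
    then have "b \<in> closed_segment a c"
      using assms(1) signs turns(2) by (intro in_closed_segment_orient) (auto intro: mult_nonpos_nonpos)
    then show ?thesis by (simp add: separated_def)
  next
    case d_on_line
    then have "d \<in> closed_segment a c"
      using assms(1) signs by (intro in_closed_segment_orient[of a c d b]) auto
    then show ?thesis by (simp add: separated_def)
  qed
qed

lemma collinear_separated:
  assumes "orient a b c = 0" "orient a d c = 0" "lex_between a b c \<or> lex_between a d c"
  shows "separated a c b d"
  using assms(3)
proof
  assume "lex_between a b c"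
  from collinear_lex_between[OF assms(1) this] show ?thesis
    by (metis closed_segment_lineI less_imp_le separated_def)
next
  assume "lex_between a d c"
  from collinear_lex_between[OF assms(2) this] show ?thesis
    by (metis closed_segment_lineI less_imp_le separated_def)
qed

context convex_boundary
begin

lemma lower_chain_collinear:
  assumes zw: "z \<in> S" "w \<in> S" and b: "lex_between z b w" "orient z b w = 0" "lower_chain S b"
    and x: "lex_between z x w" "orient z x w = 0"
  shows "lower_chain S x"
proof -
  have goal: "lower_chain S x" if zw: "z \<in> S" "w \<in> S" and b: "z <\<^sub>L b" "b <\<^sub>L w" "orient z b w = 0"
    and x: "z <\<^sub>L x" "x <\<^sub>L w" "orient z x w = 0" for z w
  proof -
    obtain a c where ac: "a \<in> S" "c \<in> S" "a <\<^sub>L b" "b <\<^sub>L c" "0 < orient a b c"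
      using \<open>lower_chain S b\<close> unfolding lower_chain_def by blast
    have pos: "0 <\<^sub>L w - z" "0 <\<^sub>L b - a" "0 <\<^sub>L c - b"
      using b ac lex_less_iff_diff lex.less_trans by blast+
    have "\<not> (orient z w a \<le> 0 \<and> orient z w c \<le> 0)"
    proof
      assume "orient z w a \<le> 0 \<and> orient z w c \<le> 0"
      then have "0 \<le> det2 (w - z) (b - a)" "det2 (w - z) (c - b) \<le> 0"
        using b(3) by (auto simp: orient_def det2_def algebra_simps)
      then have "0 \<le> det2 (c - b) (b - a)" using det2_lex_pos_mono pos by blast
      then show False using ac(5) by (simp add: orient_def det2_def algebra_simps)
    qed
    then obtain y where y: "y \<in> S" "0 < orient z w y" using ac(1,2) by (meson not_le)
    obtain r where r: "0 < r" "r < 1" "x = z + r *\<^sub>R (w - z)"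
      using collinear_lex_between[OF x(3)] x(1,2) by (auto simp: lex_between_def)
    have "0 < orient z x y" "0 < orient y x w"
      using y(2) r orient_rotate[of y x w] by (simp_all add: r(3) orient_line)
    moreover have "y \<noteq> x" using y(2) x(3) orient_swap(2)[of z x w] by auto
    ultimately show ?thesis
      using lex.less_linear[of x y] y(1) zw x(1,2) unfolding lower_chain_def by blast
  qed
  have "orient w b z = 0" "orient w x z = 0"
    using b(2) x(2) orient_rotate[of z b w] orient_rotate[of z x w] orient_swap(1)[of w b z]
      orient_swap(1)[of w x z]
    by simp_all
  moreover have "z <\<^sub>L b \<and> b <\<^sub>L w \<and> z <\<^sub>L x \<and> x <\<^sub>L w \<or> w <\<^sub>L b \<and> b <\<^sub>L z \<and> w <\<^sub>L x \<and> x <\<^sub>L z"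
    using b(1) x(1) unfolding lex_between_def by (meson lex.less_asym lex.less_trans)
  ultimately show ?thesis using goal zw b(2) x(2) by blast
qed

lemma hull_less_collinear_lex_between:
  assumes "a \<in> S" "b \<in> S" "c \<in> S" "d \<in> S" "hull_less S a b" "hull_less S b c" "hull_less S c d"
    and col: "\<And>x y z. x \<in> {a, b, c, d} \<Longrightarrow> y \<in> {a, b, c, d} \<Longrightarrow> z \<in> {a, b, c, d} \<Longrightarrow> orient x y z = 0"
  shows "lex_between a b c \<or> lex_between a d c" "lex_between b a d \<or> lex_between b c d"
proof -
  have order: "hull_less S a c" "hull_less S b d" using assms(5-7) hull.less_trans by blast+
  show "lex_between a b c \<or> lex_between a d c"
  proof (rule ccontr)
    assume "\<not> ?thesis"
    then have "d <\<^sub>L a \<and> a <\<^sub>L c \<and> c <\<^sub>L b \<or> d <\<^sub>L c \<and> c <\<^sub>L a \<and> a <\<^sub>L b"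
      and lower: "lower_chain S c" "\<not> lower_chain S a"
      using hull_less_turn[OF assms(5,6)] hull_less_turn[OF order(1) assms(7)]
        lex.less_asym[of a c] lex.less_asym[of a b] lex.less_asym[of b c] unfolding lex_between_def by blast+
    then have "lex_between d c b" "lex_between d a b"
      unfolding lex_between_def using lex.less_trans by blast+
    then show False
      using lower_chain_collinear[of d b c a] assms(2,4) col[of d c b] col[of d a b] lower by simp
  qed
  show "lex_between b a d \<or> lex_between b c d"
  proof (rule ccontr)
    assume "\<not> ?thesis"
    then have "a <\<^sub>L b \<and> b <\<^sub>L d \<and> d <\<^sub>L c \<or> a <\<^sub>L d \<and> d <\<^sub>L b \<and> b <\<^sub>L c"
      and lower: "lower_chain S d" "\<not> lower_chain S b"
      using hull_less_turn[OF assms(6,7)] hull_less_turn[OF assms(5) order(2)]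
        lex.less_asym[of b d] lex.less_asym[of a b] lex.less_asym[of a d] unfolding lex_between_def by blast+
    then have "lex_between a d c" "lex_between a b c"
      unfolding lex_between_def using lex.less_trans by blast+
    then show False
      using lower_chain_collinear[of a c d b] assms(1,3) col[of a d c] col[of a b c] lower by simp
  qed
qed

lemma hull_less_interleaved:
  assumes S: "a \<in> S" "b \<in> S" "c \<in> S" "d \<in> S"
    and order: "hull_less S a b" "hull_less S b c" "hull_less S c d"
  shows "interleaved a b c d"
proof -
  have order': "hull_less S a c" "hull_less S b d" using order hull.less_trans by blast+
  then have distinct: "a \<noteq> c" "b \<noteq> d" "c \<noteq> a" "a \<noteq> b" by (metis hull.less_irrefl order(1))+
  have turns: "orient a b c \<le> 0" "orient b c d \<le> 0" "orient c d a \<le> 0" "orient d a b \<le> 0"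
    using hull_less_orient[OF S(1,2,3) order(1,2)] hull_less_orient[OF S(2,3,4) order(2,3)]
      hull_less_orient[OF S(1,3,4) order'(1) order(3)] hull_less_orient[OF S(1,2,4) order(1) order'(2)]
      orient_rotate[of a c d] orient_rotate[of d a b] by simp_all
  have "separated a c b d \<and> separated b d c a"
  proof (cases "(orient a c b = 0 \<and> orient a c d = 0) \<or> (orient b d c = 0 \<and> orient b d a = 0)")
    case True
    then obtain u v where uv: "u \<noteq> v" "\<forall>x\<in>{a, b, c, d}. orient u v x = 0"
      using distinct(1,2) by (auto intro: that[of a c] that[of b d])
    then have "orient x y z = 0" if "x \<in> {a, b, c, d}" "y \<in> {a, b, c, d}" "z \<in> {a, b, c, d}" for x y z
      using that orient_eq_0_trans by blast
    note col = this
    show ?thesis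
      using hull_less_collinear_lex_between[OF S order col] by (auto intro: collinear_separated col)
  next
    case False
    then show ?thesis
      using clockwise_separated[OF distinct(1) turns] clockwise_separated[OF distinct(2) turns(2,3,4,1)] by blast
  qed
  then show ?thesis using distinct by (simp add: interleaved_def)
qed

lemma collinear_beyond_corner:
  assumes "a \<in> S" "c \<in> S" "b \<in> H" "d \<in> H" "a \<noteq> c" "orient a c b * orient a c d < 0"
    and y: "a + r *\<^sub>R (c - a) \<in> H"
  shows "r \<le> 1"
proof (rule ccontr)
  assume r: "\<not> r \<le> 1"
  obtain n where n: "n \<noteq> 0" "\<And>y. y \<in> H \<Longrightarrow> 0 \<le> det2 n (y - c)" using supporting_line[OF assms(2)] by blast
  have "0 \<le> det2 n (a - c)" using n(2) assms(1) subset by blast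
  moreover have "0 \<le> (1 - r) * det2 n (a - c)"
    using n(2)[OF y] by (simp add: det2_def algebra_simps)
  ultimately have "det2 n (a - c) = 0" using r by (simp add: zero_le_mult_iff)
  then obtain l where l: "a - c = l *\<^sub>R n" using det2_eq_0D n(1) by blast
  have "orient a c x = - (l * det2 n (x - c))" for x
  proof -
    have "orient a c x = - det2 (a - c) (x - c)" by (simp add: orient_def det2_def algebra_simps)
    then show ?thesis by (simp add: l det2_def algebra_simps)
  qed
  then have "orient a c b * orient a c d = (l * l) * (det2 n (b - c) * det2 n (d - c))" by simp
  also have "\<dots> \<ge> 0" using n(2) assms(3,4) by simp
  finally show False using assms(6) by simp
qed

lemma chord_Int:
  assumes "a \<in> S" "c \<in> S" "b \<in> H" "d \<in> H" "a \<noteq> c" "orient a c b * orient a c d < 0"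
    and y: "y \<in> H" "orient a c y = 0"
  shows "y \<in> closed_segment a c"
proof -
  obtain r where r: "y = a + r *\<^sub>R (c - a)" using orient_eq_0D y(2) assms(5) by blast
  have "r \<le> 1" using collinear_beyond_corner assms(1-6) y(1) unfolding r by blast
  moreover have "1 - r \<le> 1"
  proof (rule collinear_beyond_corner[of c a b d])
    show "orient c a b * orient c a d < 0"
      using assms(6) orient_swap(1)[of c a b] orient_swap(1)[of c a d] by simp
    show "c + (1 - r) *\<^sub>R (a - c) \<in> H" using y(1) by (simp add: r algebra_simps)
  qed (use assms in auto)
  ultimately show ?thesis unfolding r by (intro closed_segment_lineI) auto
qed

lemma segment_crosses_chord:
  assumes "a \<in> S" "c \<in> S" "b \<in> H" "d \<in> H" "a \<noteq> c" "orient a c b * orient a c d < 0"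
    and xy: "x \<in> H" "y \<in> H" "orient a c x * orient a c y \<le> 0"
  shows "closed_segment x y \<inter> closed_segment a c \<noteq> {}"
proof -
  define n where "n = (- snd (c - a), fst (c - a))"
  have n: "orient a c z = n \<bullet> z - n \<bullet> a" for z
    by (simp add: n_def orient_def det2_def inner_prod_def algebra_simps)
  have "\<exists>z\<in>closed_segment x y. n \<bullet> z = n \<bullet> a"
    using xy(3) connected_ivt_hyperplane[of "closed_segment x y" x y n "n \<bullet> a"]
      connected_ivt_hyperplane[of "closed_segment x y" y x n "n \<bullet> a"]
    by (auto simp: n mult_le_0_iff)
  then obtain z where z: "z \<in> closed_segment x y" "orient a c z = 0" by (auto simp: n)
  moreover have "z \<in> H" using z(1) xy(1,2) convex closed_segment_subset by blast
  ultimately have "z \<in> closed_segment a c" using chord_Int assms(1-6) by blast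
  then show ?thesis using z(1) by blast
qed

end

section \<open>Nearest sites\<close>

text \<open>
  Ties are broken lexicographically, since of two sites on opposite sides of \<open>p\<close> one is smaller than
  \<open>p\<close>. This excludes four sites seen from \<open>p\<close> at right angles.
\<close>

definition nearest_site :: "point set \<Rightarrow> point \<Rightarrow> point \<Rightarrow> bool" where
  "nearest_site Q x p \<longleftrightarrow> p \<in> Q \<and> (\<forall>q\<in>Q. dist x p < dist x q \<or> dist x p = dist x q \<and> p \<le>\<^sub>L q)"

lemma nearest_siteD:
  assumes "nearest_site Q x p"
  shows "p \<in> Q" "q \<in> Q \<Longrightarrow> dist x p \<le> dist x q"
  using assms unfolding nearest_site_def less_eq_real_def by blast+

lemma nearest_site_unique:
  assumes "nearest_site Q x p" "nearest_site Q x q"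
  shows "p = q"
proof -
  have "p \<in> Q" "q \<in> Q" using assms nearest_siteD(1) by blast+
  then have "dist x p < dist x q \<or> dist x p = dist x q \<and> p \<le>\<^sub>L q"
    "dist x q < dist x p \<or> dist x q = dist x p \<and> q \<le>\<^sub>L p"
    using assms unfolding nearest_site_def by blast+
  then have "p \<le>\<^sub>L q" "q \<le>\<^sub>L p" by linarith+
  then show ?thesis by (rule lex.order.antisym)
qed

lemma nearest_site_exists:
  assumes "finite Q" "Q \<noteq> {}"
  shows "\<exists>p. nearest_site Q x p"
proof -
  define m where "m = Min (dist x ` Q)"
  define N where "N = {q \<in> Q. dist x q = m}"
  have N_iff: "q \<in> N \<longleftrightarrow> q \<in> Q \<and> dist x q = m" for q by (simp add: N_def)
  have "m \<in> dist x ` Q" using assms by (simp add: m_def)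
  then obtain q where "q \<in> N" unfolding N_iff by blast
  moreover have "finite N" using assms(1) by (simp add: N_def)
  ultimately have Min: "lex.Min N \<in> N" "\<And>q. q \<in> N \<Longrightarrow> lex.Min N \<le>\<^sub>L q"
    using lex.Min_in lex.Min_le by blast+
  have "nearest_site Q x (lex.Min N)"
    unfolding nearest_site_def
  proof (intro conjI ballI)
    show "lex.Min N \<in> Q" using Min(1) unfolding N_iff by (rule conjunct1)
    fix q assume q: "q \<in> Q"
    have "m \<le> dist x q" using q assms(1) by (simp add: m_def)
    moreover have "dist x (lex.Min N) = m" using Min(1) unfolding N_iff by (rule conjunct2)
    ultimately consider (closer) "dist x (lex.Min N) < dist x q"
      | (tie) "dist x (lex.Min N) = dist x q" "dist x q = m"
      by linarith
    then show "dist x (lex.Min N) < dist x q \<or> dist x (lex.Min N) = dist x q \<and> lex.Min N \<le>\<^sub>L q"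
    proof cases
      case tie
      then have "q \<in> N" using q unfolding N_iff by blast
      then show ?thesis using tie Min(2) by blast
    qed (rule disjI1)
  qed
  then show ?thesis ..
qed

lemma
  fixes x p q :: "'a::real_inner"
  shows dist_le_iff_inner: "dist x p \<le> dist x q \<longleftrightarrow> 2 * ((q - p) \<bullet> (x - p)) \<le> (q - p) \<bullet> (q - p)"
    and dist_less_iff_inner: "dist x p < dist x q \<longleftrightarrow> 2 * ((q - p) \<bullet> (x - p)) < (q - p) \<bullet> (q - p)"
proof -
  have "(x - q) \<bullet> (x - q) = (x - p) \<bullet> (x - p) - 2 * ((q - p) \<bullet> (x - p)) + (q - p) \<bullet> (q - p)"
    by (simp add: inner_diff_left inner_diff_right inner_commute)
  then show "dist x p \<le> dist x q \<longleftrightarrow> 2 * ((q - p) \<bullet> (x - p)) \<le> (q - p) \<bullet> (q - p)"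
    "dist x p < dist x q \<longleftrightarrow> 2 * ((q - p) \<bullet> (x - p)) < (q - p) \<bullet> (q - p)"
    unfolding dist_norm norm_le norm_lt by linarith+
qed

lemma
  fixes p q :: "'a::real_inner"
  shows convex_dist_le: "convex {x. dist x p \<le> dist x q}"
    and convex_dist_less: "convex {x. dist x p < dist x q}"
proof -
  let ?b = "(q - p) \<bullet> p + (q - p) \<bullet> (q - p) / 2"
  have halve: "2 * (r - s) \<le> d \<longleftrightarrow> r \<le> s + d / 2" "2 * (r - s) < d \<longleftrightarrow> r < s + d / 2" for r s d :: real
    by auto
  have "dist x p \<le> dist x q \<longleftrightarrow> (q - p) \<bullet> x \<le> ?b" "dist x p < dist x q \<longleftrightarrow> (q - p) \<bullet> x < ?b" for x
    unfolding dist_le_iff_inner dist_less_iff_inner inner_diff_right[of _ x p] halve by (rule refl)+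
  then show "convex {x. dist x p \<le> dist x q}" "convex {x. dist x p < dist x q}"
    by (simp_all add: convex_halfspace_le convex_halfspace_lt)
qed

lemma convex_nearest_site: "convex {x. nearest_site Q x p}"
proof (cases "p \<in> Q")
  case True
  let ?D = "\<lambda>q. {x. dist x p < dist x q \<or> dist x p = dist x q \<and> p \<le>\<^sub>L q}"
  have "?D q = (if p \<le>\<^sub>L q then {x. dist x p \<le> dist x q} else {x. dist x p < dist x q})" for q
    by auto
  then have "convex (?D q)" for q by (simp add: convex_dist_le convex_dist_less)
  moreover have "{x. nearest_site Q x p} = (\<Inter>q\<in>Q. ?D q)" using True by (auto simp: nearest_site_def)
  ultimately show ?thesis by (simp add: convex_INT)
qed (simp add: nearest_site_def)

section \<open>Obtuse angles\<close>

lemma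
  fixes p q q' y :: "'a::real_inner"
  assumes y: "y \<in> closed_segment q q'" and "p \<noteq> q" "p \<noteq> q'"
    and closer: "dist y p \<le> dist y q" "dist y p \<le> dist y q'"
  shows inner_le_0_if_closer_on_segment: "(q - p) \<bullet> (q' - p) \<le> 0"
    and inner_less_0_if_closer_on_segment:
      "dist y p < dist y q \<or> dist y p < dist y q' \<Longrightarrow> (q - p) \<bullet> (q' - p) < 0"
proof -
  define N N' c where "N = (q - p) \<bullet> (q - p)" "N' = (q' - p) \<bullet> (q' - p)" "c = (q - p) \<bullet> (q' - p)"
  note defs = this
  have pos: "N > 0" "N' > 0" using assms(2,3) by (auto simp: defs)
  obtain r where r: "0 \<le> r" "r \<le> 1" "y = (1 - r) *\<^sub>R q + r *\<^sub>R q'" using y by (auto simp: in_segment)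
  have "y - p = (1 - r) *\<^sub>R (q - p) + r *\<^sub>R (q' - p)" by (simp add: r algebra_simps)
  then have inner: "(q - p) \<bullet> (y - p) = (1 - r) * N + r * c" "(q' - p) \<bullet> (y - p) = (1 - r) * c + r * N'"
    by (simp_all add: defs inner_add_right inner_commute[of "q' - p" "q - p"])
  have weighted: "(1 - 2 * r) * N + 2 * (r * c) \<le> 0" "(2 * r - 1) * N' + 2 * ((1 - r) * c) \<le> 0"
    using closer[unfolded dist_le_iff_inner inner, folded defs] by (simp_all add: algebra_simps)
  have half: "r = 1 / 2" if "0 \<le> c"
  proof -
    have "0 \<le> r * c" "0 \<le> (1 - r) * c" using r that by auto
    then have "(1 - 2 * r) * N \<le> 0" "(2 * r - 1) * N' \<le> 0" using weighted by linarith+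
    then show ?thesis using pos by (simp add: mult_le_0_iff)
  qed
  show "(q - p) \<bullet> (q' - p) \<le> 0"
  proof (rule ccontr)
    assume "\<not> ?thesis"
    then have "0 < c" by (simp add: defs)
    then have r: "r = 1 / 2" using half by simp
    show False using weighted(1) \<open>0 < c\<close> unfolding r by simp
  qed
  show "(q - p) \<bullet> (q' - p) < 0" if "dist y p < dist y q \<or> dist y p < dist y q'"
  proof (rule ccontr)
    assume "\<not> ?thesis"
    then have "0 \<le> c" by (simp add: defs)
    then have r: "r = 1 / 2" using half by simp
    show False using that[unfolded dist_less_iff_inner inner, folded defs] \<open>0 \<le> c\<close> unfolding r by auto
  qed
qed

lemma pos_combination_eq_0_imp_empty:
  fixes B :: "'a::real_vector set"
  assumes "finite B" "0 \<notin> convex hull B" "\<And>v. v \<in> B \<Longrightarrow> 0 < u v" "(\<Sum>v\<in>B. u v *\<^sub>R v) = 0"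
  shows "B = {}"
proof (rule ccontr)
  assume "B \<noteq> {}"
  define U where "U = sum u B"
  have "U > 0" unfolding U_def using assms(1,3) \<open>B \<noteq> {}\<close> by (simp add: sum_pos)
  have "(\<Sum>v\<in>B. (u v / U) *\<^sub>R v) \<in> convex hull B"
  proof (rule convex_sum)
    show "(\<Sum>v\<in>B. u v / U) = 1" using \<open>U > 0\<close> by (simp add: U_def sum_divide_distrib[symmetric])
  qed (use assms(1,3) \<open>U > 0\<close> in \<open>auto simp: less_imp_le hull_inc\<close>)
  moreover have "(\<Sum>v\<in>B. (u v / U) *\<^sub>R v) = (1 / U) *\<^sub>R (\<Sum>v\<in>B. u v *\<^sub>R v)"
    by (simp add: scaleR_sum_right)
  ultimately show False using assms(2,4) by simp
qed

text \<open>
  In a linear relation, move the negative terms to the other side. The inner product of the two sides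
  is nonpositive, hence both sides vanish.
\<close>

lemma independent_if_obtuse:
  fixes B :: "'a::real_inner set"
  assumes "finite B" "0 \<notin> convex hull B" and obtuse: "\<And>v w. v \<in> B \<Longrightarrow> w \<in> B \<Longrightarrow> v \<noteq> w \<Longrightarrow> v \<bullet> w \<le> 0"
  shows "independent B"
proof
  assume "dependent B"
  then obtain u where u: "\<exists>v\<in>B. u v \<noteq> 0" "(\<Sum>v\<in>B. u v *\<^sub>R v) = 0" using assms(1) by (auto simp: dependent_finite)
  define P N where "P = {v \<in> B. 0 < u v}" and "N = {v \<in> B. u v < 0}"
  define s where "s = (\<Sum>v\<in>P. u v *\<^sub>R v)"
  have fin: "finite P" "finite N" using assms(1) by (simp_all add: P_def N_def)
  have "(\<Sum>v\<in>B. u v *\<^sub>R v) = (\<Sum>v\<in>P \<union> N. u v *\<^sub>R v)"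
    by (rule sum.mono_neutral_right) (use assms(1) in \<open>auto simp: P_def N_def\<close>)
  also have "\<dots> = s + (\<Sum>v\<in>N. u v *\<^sub>R v)"
    unfolding s_def by (rule sum.union_disjoint) (use fin in \<open>auto simp: P_def N_def\<close>)
  finally have N: "(\<Sum>v\<in>N. u v *\<^sub>R v) = - s" using u(2) by (simp add: eq_neg_iff_add_eq_0 add.commute)
  have "0 \<le> s \<bullet> (\<Sum>w\<in>N. u w *\<^sub>R w)"
    unfolding s_def inner_sum_left inner_sum_right
  proof (intro sum_nonneg)
    fix v w assume "v \<in> P" "w \<in> N"
    then have vw: "v \<in> B" "w \<in> B" "0 < u v" "u w < 0" by (auto simp: P_def N_def)
    then have "v \<bullet> w \<le> 0" "u v * u w < 0" using obtuse[of v w] by (force intro: mult_pos_neg)+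
    then show "0 \<le> (u v *\<^sub>R v) \<bullet> (u w *\<^sub>R w)"
      using mult_nonpos_nonpos[of "u v * u w" "v \<bullet> w"] by (simp add: ac_simps)
  qed
  then have "s \<bullet> s \<le> 0" unfolding N by simp
  from leD[OF this] have "s = 0" unfolding inner_gt_zero_iff by blast
  have "0 \<notin> convex hull A" if "A \<subseteq> B" for A using hull_mono[OF that, of convex] assms(2) by blast
  then have hull: "0 \<notin> convex hull P" "0 \<notin> convex hull N" by (simp_all add: P_def N_def)
  have "P = {}"
    by (rule pos_combination_eq_0_imp_empty[of P u]) (use fin hull \<open>s = 0\<close> in \<open>auto simp: s_def P_def\<close>)
  moreover have "N = {}"
  proof (rule pos_combination_eq_0_imp_empty[of N "\<lambda>v. - u v"])
    show "(\<Sum>v\<in>N. - u v *\<^sub>R v) = 0" using N \<open>s = 0\<close> by (simp add: sum_negf)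
  qed (use fin hull in \<open>auto simp: N_def\<close>)
  ultimately have "u v = 0" if "v \<in> B" for v using that by (simp add: P_def N_def) (meson linorder_neqE)
  then show False using u(1) by blast
qed

lemma no_three_obtuse_in_cone:
  fixes u v w :: point
  assumes "convex C" "0 \<notin> C" and C: "u \<in> C" "v \<in> C" "w \<in> C"
    and obtuse: "u \<bullet> v \<le> 0" "u \<bullet> w \<le> 0" "v \<bullet> w \<le> 0"
  shows False
proof -
  have "u \<noteq> 0" "v \<noteq> 0" using assms(2) C by auto
  then have "0 < u \<bullet> u" "0 < v \<bullet> v" by simp_all
  then have "u \<noteq> v" "u \<noteq> w" "v \<noteq> w" using obtuse by (metis not_le)+
  then have "card {u, v, w} = 3" by simp
  moreover have "0 \<notin> convex hull {u, v, w}" using hull_minimal[of "{u, v, w}" C convex] assms(1,2) C by auto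
  then have "independent {u, v, w}"
    using obtuse by (intro independent_if_obtuse) (auto simp: inner_commute)
  then have "card {u, v, w} \<le> 2" using independent_bound[of "{u, v, w}"] by simp
  ultimately show False by simp
qed

definition obtuse :: "point \<Rightarrow> point \<Rightarrow> point \<Rightarrow> bool" where
  "obtuse p q r \<longleftrightarrow> (q - p) \<bullet> (r - p) \<le> 0 \<and> (q <\<^sub>L p \<or> r <\<^sub>L p \<longrightarrow> (q - p) \<bullet> (r - p) < 0)"

lemma obtuse_sym: "obtuse p q r \<Longrightarrow> obtuse p r q"
  by (auto simp: obtuse_def inner_commute)

lemma no_four_obtuse:
  assumes "obtuse p a b" "obtuse p a c" "obtuse p a d" "obtuse p b c" "obtuse p b d" "obtuse p c d"
    and "a \<noteq> p" "b \<noteq> p" "c \<noteq> p"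
  shows False
proof -
  have above: "p <\<^sub>L x"
    if "obtuse p x y" "obtuse p x z" "obtuse p x w" "obtuse p y z" "obtuse p y w" "obtuse p z w" "x \<noteq> p"
      for x y z w
  proof (rule ccontr)
    assume "\<not> p <\<^sub>L x"
    then have "x <\<^sub>L p" using that(7) lex.less_linear[of x p] by blast
    then show False
      using no_three_obtuse_in_cone[of "{v. (x - p) \<bullet> v < 0}" "y - p" "z - p" "w - p"] that
      by (auto simp: obtuse_def convex_halfspace_lt)
  qed
  note sym = assms(1,2,4)[THEN obtuse_sym]
  have "p <\<^sub>L a" "p <\<^sub>L b" "p <\<^sub>L c"
    using above[OF assms(1-7)] above[OF sym(1) assms(4,5,2,3,6,8)] above[OF sym(2,3) assms(6,1,3,5,9)] .
  then have "0 <\<^sub>L a - p" "0 <\<^sub>L b - p" "0 <\<^sub>L c - p" by (simp_all only: lex_less_iff_diff[of p])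
  then show False
    using no_three_obtuse_in_cone[OF convex_lex_pos, of "a - p" "b - p" "c - p"] assms(1,2,4)
    by (simp add: obtuse_def)
qed

text \<open>
  The polyline \<open>b, q, q', d\<close> connects the two sides of the chord \<open>a c\<close>. The chord is contained in the
  convex cell of \<open>p\<close>, which is disjoint from the segments \<open>b q\<close> and \<open>q' d\<close>.
\<close>

lemma (in convex_boundary) separated_obtuse:
  assumes S: "a \<in> S" "b \<in> S" "c \<in> S" "d \<in> S" and "Q \<subseteq> H" "a \<noteq> c" "separated a c b d"
    and near: "nearest_site Q a p" "nearest_site Q c p" "nearest_site Q b q" "nearest_site Q d q'"
    and distinct: "p \<noteq> q" "p \<noteq> q'"
  shows "obtuse p q q'"
proof -
  have Q: "q \<in> Q" "q' \<in> Q" using near(3,4) nearest_siteD(1) by blast+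
  have H: "b \<in> H" "d \<in> H" "q \<in> H" "q' \<in> H" using S(2,4) Q \<open>Q \<subseteq> H\<close> subset by blast+
  have cell: "closed_segment x y \<subseteq> {z. nearest_site Q z r}"
    if "nearest_site Q x r" "nearest_site Q y r" for x y r
    using that by (intro closed_segment_subset convex_nearest_site) auto
  have disjoint: "closed_segment x r \<inter> closed_segment a c = {}" if "nearest_site Q x r" "p \<noteq> r" for x r
  proof -
    have "nearest_site Q r r" using that(1) by (simp add: nearest_site_def)
    then have "closed_segment x r \<subseteq> {z. nearest_site Q z r}" using that(1) by (intro cell)
    then show ?thesis using cell[OF near(1,2)] nearest_site_unique[of Q _ p r] that(2) by blast
  qed
  have opposite: "orient a c b * orient a c d < 0"
    using \<open>separated a c b d\<close> disjoint[OF near(3) distinct(1)] disjoint[OF near(4) distinct(2)]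
    by (auto simp: separated_def)
  note cross = segment_crosses_chord[OF S(1,3) H(1,2) \<open>a \<noteq> c\<close> opposite]
  have "0 < orient a c b * orient a c q" "0 < orient a c d * orient a c q'"
    using cross[OF H(1,3)] cross[OF H(2,4)] disjoint[OF near(3) distinct(1)] disjoint[OF near(4) distinct(2)]
    by (simp_all add: not_le[symmetric], blast+)
  then have "orient a c q * orient a c q' \<le> 0"
    using opposite by (auto simp: zero_less_mult_iff mult_less_0_iff mult_le_0_iff)
  from cross[OF H(3,4) this] obtain y where y: "y \<in> closed_segment q q'" "nearest_site Q y p"
    using cell[OF near(1,2)] by blast
  have closer: "r <\<^sub>L p \<Longrightarrow> dist y p < dist y r" if "r \<in> Q" for r
    using y(2) that unfolding nearest_site_def lex.not_le[symmetric] by blast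
  note obtuse_angle = y(1) distinct nearest_siteD(2)[OF y(2) Q(1)] nearest_siteD(2)[OF y(2) Q(2)]
  show ?thesis
    unfolding obtuse_def
    using inner_le_0_if_closer_on_segment[OF obtuse_angle] inner_less_0_if_closer_on_segment[OF obtuse_angle]
      closer[OF Q(1)] closer[OF Q(2)] by blast
qed

section \<open>Groups of sources with a common nearest site\<close>

definition alternating :: "(nat \<Rightarrow> point) \<Rightarrow> nat \<Rightarrow> nat \<Rightarrow> bool" where
  "alternating X u v \<longleftrightarrow> (\<forall>i j k l. u \<le> i \<and> i < j \<and> j < k \<and> k < l \<and> l < v \<and>
     X i \<noteq> X j \<and> X j \<noteq> X k \<and> X k \<noteq> X l \<and> X l \<noteq> X i \<longrightarrow> interleaved (X i) (X j) (X k) (X l))"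

lemma alternatingD:
  assumes "alternating X u v" "u \<le> i" "i < j" "j < k" "k < l" "l < v"
    and "X i \<noteq> X j" "X j \<noteq> X k" "X k \<noteq> X l" "X l \<noteq> X i"
  shows "interleaved (X i) (X j) (X k) (X l)"
  using assms unfolding alternating_def by blast

lemma alternating_rotate:
  assumes "alternating X 0 n" and period: "\<And>p. X (p + n) = X p"
  shows "alternating X r (r + n)"
proof (induction r)
  case 0
  then show ?case using assms(1) by simp
next
  case (Suc r)
  show ?case unfolding alternating_def
  proof (intro allI impI, elim conjE)
    fix i j k l
    assume order: "Suc r \<le> i" "i < j" "j < k" "k < l" "l < Suc r + n"
      and distinct: "X i \<noteq> X j" "X j \<noteq> X k" "X k \<noteq> X l" "X l \<noteq> X i"
    show "interleaved (X i) (X j) (X k) (X l)"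
    proof (cases "l = r + n")
      case True
      then have "interleaved (X r) (X i) (X j) (X k)"
        using order distinct period[of r] by (intro alternatingD[OF Suc.IH]) simp_all
      then show ?thesis unfolding True period interleaved_rotate[of "X r"] .
    next
      case False
      then show ?thesis using order distinct by (intro alternatingD[OF Suc.IH]) simp_all
    qed
  qed
qed

lemma (in convex_boundary) alternating_hull_sorted:
  assumes "\<And>i. i < n \<Longrightarrow> X i \<in> S" and sorted: "\<And>i j. i < j \<Longrightarrow> j < n \<Longrightarrow> hull_le S (X i) (X j)"
  shows "alternating X 0 n"
  unfolding alternating_def
proof (intro allI impI, elim conjE)
  fix i j k l
  assume order: "i < j" "j < k" "k < l" "l < n" and "X i \<noteq> X j" "X j \<noteq> X k" "X k \<noteq> X l"
  then have "hull_less S (X i) (X j)" "hull_less S (X j) (X k)" "hull_less S (X k) (X l)"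
    using sorted[of i j] sorted[of j k] sorted[of k l] by (auto simp: hull_le_def)
  then show "interleaved (X i) (X j) (X k) (X l)"
    using order assms(1) by (intro hull_less_interleaved) auto
qed

locale voronoi_cells = convex_boundary +
  fixes Q :: "point set" and g :: "point \<Rightarrow> point" and X :: "nat \<Rightarrow> point" and u v :: nat
  assumes Q: "Q \<subseteq> H" and nearest: "\<And>x. x \<in> S \<Longrightarrow> nearest_site Q x (g x)"
    and in_S: "\<And>i. i < v \<Longrightarrow> X i \<in> S" and alternating: "alternating X u v"
begin

lemma obtuse_sites:
  assumes range: "a < v" "a' < v" "u \<le> b" "b < b'" "b' < v"
    and cell: "g (X a) = p" "g (X a') = p" "g (X b) \<noteq> p" "g (X b') \<noteq> p"
    and between: "b < a" "a < b'" "u \<le> a'" "a' < b \<or> b' < a'"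
  shows "obtuse p (g (X b)) (g (X b'))"
proof -
  have "X a \<noteq> X b" "X a \<noteq> X b'" "X a' \<noteq> X b" "X a' \<noteq> X b'" using cell by metis+
  then have "interleaved (X a') (X b) (X a) (X b') \<or> interleaved (X b) (X a) (X b') (X a')"
    using alternatingD[OF alternating, of a' b a b'] alternatingD[OF alternating, of b a b' a']
      range between by auto
  then have "X a' \<noteq> X a" "separated (X a') (X a) (X b) (X b')"
    using interleaved_rotate[of "X a'"] unfolding interleaved_def by blast+
  moreover have "X x \<in> S" "nearest_site Q (X x) (g (X x))" if "x < v" for x using nearest in_S that by blast+
  then have "nearest_site Q (X a') p" "nearest_site Q (X a) p"
    "nearest_site Q (X b) (g (X b))" "nearest_site Q (X b') (g (X b'))"
    "X a' \<in> S" "X b \<in> S" "X a \<in> S" "X b' \<in> S"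
    using range cell by (metis order.strict_trans)+
  ultimately show ?thesis using separated_obtuse Q cell(3,4) by metis
qed

lemma cells_noncrossing:
  assumes "u \<le> i" "i < j" "j < k" "k < l" "l < v" "g (X i) = g (X k)" "g (X j) = g (X l)"
  shows "g (X i) = g (X j)"
proof (rule ccontr)
  assume different: "g (X i) \<noteq> g (X j)"
  have "obtuse (g (X i)) (g (X j)) (g (X l))"
    by (rule obtuse_sites[of k i]) (use assms(1-6) assms(7)[symmetric] different in simp_all)
  then have "obtuse (g (X i)) (g (X j)) (g (X j))" using assms(7) by simp
  moreover have "0 < (g (X j) - g (X i)) \<bullet> (g (X j) - g (X i))" using different by simp
  ultimately show False by (simp add: obtuse_def)
qed

lemma at_most_three_interruptions:
  assumes order: "u \<le> b\<^sub>0" "b\<^sub>0 < a\<^sub>0" "a\<^sub>0 < b\<^sub>1" "b\<^sub>1 < a\<^sub>1" "a\<^sub>1 < b\<^sub>2" "b\<^sub>2 < a\<^sub>2" "a\<^sub>2 < b\<^sub>3" "b\<^sub>3 < v"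
    and last: "u \<le> a\<^sub>3" "a\<^sub>3 < b\<^sub>0 \<or> b\<^sub>3 < a\<^sub>3" "a\<^sub>3 < v"
    and cell: "g (X a\<^sub>0) = p" "g (X a\<^sub>1) = p" "g (X a\<^sub>2) = p" "g (X a\<^sub>3) = p"
    and other: "g (X b\<^sub>0) \<noteq> p" "g (X b\<^sub>1) \<noteq> p" "g (X b\<^sub>2) \<noteq> p" "g (X b\<^sub>3) \<noteq> p"
  shows False
proof (rule no_four_obtuse)
  have pair: "obtuse p (g (X b)) (g (X b'))"
    if "b\<^sub>0 \<le> b" "b < a" "a < b'" "b' \<le> b\<^sub>3" "g (X a) = p" "g (X b) \<noteq> p" "g (X b') \<noteq> p" for a b b'
  proof (rule obtuse_sites[of a a\<^sub>3])
    show "a < v" "a\<^sub>3 < v" "u \<le> b" "b < b'" "b' < v" "u \<le> a\<^sub>3" "a\<^sub>3 < b \<or> b' < a\<^sub>3"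
      using that(1-4) order last by linarith+
  qed (use that cell(4) in simp_all)
  have "b\<^sub>0 \<le> b\<^sub>1" "b\<^sub>1 \<le> b\<^sub>2" "b\<^sub>2 \<le> b\<^sub>3" "b\<^sub>0 \<le> b\<^sub>2" "b\<^sub>1 \<le> b\<^sub>3" "a\<^sub>0 < b\<^sub>2" "a\<^sub>0 < b\<^sub>3" "a\<^sub>1 < b\<^sub>3" "b\<^sub>3 \<le> b\<^sub>3"
    using order by linarith+
  note sorted = this
  show "obtuse p (g (X b\<^sub>0)) (g (X b\<^sub>1))" "obtuse p (g (X b\<^sub>0)) (g (X b\<^sub>2))" "obtuse p (g (X b\<^sub>0)) (g (X b\<^sub>3))"
    using pair[of b\<^sub>0 a\<^sub>0] order cell(1) other sorted by simp_all
  show "obtuse p (g (X b\<^sub>1)) (g (X b\<^sub>2))" "obtuse p (g (X b\<^sub>1)) (g (X b\<^sub>3))"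
    using pair[of b\<^sub>1 a\<^sub>1] order cell(2) other sorted by simp_all
  show "obtuse p (g (X b\<^sub>2)) (g (X b\<^sub>3))"
    using pair[of b\<^sub>2 a\<^sub>2 b\<^sub>3] order cell(3) other sorted by simp
qed (use other in simp_all)

end

section \<open>Interval decompositions of noncrossing partitions\<close>

text \<open>
  A group consists of the positions from \<open>u\<close> to \<open>v - 1\<close> outside of two gaps. It may be empty: this is
  how an interval is split in two.
\<close>

definition gapped_interval :: "nat \<Rightarrow> nat \<Rightarrow> nat \<Rightarrow> nat \<Rightarrow> nat \<Rightarrow> nat \<Rightarrow> nat set" where
  "gapped_interval u v u\<^sub>1 v\<^sub>1 u\<^sub>2 v\<^sub>2 = {u..<v} - {u\<^sub>1..<v\<^sub>1} - {u\<^sub>2..<v\<^sub>2}"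

definition gaps :: "nat \<Rightarrow> nat \<Rightarrow> nat \<Rightarrow> nat \<Rightarrow> nat \<Rightarrow> nat \<Rightarrow> bool" where
  "gaps u v u\<^sub>1 v\<^sub>1 u\<^sub>2 v\<^sub>2 \<longleftrightarrow> u \<le> u\<^sub>1 \<and> u\<^sub>1 \<le> v\<^sub>1 \<and> v\<^sub>1 \<le> u\<^sub>2 \<and> u\<^sub>2 \<le> v\<^sub>2 \<and> v\<^sub>2 \<le> v \<and>
     v\<^sub>1 - u\<^sub>1 < v - u \<and> v\<^sub>2 - u\<^sub>2 < v - u"

lemma gaps_partition:
  assumes "gaps u v u\<^sub>1 v\<^sub>1 u\<^sub>2 v\<^sub>2"
  shows "{u..<v} = {u\<^sub>1..<v\<^sub>1} \<union> ({u\<^sub>2..<v\<^sub>2} \<union> gapped_interval u v u\<^sub>1 v\<^sub>1 u\<^sub>2 v\<^sub>2)"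
    "{u\<^sub>1..<v\<^sub>1} \<inter> ({u\<^sub>2..<v\<^sub>2} \<union> gapped_interval u v u\<^sub>1 v\<^sub>1 u\<^sub>2 v\<^sub>2) = {}"
    "{u\<^sub>2..<v\<^sub>2} \<inter> gapped_interval u v u\<^sub>1 v\<^sub>1 u\<^sub>2 v\<^sub>2 = {}"
  using assms by (auto simp: gaps_def gapped_interval_def)

definition maximal_gap :: "(nat \<Rightarrow> bool) \<Rightarrow> nat \<Rightarrow> nat \<Rightarrow> nat \<Rightarrow> nat \<Rightarrow> bool" where
  "maximal_gap P u v x y \<longleftrightarrow> u < x \<and> x \<le> y \<and> y \<le> v \<and> (\<forall>p\<in>{x..<y}. \<not> P p) \<and>
     (x < y \<longrightarrow> P (x - 1) \<and> (y < v \<longrightarrow> P y))"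

lemma maximal_run:
  fixes u v :: nat
  assumes "u \<le> v"
  obtains w where "u \<le> w" "w \<le> v" "\<And>p. u \<le> p \<Longrightarrow> p < w \<Longrightarrow> P p" "w < v \<Longrightarrow> \<not> P w"
proof -
  define stops where "stops p \<longleftrightarrow> u \<le> p \<and> (p < v \<longrightarrow> \<not> P p)" for p
  have "stops v" using assms by (simp add: stops_def)
  then have "stops (Least stops)" "Least stops \<le> v" by (rule LeastI, rule Least_le)
  moreover have "P p" if "u \<le> p" "p < Least stops" for p
    using not_less_Least[OF that(2)] that(1) by (simp add: stops_def)
  ultimately show ?thesis using that[of "Least stops"] by (simp add: stops_def)
qed

lemma two_maximal_gaps:
  fixes u v :: nat
  assumes "u < v" and ends: "P u" "P (v - 1)"
    and interruptions: "\<And>b\<^sub>0 a\<^sub>0 b\<^sub>1 a\<^sub>1 b\<^sub>2. u < b\<^sub>0 \<Longrightarrow> b\<^sub>0 < a\<^sub>0 \<Longrightarrow> a\<^sub>0 < b\<^sub>1 \<Longrightarrow> b\<^sub>1 < a\<^sub>1 \<Longrightarrow> a\<^sub>1 < b\<^sub>2 \<Longrightarrow> b\<^sub>2 < v - 1 \<Longrightarrow>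
      P a\<^sub>0 \<Longrightarrow> P a\<^sub>1 \<Longrightarrow> \<not> P b\<^sub>0 \<Longrightarrow> \<not> P b\<^sub>1 \<Longrightarrow> \<not> P b\<^sub>2 \<Longrightarrow> False"
  obtains u\<^sub>1 v\<^sub>1 u\<^sub>2 v\<^sub>2 where "maximal_gap P u v u\<^sub>1 v\<^sub>1" "maximal_gap P u v u\<^sub>2 v\<^sub>2" "v\<^sub>1 \<le> u\<^sub>2"
    "{p \<in> {u..<v}. P p} = gapped_interval u v u\<^sub>1 v\<^sub>1 u\<^sub>2 v\<^sub>2"
proof -
  obtain u\<^sub>1 where u1: "u \<le> u\<^sub>1" "u\<^sub>1 \<le> v" "\<And>p. u \<le> p \<Longrightarrow> p < u\<^sub>1 \<Longrightarrow> P p" "u\<^sub>1 < v \<Longrightarrow> \<not> P u\<^sub>1"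
    using maximal_run[of u v P] \<open>u < v\<close> by auto
  obtain v\<^sub>1 where v1: "u\<^sub>1 \<le> v\<^sub>1" "v\<^sub>1 \<le> v" "\<And>p. u\<^sub>1 \<le> p \<Longrightarrow> p < v\<^sub>1 \<Longrightarrow> \<not> P p" "v\<^sub>1 < v \<Longrightarrow> P v\<^sub>1"
    using maximal_run[of u\<^sub>1 v "\<lambda>p. \<not> P p"] u1 by auto
  obtain u\<^sub>2 where u2: "v\<^sub>1 \<le> u\<^sub>2" "u\<^sub>2 \<le> v" "\<And>p. v\<^sub>1 \<le> p \<Longrightarrow> p < u\<^sub>2 \<Longrightarrow> P p" "u\<^sub>2 < v \<Longrightarrow> \<not> P u\<^sub>2"
    using maximal_run[of v\<^sub>1 v P] v1 by auto
  obtain v\<^sub>2 where v2: "u\<^sub>2 \<le> v\<^sub>2" "v\<^sub>2 \<le> v" "\<And>p. u\<^sub>2 \<le> p \<Longrightarrow> p < v\<^sub>2 \<Longrightarrow> \<not> P p" "v\<^sub>2 < v \<Longrightarrow> P v\<^sub>2"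
    using maximal_run[of u\<^sub>2 v "\<lambda>p. \<not> P p"] u2 by auto
  have "u < u\<^sub>1" using u1 \<open>u < v\<close> ends(1) by (cases "u = u\<^sub>1") auto
  have rest: "P p" if "v\<^sub>2 \<le> p" "p < v" for p
  proof (rule ccontr)
    assume "\<not> P p"
    have "u\<^sub>1 < v" "v\<^sub>1 < v" "u\<^sub>2 < v" "v\<^sub>2 < v" using that v1(1) u2(1) v2(1) by linarith+
    then have P: "P v\<^sub>2" "\<not> P u\<^sub>2" "P v\<^sub>1" "\<not> P u\<^sub>1" using u1(4) v1(4) u2(4) v2(4) by blast+
    then have "v\<^sub>2 \<noteq> p" "u\<^sub>2 \<noteq> v\<^sub>2" "v\<^sub>1 \<noteq> u\<^sub>2" "u\<^sub>1 \<noteq> v\<^sub>1" "p \<noteq> v - 1" using \<open>\<not> P p\<close> ends(2) by auto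
    then have "u\<^sub>1 < v\<^sub>1" "v\<^sub>1 < u\<^sub>2" "u\<^sub>2 < v\<^sub>2" "v\<^sub>2 < p" "p < v - 1" using v1(1) u2(1) v2(1) that by linarith+
    then show False by (rule interruptions[OF \<open>u < u\<^sub>1\<close> _ _ _ _ _ P(3,1,4,2) \<open>\<not> P p\<close>])
  qed
  have "P p \<longleftrightarrow> p \<notin> {u\<^sub>1..<v\<^sub>1} \<and> p \<notin> {u\<^sub>2..<v\<^sub>2}" if "p \<in> {u..<v}" for p
  proof -
    consider "p < u\<^sub>1" | "u\<^sub>1 \<le> p" "p < v\<^sub>1" | "v\<^sub>1 \<le> p" "p < u\<^sub>2" | "u\<^sub>2 \<le> p" "p < v\<^sub>2" | "v\<^sub>2 \<le> p" by linarith
    then show ?thesis by cases (use that u1(3) v1(1,3) u2(1,3) v2(1,3) rest in auto)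
  qed
  then have "{p \<in> {u..<v}. P p} = gapped_interval u v u\<^sub>1 v\<^sub>1 u\<^sub>2 v\<^sub>2" unfolding gapped_interval_def by blast
  moreover have "maximal_gap P u v u\<^sub>1 v\<^sub>1"
    using \<open>u < u\<^sub>1\<close> u1(3)[of "u\<^sub>1 - 1"] v1 by (auto simp: maximal_gap_def)
  moreover have "P (u\<^sub>2 - 1)" if "u\<^sub>2 < v\<^sub>2"
  proof -
    have "v\<^sub>1 \<noteq> u\<^sub>2" using v1(4) v2(2) v2(3)[of u\<^sub>2] that by auto
    then show ?thesis using u2(1) u2(3)[of "u\<^sub>2 - 1"] by simp
  qed
  then have "maximal_gap P u v u\<^sub>2 v\<^sub>2"
    using \<open>u < u\<^sub>1\<close> v1(1) u2(1) v2 by (auto simp: maximal_gap_def)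
  ultimately show ?thesis using that u2(1) by blast
qed

locale noncrossing =
  fixes G :: "nat \<Rightarrow> 'c" and r R :: nat
  assumes crossing: "\<And>i j k l. r \<le> i \<Longrightarrow> i < j \<Longrightarrow> j < k \<Longrightarrow> k < l \<Longrightarrow> l < R \<Longrightarrow>
      G i = G k \<Longrightarrow> G j = G l \<Longrightarrow> G i = G j"
    and interruptions: "\<And>a b\<^sub>0 a\<^sub>0 b\<^sub>1 a\<^sub>1 b\<^sub>2 a\<^sub>2. r \<le> a \<Longrightarrow> a < b\<^sub>0 \<Longrightarrow> b\<^sub>0 < a\<^sub>0 \<Longrightarrow> a\<^sub>0 < b\<^sub>1 \<Longrightarrow> b\<^sub>1 < a\<^sub>1 \<Longrightarrow>
      a\<^sub>1 < b\<^sub>2 \<Longrightarrow> b\<^sub>2 < a\<^sub>2 \<Longrightarrow> a\<^sub>2 < R \<Longrightarrow> G a\<^sub>0 = G a \<Longrightarrow> G a\<^sub>1 = G a \<Longrightarrow> G a\<^sub>2 = G a \<Longrightarrow>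
      G b\<^sub>0 \<noteq> G a \<Longrightarrow> G b\<^sub>1 \<noteq> G a \<Longrightarrow> G b\<^sub>2 \<noteq> G a \<Longrightarrow> False"
begin

definition closed_interval :: "nat \<Rightarrow> nat \<Rightarrow> bool" where
  "closed_interval u v \<longleftrightarrow> r \<le> u \<and> u \<le> v \<and> v \<le> R \<and>
     (\<forall>i\<in>{u..<v}. \<forall>j\<in>{r..<R}. G i = G j \<longrightarrow> j \<in> {u..<v})"

definition cell :: "'c \<Rightarrow> nat set" where
  "cell q = {p \<in> {r..<R}. G p = q}"

lemma closed_interval_bounds:
  assumes "closed_interval u v"
  shows "r \<le> u" "u \<le> v" "v \<le> R"
  using assms unfolding closed_interval_def by blast+

lemma closed_intervalD:
  assumes "closed_interval u v" "i \<in> {u..<v}" "j \<in> {r..<R}" "G i = G j"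
  shows "j \<in> {u..<v}"
  using assms unfolding closed_interval_def by blast

lemma closed_subinterval:
  assumes "closed_interval u v" "u \<le> x" "x \<le> y" "y \<le> v"
    and "\<And>i j. i \<in> {x..<y} \<Longrightarrow> j \<in> {u..<v} \<Longrightarrow> G i = G j \<Longrightarrow> j \<in> {x..<y}"
  shows "closed_interval x y"
  unfolding closed_interval_def
proof (intro conjI ballI impI)
  fix i j assume ij: "i \<in> {x..<y}" "j \<in> {r..<R}" "G i = G j"
  moreover have "i \<in> {u..<v}" using ij(1) assms(2,4) by auto
  ultimately have "j \<in> {u..<v}" using closed_intervalD[OF assms(1)] by blast
  then show "j \<in> {x..<y}" by (rule assms(5)[OF ij(1) _ ij(3)])
qed (use closed_interval_bounds[OF assms(1)] assms(2-4) in auto)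

lemma closed_intervals_disjoint:
  assumes "closed_interval u v" "closed_interval u' v'" "v \<le> u'"
  shows "G ` {u..<v} \<inter> G ` {u'..<v'} = {}"
proof -
  have False if "i \<in> {u..<v}" "j \<in> {u'..<v'}" "G i = G j" for i j
  proof -
    have "j \<in> {r..<R}" using that(2) closed_interval_bounds[OF assms(2)] by auto
    then have "j \<in> {u..<v}" using closed_intervalD[OF assms(1)] that(1,3) by blast
    then show False using that(2) assms(3) by simp
  qed
  then show ?thesis by blast
qed

lemma closed_interval_split:
  assumes "closed_interval u v" "u \<le> e" "e < v" "G e = G u" and last: "\<And>p. p \<in> {Suc e..<v} \<Longrightarrow> G p \<noteq> G u"
  shows "closed_interval u (Suc e)" "closed_interval (Suc e) v"
proof -
  note bounds = closed_interval_bounds[OF assms(1)]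
  have no_crossing: "G i \<noteq> G j" if "i \<in> {u..e}" "j \<in> {Suc e..<v}" for i j
  proof
    assume "G i = G j"
    then have "i \<noteq> u" "i \<noteq> e" using last[OF that(2)] assms(4) by metis+
    then have "G u = G i" using crossing[of u i e j] that assms(4) bounds \<open>G i = G j\<close> by auto
    then show False using last[OF that(2)] \<open>G i = G j\<close> by simp
  qed
  show "closed_interval u (Suc e)"
  proof (rule closed_subinterval[OF assms(1)])
    fix i j assume "i \<in> {u..<Suc e}" "j \<in> {u..<v}" "G i = G j"
    then show "j \<in> {u..<Suc e}" using no_crossing[of i j] by fastforce
  qed (use assms(2,3) in auto)
  show "closed_interval (Suc e) v"
  proof (rule closed_subinterval[OF assms(1)])
    fix i j assume "i \<in> {Suc e..<v}" "j \<in> {u..<v}" "G i = G j"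
    then show "j \<in> {Suc e..<v}" using no_crossing[of j i] by fastforce
  qed (use assms(2,3) in auto)
qed

lemma closed_maximal_gap:
  assumes "closed_interval u v" "maximal_gap (\<lambda>p. G p = G u) u v x y"
  shows "closed_interval x y"
proof (rule closed_subinterval[OF assms(1)])
  show "u \<le> x" "x \<le> y" "y \<le> v" using assms(2) by (simp_all add: maximal_gap_def)
  note bounds = closed_interval_bounds[OF assms(1)]
  fix i j assume i: "i \<in> {x..<y}" and j: "j \<in> {u..<v}" and eq: "G i = G j"
  have gap: "u < x" "G (x - 1) = G u" "y < v \<Longrightarrow> G y = G u" and "G i \<noteq> G u"
    using assms(2) i by (auto simp: maximal_gap_def)
  show "j \<in> {x..<y}"
  proof (rule ccontr)
    assume "j \<notin> {x..<y}"
    then consider (after) "y \<le> j" | (before) "j \<le> x - 1" by fastforce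
    then show False
    proof cases
      case after
      then have "G y = G u" using j gap(3) by simp
      then have "y < j" using after \<open>G i \<noteq> G u\<close> eq by (cases "y = j") auto
      then show False using crossing[of u i y j] i j gap(1) bounds eq \<open>G y = G u\<close> \<open>G i \<noteq> G u\<close> by auto
    next
      case before
      then have "u \<noteq> j" "j \<noteq> x - 1" using eq gap(2) \<open>G i \<noteq> G u\<close> by auto
      then have "u < j" "j < x - 1" using before j by auto
      then show False using crossing[of u j "x - 1" i] i j bounds eq gap(2) \<open>G i \<noteq> G u\<close> assms(2)
        by (auto simp: maximal_gap_def)
    qed
  qed
qed

lemma group_of_first:
  assumes "closed_interval u v" "u < v" "G (v - 1) = G u"
  obtains u\<^sub>1 v\<^sub>1 u\<^sub>2 v\<^sub>2 where "gaps u v u\<^sub>1 v\<^sub>1 u\<^sub>2 v\<^sub>2" "closed_interval u\<^sub>1 v\<^sub>1" "closed_interval u\<^sub>2 v\<^sub>2"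
    "gapped_interval u v u\<^sub>1 v\<^sub>1 u\<^sub>2 v\<^sub>2 = cell (G u)"
proof -
  note bounds = closed_interval_bounds[OF assms(1)]
  obtain u\<^sub>1 v\<^sub>1 u\<^sub>2 v\<^sub>2 where maximal: "maximal_gap (\<lambda>p. G p = G u) u v u\<^sub>1 v\<^sub>1" "maximal_gap (\<lambda>p. G p = G u) u v u\<^sub>2 v\<^sub>2"
    "v\<^sub>1 \<le> u\<^sub>2" "{p \<in> {u..<v}. G p = G u} = gapped_interval u v u\<^sub>1 v\<^sub>1 u\<^sub>2 v\<^sub>2"
  proof (rule two_maximal_gaps[of u v "\<lambda>p. G p = G u"])
    fix b\<^sub>0 a\<^sub>0 b\<^sub>1 a\<^sub>1 b\<^sub>2
    assume order: "u < b\<^sub>0" "b\<^sub>0 < a\<^sub>0" "a\<^sub>0 < b\<^sub>1" "b\<^sub>1 < a\<^sub>1" "a\<^sub>1 < b\<^sub>2" "b\<^sub>2 < v - 1"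
      and P: "G a\<^sub>0 = G u" "G a\<^sub>1 = G u" "G b\<^sub>0 \<noteq> G u" "G b\<^sub>1 \<noteq> G u" "G b\<^sub>2 \<noteq> G u"
    have "v - 1 < R" using assms(2) bounds(3) by simp
    from interruptions[OF bounds(1) order this P(1,2) assms(3) P(3-5)] show False .
  qed (use assms(2,3) in auto)
  have "gaps u v u\<^sub>1 v\<^sub>1 u\<^sub>2 v\<^sub>2" using maximal(1-3) by (auto simp: gaps_def maximal_gap_def)
  moreover have "closed_interval u\<^sub>1 v\<^sub>1" "closed_interval u\<^sub>2 v\<^sub>2"
    using maximal(1,2) closed_maximal_gap assms(1) by blast+
  moreover have "{p \<in> {u..<v}. G p = G u} = cell (G u)"
  proof (intro equalityI subsetI)
    fix p assume "p \<in> cell (G u)"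
    then show "p \<in> {p \<in> {u..<v}. G p = G u}"
      using closed_intervalD[OF assms(1), of u p] assms(2) by (simp add: cell_def)
  qed (use bounds in \<open>auto simp: cell_def\<close>)
  ultimately show ?thesis using that maximal(4) by simp
qed

definition total :: "(nat set \<Rightarrow> real) \<Rightarrow> nat \<Rightarrow> nat \<Rightarrow> real" where
  "total w u v = (\<Sum>q\<in>G ` {u..<v}. w (cell q))"

lemma total_split:
  assumes "closed_interval u e" "closed_interval e v"
  shows "total w u v = total w u e + total w e v"
proof -
  have "G ` {u..<v} = G ` {u..<e} \<union> G ` {e..<v}"
    using closed_interval_bounds assms by (simp add: image_Un[symmetric] ivl_disj_un_two(3))
  then show ?thesis
    using closed_intervals_disjoint[OF assms order_refl] by (simp add: total_def sum.union_disjoint)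
qed

lemma total_group:
  assumes "r \<le> u" "v \<le> R" "u < v" and gaps: "gaps u v u\<^sub>1 v\<^sub>1 u\<^sub>2 v\<^sub>2"
    and closed: "closed_interval u\<^sub>1 v\<^sub>1" "closed_interval u\<^sub>2 v\<^sub>2"
    and group: "gapped_interval u v u\<^sub>1 v\<^sub>1 u\<^sub>2 v\<^sub>2 = cell (G u)"
  shows "total w u v = total w u\<^sub>1 v\<^sub>1 + total w u\<^sub>2 v\<^sub>2 + w (cell (G u))"
proof -
  let ?rest = "G ` {u\<^sub>1..<v\<^sub>1} \<union> G ` {u\<^sub>2..<v\<^sub>2}"
  have "v\<^sub>1 \<le> u\<^sub>2" "{u\<^sub>1..<v\<^sub>1} \<union> {u\<^sub>2..<v\<^sub>2} \<subseteq> {r..<R}" using gaps assms(1,2) by (auto simp: gaps_def)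
  have "G ` cell (G u) = {G u}" using assms(1-3) by (auto simp: cell_def)
  then have "G ` {u..<v} = insert (G u) ?rest"
    unfolding gaps_partition(1)[OF gaps] group by auto
  moreover have "G u \<notin> ?rest"
    using gaps_partition(2,3)[OF gaps] \<open>{u\<^sub>1..<v\<^sub>1} \<union> {u\<^sub>2..<v\<^sub>2} \<subseteq> {r..<R}\<close> unfolding group cell_def by fastforce
  moreover have "(\<Sum>q\<in>?rest. w (cell q)) = total w u\<^sub>1 v\<^sub>1 + total w u\<^sub>2 v\<^sub>2"
    unfolding total_def using closed_intervals_disjoint[OF closed \<open>v\<^sub>1 \<le> u\<^sub>2\<close>] by (simp add: sum.union_disjoint)
  ultimately show ?thesis unfolding total_def by simp
qed

lemma last_of_first_group:
  fixes u v :: nat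
  assumes "u < v"
  obtains e where "u \<le> e" "e < v" "G e = G u" "\<And>p. p \<in> {Suc e..<v} \<Longrightarrow> G p \<noteq> G u"
proof
  define E where "E = {p \<in> {u..<v}. G p = G u}"
  have "Max E \<in> E" using assms by (intro Max_in) (auto simp: E_def)
  then show Max: "u \<le> Max E" "Max E < v" "G (Max E) = G u" by (auto simp: E_def)
  fix p assume p: "p \<in> {Suc (Max E)..<v}"
  show "G p \<noteq> G u"
  proof
    assume "G p = G u"
    then have "p \<le> Max E" using p Max(1) by (intro Max_ge) (auto simp: E_def)
    then show False using p by simp
  qed
qed

lemma recurrence_le_total:
  fixes F :: "nat \<Rightarrow> nat \<Rightarrow> real" and w :: "nat set \<Rightarrow> real"
  assumes empty: "\<And>u. r \<le> u \<Longrightarrow> u \<le> R \<Longrightarrow> F u u \<le> 0" "w {} = 0"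
    and step: "\<And>u v u\<^sub>1 v\<^sub>1 u\<^sub>2 v\<^sub>2. r \<le> u \<Longrightarrow> v \<le> R \<Longrightarrow> gaps u v u\<^sub>1 v\<^sub>1 u\<^sub>2 v\<^sub>2 \<Longrightarrow>
      F u v \<le> F u\<^sub>1 v\<^sub>1 + F u\<^sub>2 v\<^sub>2 + w (gapped_interval u v u\<^sub>1 v\<^sub>1 u\<^sub>2 v\<^sub>2)"
    and "closed_interval u v"
  shows "F u v \<le> total w u v"
  using assms(4)
proof (induction "v - u" arbitrary: u v rule: less_induct)
  case less
  note bounds = closed_interval_bounds[OF less.prems]
  consider (equal) "u = v" | (proper) "u < v" using bounds(2) by linarith
  then show ?case
  proof cases
    case equal
    then show ?thesis using empty(1)[of u] bounds by (simp add: total_def)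
  next
    case proper
    then obtain e where e: "u \<le> e" "e < v" "G e = G u" "\<And>p. p \<in> {Suc e..<v} \<Longrightarrow> G p \<noteq> G u"
      by (rule last_of_first_group) blast
    show ?thesis
    proof (cases "Suc e = v")
      case False
      note closed = closed_interval_split[OF less.prems e]
      have "gaps u v u (Suc e) (Suc e) v" "gapped_interval u v u (Suc e) (Suc e) v = {}"
        using e(1,2) False by (auto simp: gaps_def gapped_interval_def)
      then have "F u v \<le> F u (Suc e) + F (Suc e) v"
        using step[of u v u "Suc e" "Suc e" v] bounds empty(2) by simp
      also have "\<dots> \<le> total w u (Suc e) + total w (Suc e) v"
        using less.hyps[OF _ closed(1)] less.hyps[OF _ closed(2)] False e(1,2) by (intro add_mono) auto
      also have "\<dots> = total w u v" by (rule total_split[OF closed, symmetric])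
      finally show ?thesis .
    next
      case True
      then have "G (v - 1) = G u" using e(3) by auto
      with less.prems \<open>u < v\<close> obtain u\<^sub>1 v\<^sub>1 u\<^sub>2 v\<^sub>2 where group: "gaps u v u\<^sub>1 v\<^sub>1 u\<^sub>2 v\<^sub>2"
        "closed_interval u\<^sub>1 v\<^sub>1" "closed_interval u\<^sub>2 v\<^sub>2" "gapped_interval u v u\<^sub>1 v\<^sub>1 u\<^sub>2 v\<^sub>2 = cell (G u)"
        by (rule group_of_first)
      have smaller: "v\<^sub>1 - u\<^sub>1 < v - u" "v\<^sub>2 - u\<^sub>2 < v - u" using group(1) by (simp_all add: gaps_def)
      show ?thesis
        using step[OF bounds(1,3) group(1)] less.hyps[OF smaller(1) group(2)] less.hyps[OF smaller(2) group(3)]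
        unfolding group(4) total_group[OF bounds(1,3) \<open>u < v\<close> group] by linarith
    qed
  qed
qed

end

section \<open>Weber costs\<close>

lemma star_cost_nonneg: "0 \<le> star_cost t A p"
  unfolding star_cost_def by (intro add_nonneg_nonneg sum_list_nonneg) auto

lemma weber_cost_le: "weber_cost t A \<le> star_cost t A p"
  unfolding weber_cost_def by (rule cINF_lower[OF bdd_belowI2[OF star_cost_nonneg]]) simp

lemma weber_cost_geI: "(\<And>p. x \<le> star_cost t A p) \<Longrightarrow> x \<le> weber_cost t A"
  unfolding weber_cost_def by (auto intro!: cINF_greatest)

lemma weber_cost_eq_0: "star_cost t A t = 0 \<Longrightarrow> weber_cost t A = 0"
  using weber_cost_le[of t A t] weber_cost_geI[of 0 t A] star_cost_nonneg[of t A] by simp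

definition sources_at :: "(nat \<Rightarrow> point) \<Rightarrow> nat set \<Rightarrow> point list" where
  "sources_at X D = map X (sorted_list_of_set D)"

lemma star_cost_sources_at:
  assumes "finite D"
  shows "star_cost t (sources_at X D) q = dist q t + (\<Sum>p\<in>D. dist (X p) q)"
  using assms by (simp add: star_cost_def sources_at_def comp_def sum_list_distinct_conv_sum_set)

text \<open>
  The inequality for interval costs \<open>F\<close> that the dynamic program guarantees. There are \<open>2 n\<close> positions,
  as the cyclic order is written down twice to turn all its rotations into intervals.
\<close>

definition interval_recurrence :: "real \<Rightarrow> point \<Rightarrow> (nat \<Rightarrow> point) \<Rightarrow> nat \<Rightarrow> (nat \<Rightarrow> nat \<Rightarrow> real) \<Rightarrow> bool" where
  "interval_recurrence c t X n F \<longleftrightarrow> (\<forall>u\<le>2 * n. F u u \<le> 0) \<and>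
     (\<forall>u v u\<^sub>1 v\<^sub>1 u\<^sub>2 v\<^sub>2. v \<le> u + n \<longrightarrow> v \<le> 2 * n \<longrightarrow> gaps u v u\<^sub>1 v\<^sub>1 u\<^sub>2 v\<^sub>2 \<longrightarrow>
       F u v \<le> F u\<^sub>1 v\<^sub>1 + F u\<^sub>2 v\<^sub>2 + c * weber_cost t (sources_at X (gapped_interval u v u\<^sub>1 v\<^sub>1 u\<^sub>2 v\<^sub>2)))"

lemma noncrossing_recurrence_le:
  fixes G :: "nat \<Rightarrow> point"
  assumes "noncrossing G r (r + n)" "r \<le> n" "0 \<le> c" and F: "interval_recurrence c t X n F"
  shows "F r (r + n) \<le> c * ((\<Sum>q\<in>G ` {r..<r + n}. dist q t) + (\<Sum>p\<in>{r..<r + n}. dist (X p) (G p)))"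
proof -
  interpret noncrossing G r "r + n" by (rule assms(1))
  let ?w = "\<lambda>D. c * weber_cost t (sources_at X D)"
  have "F r (r + n) \<le> total ?w r (r + n)"
  proof (rule recurrence_le_total)
    fix u assume "u \<le> r + n"
    then have "u \<le> 2 * n" using \<open>r \<le> n\<close> by simp
    then show "F u u \<le> 0" using F unfolding interval_recurrence_def by blast
  next
    show "?w {} = 0" by (simp add: weber_cost_eq_0 star_cost_sources_at)
    show "closed_interval r (r + n)" by (simp add: closed_interval_def)
  next
    fix u v u\<^sub>1 v\<^sub>1 u\<^sub>2 v\<^sub>2 assume "r \<le> u" "v \<le> r + n" "gaps u v u\<^sub>1 v\<^sub>1 u\<^sub>2 v\<^sub>2"
    moreover from this have "v \<le> u + n" "v \<le> 2 * n" using \<open>r \<le> n\<close> by linarith+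
    ultimately show "F u v \<le> F u\<^sub>1 v\<^sub>1 + F u\<^sub>2 v\<^sub>2 + ?w (gapped_interval u v u\<^sub>1 v\<^sub>1 u\<^sub>2 v\<^sub>2)"
      using F unfolding interval_recurrence_def by blast
  qed
  also have "\<dots> \<le> (\<Sum>q\<in>G ` {r..<r + n}. c * (dist q t + (\<Sum>p\<in>cell q. dist (X p) q)))"
    unfolding total_def
  proof (rule sum_mono)
    fix q
    have "finite (cell q)" by (simp add: cell_def)
    then show "?w (cell q) \<le> c * (dist q t + (\<Sum>p\<in>cell q. dist (X p) q))"
      using weber_cost_le[of t "sources_at X (cell q)" q] \<open>0 \<le> c\<close>
      by (simp add: star_cost_sources_at mult_left_mono)
  qed
  also have "\<dots> = c * ((\<Sum>q\<in>G ` {r..<r + n}. dist q t) + (\<Sum>q\<in>G ` {r..<r + n}. \<Sum>p\<in>cell q. dist (X p) (G p)))"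
    by (simp add: sum_distrib_left[symmetric] sum.distrib cell_def)
  also have "(\<Sum>q\<in>G ` {r..<r + n}. \<Sum>p\<in>cell q. dist (X p) (G p)) = (\<Sum>p\<in>{r..<r + n}. dist (X p) (G p))"
    unfolding cell_def by (rule sum.image_gen[symmetric]) simp
  finally show ?thesis .
qed

section \<open>The recurrence bounds every choice of sites\<close>

lemma (in voronoi_cells) noncrossing_cells:
  assumes "g (X u) \<noteq> g (X (v - 1)) \<or> (\<forall>i\<in>{u..<v}. g (X i) = g (X u))"
  shows "noncrossing (\<lambda>p. g (X p)) u v"
proof
  fix i j k l
  assume "u \<le> i" "i < j" "j < k" "k < l" "l < v" "g (X i) = g (X k)" "g (X j) = g (X l)"
  then show "g (X i) = g (X j)" by (rule cells_noncrossing)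
next
  fix a b\<^sub>0 a\<^sub>0 b\<^sub>1 a\<^sub>1 b\<^sub>2 a\<^sub>2
  assume order: "u \<le> a" "a < b\<^sub>0" "b\<^sub>0 < a\<^sub>0" "a\<^sub>0 < b\<^sub>1" "b\<^sub>1 < a\<^sub>1" "a\<^sub>1 < b\<^sub>2" "b\<^sub>2 < a\<^sub>2" "a\<^sub>2 < v"
    and cell: "g (X a\<^sub>0) = g (X a)" "g (X a\<^sub>1) = g (X a)" "g (X a\<^sub>2) = g (X a)"
    and other: "g (X b\<^sub>0) \<noteq> g (X a)" "g (X b\<^sub>1) \<noteq> g (X a)" "g (X b\<^sub>2) \<noteq> g (X a)"
  have "a \<in> {u..<v}" "b\<^sub>0 \<in> {u..<v}" using order by auto
  then have ends: "g (X u) \<noteq> g (X (v - 1))" using assms other(1) by metis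
  show False
  proof (cases "g (X u) = g (X a)")
    case True
    then have last: "g (X (v - 1)) \<noteq> g (X a)" using ends by simp
    then have "a\<^sub>2 \<noteq> v - 1" using cell(3) by auto
    then have "u \<le> b\<^sub>0" "a\<^sub>2 < v - 1" "v - 1 < v" "a < v" using order by linarith+
    then show False
      using at_most_three_interruptions[OF _ order(3-7) _ _ order(1) _ _ cell refl other last] order(2) by blast
  next
    case False
    then have "u < a" using order(1) by (cases "u = a") auto
    moreover have "b\<^sub>2 < v" "u \<le> a\<^sub>2" using order by linarith+
    ultimately show False
      using at_most_three_interruptions[OF order_refl _ order(2-6) _ _ _ order(8) refl cell False other]
        order(7)
      by blast
  qed
qed

lemma rotation_with_distinct_ends:
  fixes G :: "nat \<Rightarrow> 'a"
  assumes "\<And>p. G (p + n) = G p"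
  obtains r where "r \<le> n" "G r \<noteq> G (r + n - 1) \<or> (\<forall>i\<in>{r..<r + n}. G i = G r)"
proof (cases "\<exists>i<n. G i \<noteq> G (Suc i)")
  case True
  then obtain i where "i < n" "G i \<noteq> G (Suc i)" by blast
  moreover have "G (Suc i + n - 1) = G i" using assms by simp
  ultimately have "Suc i \<le> n" "G (Suc i) \<noteq> G (Suc i + n - 1)" by simp_all
  then show ?thesis using that by blast
next
  case False
  have "G i = G 0" if "i \<le> n" for i
    using that
  proof (induction i)
    case (Suc i)
    then have "G i = G (Suc i)" using False by (metis Suc_le_eq)
    then show ?case using Suc by simp
  qed simp
  then have "\<forall>i\<in>{0..<0 + n}. G i = G 0" by (metis add_0 atLeastLessThan_iff less_imp_le)
  then show ?thesis using that by blast
qed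

lemma sum_periodic:
  fixes f :: "nat \<Rightarrow> 'a::ab_group_add"
  assumes "\<And>p. f (p + n) = f p"
  shows "sum f {r..<r + n} = sum f {..<n}"
proof (induction r)
  case 0
  then show ?case by (simp add: atLeast0LessThan)
next
  case (Suc r)
  have "sum f {Suc r..<Suc r + n} + f r = sum f {r..<r + n} + f (r + n)"
    by (cases n) (auto simp: sum.atLeast_Suc_lessThan sum.atLeastLessThan_Suc add.commute algebra_simps)
  then show ?case using Suc assms by simp
qed

lemma interval_recurrence_le_sites:
  assumes boundary: "convex_boundary S H" and sites: "finite Q" "Q \<subseteq> H" and "0 < n"
    and X: "\<And>i. X i \<in> S" "\<And>p. X (p + n) = X p" "alternating X 0 n"
    and in_Q: "\<And>i. i < n \<Longrightarrow> h i \<in> Q"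
    and F: "interval_recurrence c t X n F" "0 \<le> c"
  shows "\<exists>r\<le>n. F r (r + n) \<le> c * ((\<Sum>i<n. dist (X i) (h i)) + (\<Sum>q\<in>Q. dist q t))"
proof -
  have "Q \<noteq> {}" using in_Q \<open>0 < n\<close> by blast
  then obtain g where nearest: "\<And>x. nearest_site Q x (g x)" using nearest_site_exists[OF sites(1)] by metis
  define G where "G = (\<lambda>p. g (X p))"
  have G: "G p \<in> Q" "q \<in> Q \<Longrightarrow> dist (X p) (G p) \<le> dist (X p) q" for p q
    unfolding G_def using nearest_siteD[OF nearest] by blast+
  have "G (p + n) = G p" for p by (simp add: G_def X(2))
  then obtain r where r: "r \<le> n" "G r \<noteq> G (r + n - 1) \<or> (\<forall>i\<in>{r..<r + n}. G i = G r)"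
    by (rule rotation_with_distinct_ends)
  interpret voronoi_cells S H Q g X r "r + n"
    using boundary sites(2) nearest X alternating_rotate[OF X(3,2)]
    by (simp add: voronoi_cells_def voronoi_cells_axioms_def)
  have "noncrossing G r (r + n)" using noncrossing_cells r(2) unfolding G_def by blast
  from noncrossing_recurrence_le[OF this r(1) F(2,1)]
  have "F r (r + n) \<le> c * ((\<Sum>q\<in>G ` {r..<r + n}. dist q t) + (\<Sum>p\<in>{r..<r + n}. dist (X p) (G p)))" .
  also have "(\<Sum>p\<in>{r..<r + n}. dist (X p) (G p)) = (\<Sum>p<n. dist (X p) (G p))"
    by (rule sum_periodic) (simp add: G_def X(2))
  also have "c * ((\<Sum>q\<in>G ` {r..<r + n}. dist q t) + (\<Sum>p<n. dist (X p) (G p))) \<le>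
      c * ((\<Sum>q\<in>Q. dist q t) + (\<Sum>i<n. dist (X i) (h i)))"
  proof (intro mult_left_mono add_mono \<open>0 \<le> c\<close>)
    show "(\<Sum>q\<in>G ` {r..<r + n}. dist q t) \<le> (\<Sum>q\<in>Q. dist q t)"
      by (rule sum_mono2) (use sites(1) G(1) in auto)
    show "(\<Sum>p<n. dist (X p) (G p)) \<le> (\<Sum>i<n. dist (X i) (h i))"
      by (rule sum_mono) (use G(2) in_Q in auto)
  qed
  finally show ?thesis using r(1) by (auto simp: add.commute)
qed

section \<open>Layouts with one intermediate layer\<close>

definition site_cost :: "point list \<Rightarrow> point \<Rightarrow> (nat \<Rightarrow> point) \<Rightarrow> point set \<Rightarrow> real" where
  "site_cost A t h Q = (\<Sum>i<length A. dist (A ! i) (h i)) + (\<Sum>q\<in>Q. dist q t)"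

lemma sum_dist_image_le:
  assumes "finite V"
  shows "(\<Sum>q\<in>f ` V. dist q t) \<le> (\<Sum>v\<in>V. dist (f v) t)"
  using sum_image_le[OF assms, of "\<lambda>q. dist q t" f] by (simp add: comp_def)

lemma site_cost_closest_point:
  assumes "convex H" "closed H" "t \<in> H" "set A \<subseteq> H" "finite Q"
  shows "site_cost A t (closest_point H \<circ> h) (closest_point H ` Q) \<le> site_cost A t h Q"
proof -
  have closest_le: "dist x (closest_point H y) \<le> dist x y" if "x \<in> H" for x y
    using closest_point_lipschitz[OF assms(1,2), of x y] closest_point_self[OF that] that by auto
  have "(\<Sum>q\<in>closest_point H ` Q. dist q t) \<le> (\<Sum>q\<in>Q. dist (closest_point H q) t)"
    by (rule sum_dist_image_le[OF assms(5)])
  also have "\<dots> \<le> (\<Sum>q\<in>Q. dist q t)"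
    using closest_le[OF assms(3)] by (intro sum_mono) (simp add: dist_commute)
  finally have "(\<Sum>q\<in>closest_point H ` Q. dist q t) \<le> (\<Sum>q\<in>Q. dist q t)" .
  moreover have "(\<Sum>i<length A. dist (A ! i) (closest_point H (h i))) \<le> (\<Sum>i<length A. dist (A ! i) (h i))"
    using assms(4) by (intro sum_mono closest_le) auto
  ultimately show ?thesis by (simp add: site_cost_def)
qed

locale one_layer_instance =
  fixes I :: flamecast and t :: point
  assumes sinks: "sinks I = [t]" and layers: "layers I = 1" and alpha: "alpha I = 0"
begin

abbreviation n :: nat where "n \<equiv> length (sources I)"

lemma layout_cost_nonneg: "0 \<le> layout_cost I L"
  unfolding layout_cost_def by (rule sum_nonneg) auto

lemma layout_source_arc:
  assumes "is_layout I L" "i < n"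
  shows "\<exists>v. (Source i, v) \<in> arcs L"
proof -
  have "Source i \<in> leaves L" "Source i \<notin> roots L"
    using assms unfolding is_layout_def by auto
  then show ?thesis by (auto simp: leaves_def roots_def arcs_def)
qed

lemma layout_source_parent:
  assumes L: "is_layout I L" and arc: "(Source i, v) \<in> arcs L"
  shows "v = Sink 0 \<or> v \<in> range Steiner \<and> (v, Sink 0) \<in> arcs L"
proof (cases "v \<in> roots L")
  case True
  then show ?thesis using L sinks unfolding is_layout_def by auto
next
  case False
  have in_verts: "y \<in> verts L" if "(x, y) \<in> arcs L" for x y
    using L that unfolding is_layout_def rooted_forest_def by auto
  have up: "\<exists>y. (x, y) \<in> arcs L" if "x \<in> verts L" "x \<notin> roots L" for x
    using that by (auto simp: roots_def arcs_def)
  have "v \<notin> leaves L" using arc by (auto simp: leaves_def)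
  then have "v \<in> range Steiner" using L in_verts[OF arc] False unfolding is_layout_def by blast
  moreover obtain w where w: "(v, w) \<in> arcs L" using up in_verts[OF arc] False by blast
  moreover have "w \<in> roots L"
  proof (rule ccontr)
    assume "w \<notin> roots L"
    then obtain x where "(w, x) \<in> arcs L" using up in_verts[OF w] by blast
    then have "(Source i, x) \<in> arcs L ^^ 3" using arc w by (auto simp: numeral_3_eq_3)
    then show False using L layers unfolding is_layout_def height_at_most_def by fastforce
  qed
  then have "w = Sink 0" using L sinks unfolding is_layout_def by auto
  ultimately show ?thesis by blast
qed

lemma load_neq_0:
  assumes "is_layout I L" "i < n" "(Source i, u) \<in> (arcs L)\<^sup>*"
  shows "load L u \<noteq> 0"
proof -
  have leaves: "leaves L = Source ` {..<n}" using assms(1) by (simp add: is_layout_def)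
  then have "Source i \<in> {w \<in> leaves L. (w, u) \<in> (arcs L)\<^sup>*}" using assms(2,3) by auto
  moreover have "finite {w \<in> leaves L. (w, u) \<in> (arcs L)\<^sup>*}" using leaves by simp
  ultimately show ?thesis unfolding load_def using card_0_eq by blast
qed

lemma sum_arcs_le_layout_cost:
  assumes L: "is_layout I L" and up: "\<And>i. i < n \<Longrightarrow> (Source i, up i) \<in> arcs L"
  shows "(\<Sum>i<n. dist (sources I ! i) (pos L (up i))) + (\<Sum>v\<in>up ` {..<n} - {Sink 0}. dist (pos L v) t) \<le>
      layout_cost I L"
proof -
  define cost where "cost = (\<lambda>(u, v). dist (pos L u) (pos L v) * real (load L u) powr alpha I)"
  let ?V = "up ` {..<n} - {Sink 0}"
  let ?A = "(\<lambda>i. (Source i, up i)) ` {..<n}" and ?B = "(\<lambda>v. (v, Sink 0)) ` ?V"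
  have V: "v \<in> range Steiner \<and> (v, Sink 0) \<in> arcs L" if "v \<in> ?V" for v
    using that layout_source_parent[OF L up] by auto
  have cost: "cost (u, v) = dist (pos L u) (pos L v)" if "i < n" "(Source i, u) \<in> (arcs L)\<^sup>*" for i u v
    using load_neq_0[OF L that] alpha by (simp add: cost_def)
  have pos: "pos L (Source i) = sources I ! i" "pos L (Sink 0) = t" if "i < n" for i
    using L that sinks by (auto simp: is_layout_def)
  have "(\<Sum>i<n. dist (sources I ! i) (pos L (up i))) = sum cost ?A"
    using cost pos by (subst sum.reindex) (auto simp: inj_on_def intro!: sum.cong)
  moreover have "(\<Sum>v\<in>?V. dist (pos L v) t) = sum cost ?B"
  proof -
    have "cost (v, Sink 0) = dist (pos L v) t" if v: "v \<in> ?V" for v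
    proof -
      obtain i where "i < n" "(Source i, v) \<in> arcs L" using up v by auto
      then show ?thesis using cost[OF \<open>i < n\<close> r_into_rtrancl] pos(2) by simp
    qed
    then show ?thesis by (subst sum.reindex) (auto simp: inj_on_def intro!: sum.cong)
  qed
  moreover have "sum cost ?A + sum cost ?B = sum cost (?A \<union> ?B)"
    by (rule sum.union_disjoint[symmetric]) (use V in auto)
  moreover have "sum cost (?A \<union> ?B) \<le> sum cost (arcs L)"
  proof (rule sum_mono2)
    have "finite (verts L)" "arcs L \<subseteq> verts L \<times> verts L"
      using L by (simp_all add: is_layout_def rooted_forest_def)
    then show "finite (arcs L)" by (meson finite_SigmaI finite_subset)
  qed (use up V in \<open>auto simp: cost_def\<close>)
  ultimately show ?thesis by (simp add: layout_cost_def cost_def)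
qed

lemma site_cost_le_layout_cost:
  assumes L: "is_layout I L"
  obtains h Q where "finite Q" "h ` {..<n} \<subseteq> Q" "site_cost (sources I) t h Q \<le> layout_cost I L"
proof -
  obtain up where up: "\<And>i. i < n \<Longrightarrow> (Source i, up i) \<in> arcs L" using layout_source_arc[OF L] by metis
  let ?V = "up ` {..<n}"
  have "pos L (Sink 0) = t" using L sinks by (auto simp: is_layout_def)
  then have "(\<Sum>v\<in>?V. dist (pos L v) t) = (\<Sum>v\<in>?V - {Sink 0}. dist (pos L v) t)"
    by (intro sum.mono_neutral_right) auto
  then have "site_cost (sources I) t (\<lambda>i. pos L (up i)) (pos L ` ?V) \<le> layout_cost I L"
    using sum_arcs_le_layout_cost[OF L up] sum_dist_image_le[of ?V t "pos L"] by (simp add: site_cost_def)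
  then show ?thesis using that[of "pos L ` ?V" "\<lambda>i. pos L (up i)"] by auto
qed

end

locale star_output = one_layer_instance +
  fixes s :: state and m :: nat and k :: "nat \<Rightarrow> nat"
  assumes steiner_count: "nmem s 1 0 = m"
    and source_parent: "\<And>i. i < n \<Longrightarrow> nmem s 2 i = n + k i" "\<And>i. i < n \<Longrightarrow> k i < m"
    and steiner_child: "\<And>j. j < m \<Longrightarrow> \<exists>i<n. k i = j"
    and steiner_parent: "\<And>j. j < m \<Longrightarrow> nmem s 2 (n + j) = n + m"
begin

abbreviation L :: layout where "L \<equiv> output_layout I s"

definition steiner_pos :: "nat \<Rightarrow> point" where
  "steiner_pos j = (rmem s 3 j, rmem s 4 j)"

lemma pos_output:
  "pos L (Source i) = sources I ! i" "pos L (Steiner j) = steiner_pos j" "pos L (Sink 0) = t"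
  by (simp_all add: output_layout_def Let_def steiner_pos_def sinks)

lemma parent_output:
  "parent L (Source i) = (if i < n then Some (Steiner (k i)) else None)"
  "parent L (Steiner j) = (if j < m then Some (Sink 0) else None)"
  "parent L (Sink l) = None"
  using source_parent steiner_parent steiner_count
  by (simp_all add: output_layout_def output_parent_def vertex_of_code_def)

lemma parent_output_iff:
  "parent L u = Some v \<longleftrightarrow> (\<exists>i<n. u = Source i \<and> v = Steiner (k i)) \<or> (\<exists>j<m. u = Steiner j \<and> v = Sink 0)"
  by (cases u) (auto simp: parent_output)

lemma verts_output: "verts L = Source ` {..<n} \<union> Steiner ` {..<m} \<union> (if m = 0 then {} else {Sink 0})"
proof -
  have "verts L = {u. \<exists>v. parent L u = Some v} \<union> {v. \<exists>u. parent L u = Some v}"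
    by (simp add: output_layout_def Let_def)
  also have "{u. \<exists>v. parent L u = Some v} = Source ` {..<n} \<union> Steiner ` {..<m}"
    unfolding parent_output_iff by auto
  also have "{v. \<exists>u. parent L u = Some v} = Steiner ` k ` {..<n} \<union> (if m = 0 then {} else {Sink 0})"
    unfolding parent_output_iff by auto
  also have "k ` {..<n} = {..<m}" using source_parent(2) steiner_child by auto
  finally show ?thesis by auto
qed

lemma arcs_output: "arcs L = (\<lambda>i. (Source i, Steiner (k i))) ` {..<n} \<union> (\<lambda>j. (Steiner j, Sink 0)) ` {..<m}"
  unfolding arcs_def parent_output_iff verts_output by auto

definition level :: "vertex \<Rightarrow> nat" where
  "level v = (case v of Source i \<Rightarrow> 0 | Steiner j \<Rightarrow> 1 | Sink j \<Rightarrow> 2)"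

lemma level_arc: "(u, v) \<in> arcs L \<Longrightarrow> level v = Suc (level u)"
  by (auto simp: arcs_output level_def)

lemma level_relpow: "(u, v) \<in> arcs L ^^ d \<Longrightarrow> level v = level u + d"
  by (induction d arbitrary: v) (auto dest: level_arc)

lemma is_layout_output: "is_layout I L"
proof -
  have "finite (verts L)" by (simp add: verts_output)
  moreover have "arcs L \<subseteq> verts L \<times> verts L"
    using source_parent(2) by (auto simp: arcs_output verts_output split: if_splits)
  moreover have "acyclic (arcs L)"
  proof (rule acyclicI_order[where f = "\<lambda>v. 2 - level v"])
    fix u v assume "(u, v) \<in> arcs L"
    moreover have "level v \<le> 2" by (simp add: level_def split: vertex.split)
    ultimately show "2 - level v < 2 - level u" using level_arc by fastforce
  qed
  moreover have "height_at_most L (layers I + 1)"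
    unfolding height_at_most_def
  proof (intro allI impI)
    fix u v d assume "(u, v) \<in> arcs L ^^ d"
    moreover have "level v \<le> 2" by (simp add: level_def split: vertex.split)
    ultimately show "d \<le> layers I + 1" using level_relpow layers by fastforce
  qed
  moreover have "\<exists>u. (u, Steiner j) \<in> arcs L" if "j < m" for j
    using steiner_child[OF that] unfolding arcs_output by blast
  then have "leaves L = Source ` {..<n}"
    unfolding leaves_def verts_output by (auto simp: arcs_output split: if_splits)
  moreover have "roots L = (if m = 0 then {} else {Sink 0})"
    by (auto simp: roots_def verts_output parent_output split: if_splits)
  ultimately show ?thesis
    unfolding is_layout_def rooted_forest_def
    using sinks pos_output by (auto simp: verts_output split: if_splits)
qed

lemma layout_cost_output_le:
  "layout_cost I L \<le> (\<Sum>i<n. dist (sources I ! i) (steiner_pos (k i))) + (\<Sum>j<m. dist (steiner_pos j) t)"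
proof -
  have load_le: "d * real l powr alpha I \<le> d" if "0 \<le> d" for d l
    using that alpha by (cases "l = 0") auto
  have "layout_cost I L \<le> (\<Sum>(u, v)\<in>arcs L. dist (pos L u) (pos L v))"
    unfolding layout_cost_def by (rule sum_mono) (auto intro!: load_le)
  also have "\<dots> = (\<Sum>(u, v)\<in>(\<lambda>i. (Source i, Steiner (k i))) ` {..<n}. dist (pos L u) (pos L v)) +
      (\<Sum>(u, v)\<in>(\<lambda>j. (Steiner j, Sink 0)) ` {..<m}. dist (pos L u) (pos L v))"
    unfolding arcs_output by (rule sum.union_disjoint) auto
  also have "\<dots> = (\<Sum>i<n. dist (sources I ! i) (steiner_pos (k i))) + (\<Sum>j<m. dist (steiner_pos j) t)"
    by (simp add: sum.reindex inj_on_def pos_output)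
  finally show ?thesis .
qed

end

section \<open>The hull order of the sources\<close>

lemma (in linorder) card_less_strict_mono:
  assumes "finite S" "x \<in> S" "x < y"
  shows "card {z \<in> S. z < x} < card {z \<in> S. z < y}"
  by (rule psubset_card_mono) (use assms less_trans in auto)

lemma (in linorder) bij_betw_card_less:
  assumes "finite S"
  shows "bij_betw (\<lambda>x. card {z \<in> S. z < x}) S {..<card S}"
  unfolding bij_betw_def
proof
  show inj: "inj_on (\<lambda>x. card {z \<in> S. z < x}) S"
  proof (rule inj_onI)
    fix x y assume "x \<in> S" "y \<in> S" "card {z \<in> S. z < x} = card {z \<in> S. z < y}"
    then have "\<not> x < y" "\<not> y < x"
      using card_less_strict_mono[OF assms, of x y] card_less_strict_mono[OF assms, of y x] by auto
    then show "x = y" using less_linear by blast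
  qed
  have "card {z \<in> S. z < x} < card S" if "x \<in> S" for x
    by (rule psubset_card_mono) (use assms that in auto)
  then show "(\<lambda>x. card {z \<in> S. z < x}) ` S = {..<card S}"
    using card_image[OF inj] by (intro card_subset_eq) auto
qed

definition before :: "point list \<Rightarrow> nat \<Rightarrow> nat \<Rightarrow> bool" where
  "before A i j \<longleftrightarrow> hull_less (set A) (A ! i) (A ! j) \<or> A ! i = A ! j \<and> i < j"

definition before_eq :: "point list \<Rightarrow> nat \<Rightarrow> nat \<Rightarrow> bool" where
  "before_eq A i j \<longleftrightarrow> i = j \<or> before A i j"

interpretation before: linorder "before_eq A" "before A" for A
proof -
  let ?less = "\<lambda>i j. hull_less (set A) (A ! i) (A ! j)"
  have trans: "before A i k" if less: "before A i j" "before A j k" for i j k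
  proof -
    consider "?less i j" "?less j k" | "?less i j" "A ! j = A ! k" | "A ! i = A ! j" "?less j k"
      | "A ! i = A ! j" "A ! j = A ! k" "i < k"
      using less less_trans[of i j k] unfolding before_def by blast
    then have "?less i k \<or> A ! i = A ! k \<and> i < k" by cases (use hull.less_trans in fastforce)+
    then show ?thesis by (simp only: before_def)
  qed
  have asym: "\<not> before A j i" if "before A i j" for i j
    using that hull.less_asym[of "set A" "A ! i" "A ! j"] hull.less_irrefl[of "set A" "A ! i"] less_asym[of i j]
    unfolding before_def by metis
  have total: "before A i j \<or> i = j \<or> before A j i" for i j
    using hull.less_linear[of "set A" "A ! i" "A ! j"] less_linear[of i j] unfolding before_def by metis
  show "class.linorder (before_eq A) (before A)"
    by unfold_locales (use trans asym total in \<open>unfold before_eq_def, blast+\<close>)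
qed

definition hull_rank :: "point list \<Rightarrow> nat \<Rightarrow> nat" where
  "hull_rank A i = card {j \<in> {..<length A}. before A j i}"

definition source_at :: "point list \<Rightarrow> nat \<Rightarrow> nat" where
  "source_at A p = the_inv_into {..<length A} (hull_rank A) (p mod length A)"

definition hull_seq :: "point list \<Rightarrow> nat \<Rightarrow> point" where
  "hull_seq A p = A ! source_at A p"

lemma bij_betw_hull_rank: "bij_betw (hull_rank A) {..<length A} {..<length A}"
  unfolding hull_rank_def using before.bij_betw_card_less[of "{..<length A}" A] by simp

lemma hull_rank_less: "i < length A \<Longrightarrow> hull_rank A i < length A"
  using bij_betw_hull_rank[of A] by (auto simp: bij_betw_def)

lemma source_at_hull_rank: "i < length A \<Longrightarrow> source_at A (hull_rank A i) = i"
  using bij_betw_hull_rank[of A] hull_rank_less[of i A]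
  by (simp add: source_at_def bij_betw_def the_inv_into_f_f)

lemma source_at_periodic: "source_at A (p + length A) = source_at A p"
  by (simp add: source_at_def)

lemma bij_betw_mod_interval:
  fixes b n :: nat
  shows "bij_betw (\<lambda>p. p mod n) {b..<b + n} {..<n}"
proof (cases "n = 0")
  case False
  have inj: "inj_on (\<lambda>p. p mod n) {b..<b + n}"
  proof (rule linorder_inj_onI')
    fix p q assume pq: "p \<in> {b..<b + n}" "q \<in> {b..<b + n}" "p < q"
    show "p mod n \<noteq> q mod n"
    proof
      assume "p mod n = q mod n"
      then have "n dvd q - p" using pq(3) mod_eq_dvd_iff_nat[of p q n] by simp
      then show False using pq by (auto dest: dvd_imp_le)
    qed
  qed
  moreover have "(\<lambda>p. p mod n) ` {b..<b + n} = {..<n}"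
    using False card_image[OF inj] by (intro card_subset_eq) auto
  ultimately show ?thesis by (simp add: bij_betw_def)
qed (simp add: bij_betw_def)

lemma bij_betw_source_at: "bij_betw (source_at A) {b..<b + length A} {..<length A}"
  using bij_betw_trans[OF bij_betw_mod_interval bij_betw_the_inv_into[OF bij_betw_hull_rank[of A]], of b]
  by (simp add: comp_def source_at_def[abs_def])

lemma sum_source_at: "(\<Sum>p\<in>{b..<b + length A}. f (source_at A p)) = (\<Sum>i<length A. f i)"
  by (rule sum.reindex_bij_betw[OF bij_betw_source_at])

lemma source_at_less: "A \<noteq> [] \<Longrightarrow> source_at A p < length A"
  using bij_betw_apply[OF bij_betw_source_at[of A p], of p] by auto

lemma source_at_sorted:
  assumes "p < q" "q < length A"
  shows "before A (source_at A p) (source_at A q)"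
proof -
  let ?i = "source_at A p" and ?j = "source_at A q"
  have "A \<noteq> []" using assms by auto
  have rank: "hull_rank A (source_at A r) = r" if "r < length A" for r
    using that bij_betw_hull_rank[of A] by (simp add: source_at_def f_the_inv_into_f_bij_betw)
  have "\<not> before A ?j ?i"
  proof
    assume "before A ?j ?i"
    then have "hull_rank A ?j < hull_rank A ?i"
      unfolding hull_rank_def
      using source_at_less[OF \<open>A \<noteq> []\<close>] by (intro before.card_less_strict_mono) simp_all
    then show False using rank assms by simp
  qed
  moreover have "?i \<noteq> ?j"
  proof
    assume "?i = ?j"
    then have "hull_rank A ?i = hull_rank A ?j" by simp
    then show False using rank assms by simp
  qed
  ultimately show ?thesis using before.less_linear[of A ?i ?j] by blast
qed

lemma hull_seq_in_set: "A \<noteq> [] \<Longrightarrow> hull_seq A p \<in> set A"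
  using source_at_less by (simp add: hull_seq_def)

lemma alternating_hull_seq:
  assumes "convex_boundary (set A) H"
  shows "alternating (hull_seq A) 0 (length A)"
proof (rule convex_boundary.alternating_hull_sorted[OF assms])
  show "hull_seq A i \<in> set A" if "i < length A" for i
    using that by (intro hull_seq_in_set) auto
  show "hull_le (set A) (hull_seq A i) (hull_seq A j)" if "i < j" "j < length A" for i j
    using source_at_sorted[OF that] by (auto simp: hull_seq_def hull_le_def before_def)
qed

lemma (in one_layer_instance) recurrence_le_layout_cost:
  assumes "convex_instance I" and L: "is_layout I L"
    and F: "interval_recurrence c t (hull_seq (sources I)) n F" "0 \<le> c"
  shows "\<exists>r\<le>n. F r (r + n) \<le> c * layout_cost I L"
proof (cases "n = 0")
  case True
  then have "F 0 0 \<le> 0" using F(1) by (simp add: interval_recurrence_def)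
  also have "0 \<le> c * layout_cost I L" using F(2) layout_cost_nonneg by simp
  finally show ?thesis using True by auto
next
  case False
  let ?A = "sources I"
  define H where "H = convex hull (set ?A \<union> {t})"
  have H: "convex H" "closed H" "t \<in> H" "set ?A \<subseteq> H"
    by (auto simp: H_def intro!: compact_imp_closed finite_imp_compact_convex_hull hull_inc)
  have boundary: "convex_boundary (set ?A) H"
  proof
    show "set ?A \<subseteq> frontier H" using assms(1) by (simp add: H_def convex_instance_def sinks)
  qed (fact H(1,4))+
  obtain h Q where Q: "finite Q" "h ` {..<n} \<subseteq> Q" "site_cost ?A t h Q \<le> layout_cost I L"
    by (rule site_cost_le_layout_cost[OF L])
  define h' where "h' = closest_point H \<circ> h"
  let ?Q = "closest_point H ` Q"
  have "\<exists>r\<le>n. F r (r + n) \<le> c * ((\<Sum>i<n. dist (hull_seq ?A i) (h' (source_at ?A i))) + (\<Sum>q\<in>?Q. dist q t))"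
  proof (rule interval_recurrence_le_sites[OF boundary _ _ _ _ _ alternating_hull_seq[OF boundary] _ F])
    have "H \<noteq> {}" using H(3) by blast
    then show "?Q \<subseteq> H" using closest_point_in_set[OF H(2)] by blast
    show "hull_seq ?A i \<in> set ?A" for i
      using False by (intro hull_seq_in_set) simp
    show "h' (source_at ?A i) \<in> ?Q" for i
      using source_at_less[of ?A i] False Q(2) by (auto simp: h'_def)
  qed (use False Q(1) in \<open>simp_all add: hull_seq_def source_at_periodic\<close>)
  moreover have "(\<Sum>i<n. dist (hull_seq ?A i) (h' (source_at ?A i))) = (\<Sum>i<n. dist (?A ! i) (h' i))"
    using sum_source_at[of "\<lambda>i. dist (?A ! i) (h' i)" ?A 0] by (simp add: hull_seq_def atLeast0LessThan)
  then have "(\<Sum>i<n. dist (hull_seq ?A i) (h' (source_at ?A i))) + (\<Sum>q\<in>?Q. dist q t) \<le> layout_cost I L"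
    using site_cost_closest_point[OF H Q(1), of h] Q(3) by (simp add: site_cost_def h'_def)
  ultimately show ?thesis using F(2) by (meson mult_left_mono order_trans)
qed

section \<open>Solutions on an interval of positions\<close>

text \<open>
  The label of a position is a representative of its group, so that the fixed points of the labelling
  enumerate the groups.
\<close>

record solution =
  label :: "nat \<Rightarrow> nat"
  site :: "nat \<Rightarrow> point"
  val :: real

definition leaders :: "nat \<Rightarrow> nat \<Rightarrow> solution \<Rightarrow> nat set" where
  "leaders u v S = {p \<in> {u..<v}. label S p = p}"

definition valid :: "(nat \<Rightarrow> point) \<Rightarrow> point \<Rightarrow> nat \<Rightarrow> nat \<Rightarrow> solution \<Rightarrow> bool" where
  "valid X t u v S \<longleftrightarrow>
     (\<forall>p\<in>{u..<v}. label S p \<in> {u..<v} \<and> label S (label S p) = label S p \<and> site S (label S p) = site S p) \<and>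
     (\<Sum>p\<in>{u..<v}. dist (X p) (site S p)) + (\<Sum>p\<in>leaders u v S. dist (site S p) t) \<le> val S"

lemma validD:
  assumes "valid X t u v S"
  shows "p \<in> {u..<v} \<Longrightarrow> label S p \<in> {u..<v}" "p \<in> {u..<v} \<Longrightarrow> label S (label S p) = label S p"
    "p \<in> {u..<v} \<Longrightarrow> site S (label S p) = site S p"
    "(\<Sum>p\<in>{u..<v}. dist (X p) (site S p)) + (\<Sum>p\<in>leaders u v S. dist (site S p) t) \<le> val S"
  using assms unfolding valid_def by blast+

lemma label_in_leaders:
  assumes "valid X t u v S" "p \<in> {u..<v}"
  shows "label S p \<in> leaders u v S"
  using validD(1,2)[OF assms] by (simp add: leaders_def)

definition position_from :: "nat \<Rightarrow> point list \<Rightarrow> nat \<Rightarrow> nat" where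
  "position_from b A = the_inv_into {b..<b + length A} (source_at A)"

lemma position_from:
  assumes "i < length A"
  shows "position_from b A i \<in> {b..<b + length A}" "source_at A (position_from b A i) = i"
  using assms bij_betw_apply[OF bij_betw_the_inv_into[OF bij_betw_source_at[of A b]], of i]
    f_the_inv_into_f_bij_betw[OF bij_betw_source_at[of A b]]
  by (simp_all add: position_from_def)

lemma position_from_source_at: "p \<in> {b..<b + length A} \<Longrightarrow> position_from b A (source_at A p) = p"
  unfolding position_from_def by (rule the_inv_into_f_f[OF bij_betw_imp_inj_on[OF bij_betw_source_at]])

lemma (in one_layer_instance) output_of_solution:
  assumes S: "valid (hull_seq (sources I)) t b (b + n) S"
    and ls: "ls = sorted_list_of_set (leaders b (b + n) S)" and count: "nmem s 1 0 = length ls"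
    and steiner: "\<And>j. j < length ls \<Longrightarrow> index (ls ! j) = j"
      "\<And>j. j < length ls \<Longrightarrow> (rmem s 3 j, rmem s 4 j) = site S (ls ! j)"
    and parents: "\<And>p. p \<in> {b..<b + n} \<Longrightarrow> nmem s 2 (source_at (sources I) p) = n + index (label S p)"
      "\<And>j. j < length ls \<Longrightarrow> nmem s 2 (n + j) = n + length ls"
  shows "is_layout I (output_layout I s)" "layout_cost I (output_layout I s) \<le> val S"
proof -
  let ?A = "sources I" and ?R = "{b..<b + n}"
  have set: "set ls = leaders b (b + n) S" by (simp add: ls leaders_def)
  have group: "index (label S p) < length ls" "ls ! index (label S p) = label S p" if p: "p \<in> ?R" for p
  proof -
    obtain j where "j < length ls" "ls ! j = label S p"
      using label_in_leaders[OF S p] unfolding set[symmetric] in_set_conv_nth by blast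
    then show "index (label S p) < length ls" "ls ! index (label S p) = label S p" using steiner(1) by metis+
  qed
  define k where "k i = index (label S (position_from b ?A i))" for i
  interpret star_output I t s "length ls" k
  proof unfold_locales
    fix j assume j: "j < length ls"
    then have "ls ! j \<in> leaders b (b + n) S" using set nth_mem by blast
    then have "ls ! j \<in> ?R" "label S (ls ! j) = ls ! j" by (auto simp: leaders_def)
    then have "k (source_at ?A (ls ! j)) = j" "source_at ?A (ls ! j) < n"
      using steiner(1)[OF j] bij_betw_apply[OF bij_betw_source_at] by (auto simp: k_def position_from_source_at)
    then show "\<exists>i<n. k i = j" by blast
  next
    fix i assume "i < n"
    then show "nmem s 2 i = n + k i" "k i < length ls"
      using position_from[of i ?A b] parents(1)[of "position_from b ?A i"] group(1) by (auto simp: k_def)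
  qed (use count parents(2) in auto)
  show "is_layout I (output_layout I s)" by (rule is_layout_output)
  have steiner_pos: "steiner_pos j = site S (ls ! j)" if "j < length ls" for j
    using steiner(2)[OF that] by (simp add: steiner_pos_def)
  have "(\<Sum>i<n. dist (?A ! i) (steiner_pos (k i))) =
      (\<Sum>p\<in>?R. dist (?A ! source_at ?A p) (steiner_pos (k (source_at ?A p))))"
    by (rule sum_source_at[symmetric])
  also have "\<dots> = (\<Sum>p\<in>?R. dist (hull_seq ?A p) (site S p))"
    using group validD(3)[OF S]
    by (intro sum.cong) (simp_all add: k_def steiner_pos hull_seq_def position_from_source_at)
  finally have connect: "(\<Sum>i<n. dist (?A ! i) (steiner_pos (k i))) = (\<Sum>p\<in>?R. dist (hull_seq ?A p) (site S p))" .
  have "(\<Sum>j<length ls. dist (steiner_pos j) t) = (\<Sum>j<length ls. dist (site S (ls ! j)) t)"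
    by (rule sum.cong) (simp_all add: steiner_pos)
  also have "\<dots> = (\<Sum>p\<in>set ls. dist (site S p) t)"
    by (rule sum.reindex_bij_betw[OF bij_betw_nth]) (simp_all add: ls)
  finally show "layout_cost I (output_layout I s) \<le> val S"
    using layout_cost_output_le validD(4)[OF S] connect unfolding set by linarith
qed

section \<open>Execution of programs\<close>

lemma nmem_nupd [simp]: "nmem (nupd a i x s) = (nmem s)(a := (nmem s a)(i := x))"
  and rmem_nupd [simp]: "rmem (nupd a i x s) = rmem s"
  and nmem_rupd [simp]: "nmem (rupd a i y s) = nmem s"
  and rmem_rupd [simp]: "rmem (rupd a i y s) = (rmem s)(a := (rmem s a)(i := y))"
  by (simp_all add: nupd_def rupd_def)

inductive_cases SkipE: "exec SKIP s k s'"
inductive_cases NAssignE: "exec (NAssign a i e) s k s'"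
inductive_cases RAssignE: "exec (RAssign a i e) s k s'"
inductive_cases SeqE: "exec (Seq c d) s k s'"
inductive_cases IfE: "exec (If b c d) s k s'"
inductive_cases WhileE: "exec (While b c) s k s'"

lemma exec_deterministic:
  "exec c s k s' \<Longrightarrow> exec c s l t \<Longrightarrow> k = l \<and> s' = t"
proof (induction arbitrary: l t rule: exec.induct)
  case (Seq c s j s' d k s'')
  from Seq.prems show ?case by (rule SeqE) (use Seq.IH in blast)
next
  case (IfTrue b s c k s' d)
  from IfTrue.prems obtain i where "l = i + 1" "exec c s i t"
    by (rule IfE) (use IfTrue.hyps in auto)
  then show ?case using IfTrue.IH by blast
next
  case (IfFalse b s d k s' c)
  from IfFalse.prems obtain i where "l = i + 1" "exec d s i t"
    by (rule IfE) (use IfFalse.hyps in auto)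
  then show ?case using IfFalse.IH by blast
next
  case (WhileFalse b s c)
  from WhileFalse.prems show ?case by (rule WhileE) (use WhileFalse.hyps in auto)
next
  case (WhileTrue b s c j s' k s'')
  from WhileTrue.prems obtain i u m where "l = i + m + 1" "exec c s i u" "exec (While b c) u m t"
    by (rule WhileE) (use WhileTrue.hyps in auto)
  then show ?case using WhileTrue.IH by blast
qed (auto elim: SkipE NAssignE RAssignE)

lemma exec_pos: "exec c s k s' \<Longrightarrow> 1 \<le> k"
  by (induction rule: exec.induct) auto

fun nmods :: "com \<Rightarrow> nat set" where
  "nmods SKIP = {}"
| "nmods (NAssign a i e) = {a}"
| "nmods (RAssign a i e) = {}"
| "nmods (Seq c d) = nmods c \<union> nmods d"
| "nmods (If b c d) = nmods c \<union> nmods d"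
| "nmods (While b c) = nmods c"

fun rmods :: "com \<Rightarrow> nat set" where
  "rmods SKIP = {}"
| "rmods (NAssign a i e) = {}"
| "rmods (RAssign a i e) = {a}"
| "rmods (Seq c d) = rmods c \<union> rmods d"
| "rmods (If b c d) = rmods c \<union> rmods d"
| "rmods (While b c) = rmods c"

definition frame :: "com \<Rightarrow> state \<Rightarrow> state \<Rightarrow> bool" where
  "frame c s s' \<longleftrightarrow> (\<forall>a. a \<notin> nmods c \<longrightarrow> nmem s' a = nmem s a) \<and>
     (\<forall>a. a \<notin> rmods c \<longrightarrow> rmem s' a = rmem s a)"

lemma frame_nmem: "frame c s s' \<Longrightarrow> a \<notin> nmods c \<Longrightarrow> nmem s' a = nmem s a"
  and frame_rmem: "frame c s s' \<Longrightarrow> a \<notin> rmods c \<Longrightarrow> rmem s' a = rmem s a"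
  by (simp_all add: frame_def)

lemma frame_trans:
  "frame c s s' \<Longrightarrow> frame d s' s'' \<Longrightarrow> nmods d \<subseteq> nmods c \<Longrightarrow> rmods d \<subseteq> rmods c \<Longrightarrow> frame c s s''"
  by (auto simp: frame_def)

lemma exec_frame: "exec c s k s' \<Longrightarrow> frame c s s'"
  by (induction rule: exec.induct) (auto simp: frame_def)

lemma finite_nmods: "finite (nmods c)" and finite_rmods: "finite (rmods c)"
  by (induction c) auto

section \<open>A program inspects at most a constant number of cells per step\<close>

fun rsize :: "rexp \<Rightarrow> nat" where
  "rsize (RNat e) = 0"
| "rsize (RCell a i) = 1"
| "rsize (RAdd e f) = rsize e + rsize f"
| "rsize (RSub e f) = rsize e + rsize f"
| "rsize (RMul e f) = rsize e + rsize f"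
| "rsize (RDiv e f) = rsize e + rsize f"
| "rsize (RSqrt e) = rsize e"

fun bsize :: "bexp \<Rightarrow> nat" where
  "bsize (NLess e f) = 0"
| "bsize (RLess e f) = rsize e + rsize f"
| "bsize (BNot b) = bsize b"
| "bsize (BAnd b c) = bsize b + bsize c"

fun csize :: "com \<Rightarrow> nat" where
  "csize SKIP = 0"
| "csize (NAssign a i e) = 0"
| "csize (RAssign a i e) = rsize e"
| "csize (Seq c d) = csize c + csize d"
| "csize (If b c d) = bsize b + csize c + csize d"
| "csize (While b c) = bsize b + csize c"

fun rcells :: "nat \<Rightarrow> rexp \<Rightarrow> state \<Rightarrow> nat set" where
  "rcells r (RNat e) s = {}"
| "rcells r (RCell a i) s = (if a = r then {nval i s} else {})"
| "rcells r (RAdd e f) s = rcells r e s \<union> rcells r f s"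
| "rcells r (RSub e f) s = rcells r e s \<union> rcells r f s"
| "rcells r (RMul e f) s = rcells r e s \<union> rcells r f s"
| "rcells r (RDiv e f) s = rcells r e s \<union> rcells r f s"
| "rcells r (RSqrt e) s = rcells r e s"

fun bcells :: "nat \<Rightarrow> bexp \<Rightarrow> state \<Rightarrow> nat set" where
  "bcells r (NLess e f) s = {}"
| "bcells r (RLess e f) s = rcells r e s \<union> rcells r f s"
| "bcells r (BNot b) s = bcells r b s"
| "bcells r (BAnd b c) s = bcells r b s \<union> bcells r c s"

lemma finite_rcells: "finite (rcells r e s)" and card_rcells: "card (rcells r e s) \<le> rsize e"
  by (induction e) (auto intro!: order_trans[OF card_Un_le] add_mono)

lemma finite_bcells: "finite (bcells r b s)"
  by (induction b) (auto simp: finite_rcells)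

lemma card_bcells: "card (bcells r b s) \<le> bsize b"
  by (induction b) (auto intro!: order_trans[OF card_Un_le] add_mono card_rcells)

lemma nval_rupd [simp]: "nval e (rupd a i x s) = nval e s"
  by (induction e) auto

lemma rval_unread: "i \<notin> rcells r e s \<Longrightarrow> rval e (rupd r i x s) = rval e s"
  by (induction e) (auto split: if_splits)

lemma bval_unread: "i \<notin> bcells r b s \<Longrightarrow> bval b (rupd r i x s) = bval b s"
  by (induction b) (auto simp: rval_unread)

lemma rupd_twice: "rupd a i x (rupd a i y s) = rupd a i x s"
  by (simp add: rupd_def)

lemma rupd_commute: "(a, i) \<noteq> (b, j) \<Longrightarrow> rupd a i x (rupd b j y s) = rupd b j y (rupd a i x s)"
  by (auto simp: rupd_def fun_upd_twist)

lemma nupd_rupd_commute: "nupd a i x (rupd b j y s) = rupd b j y (nupd a i x s)"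
  by (simp add: nupd_def rupd_def)

text \<open>
  Changing a cell of array \<open>r\<close> outside of \<open>R\<close> does not affect the run, except perhaps for the final
  value of this cell.
\<close>

definition unread :: "nat \<Rightarrow> nat set \<Rightarrow> com \<Rightarrow> state \<Rightarrow> nat \<Rightarrow> state \<Rightarrow> bool" where
  "unread r R c s k s' \<longleftrightarrow> (\<forall>i x. i \<notin> R \<longrightarrow> (\<exists>y. exec c (rupd r i x s) k (rupd r i y s')))"

lemma unread_NAssign: "unread r {} (NAssign a i e) s 1 (nupd a (nval i s) (nval e s) s)"
  unfolding unread_def using exec.NAssign[of a i e "rupd r _ _ s"] by (auto simp: nupd_rupd_commute)

lemma unread_RAssign: "unread r (rcells r e s) (RAssign a i e) s 1 (rupd a (nval i s) (rval e s) s)"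
  unfolding unread_def
proof (intro allI impI)
  fix j x assume "j \<notin> rcells r e s"
  then have run: "exec (RAssign a i e) (rupd r j x s) 1 (rupd a (nval i s) (rval e s) (rupd r j x s))"
    using exec.RAssign[of a i e "rupd r j x s"] rval_unread[of j r e s x] by simp
  show "\<exists>y. exec (RAssign a i e) (rupd r j x s) 1 (rupd r j y (rupd a (nval i s) (rval e s) s))"
  proof (cases "(a, nval i s) = (r, j)")
    case True
    then show ?thesis using run by (auto simp: rupd_twice)
  next
    case False
    then show ?thesis using run rupd_commute by metis
  qed
qed

lemma unread_Seq:
  assumes "unread r R c s j s'" "unread r R' d s' k s''"
  shows "unread r (R \<union> R') (Seq c d) s (j + k) s''"
  unfolding unread_def
proof (intro allI impI)
  fix i x assume "i \<notin> R \<union> R'"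
  then obtain y z where "exec c (rupd r i x s) j (rupd r i y s')" "exec d (rupd r i y s') k (rupd r i z s'')"
    using assms unfolding unread_def by (metis UnCI)
  then show "\<exists>y. exec (Seq c d) (rupd r i x s) (j + k) (rupd r i y s'')" using exec.Seq by blast
qed

lemma unread_If:
  assumes "unread r R (if bval b s then c else d) s k s'"
  shows "unread r (R \<union> bcells r b s) (If b c d) s (k + 1) s'"
  unfolding unread_def
proof (intro allI impI)
  fix i x assume i: "i \<notin> R \<union> bcells r b s"
  then obtain y where "exec (if bval b s then c else d) (rupd r i x s) k (rupd r i y s')"
    using assms unfolding unread_def by blast
  then show "\<exists>y. exec (If b c d) (rupd r i x s) (k + 1) (rupd r i y s')"
    using bval_unread[of i r b s x] i exec.IfTrue[of b "rupd r i x s" c k "rupd r i y s'" d]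
      exec.IfFalse[of b "rupd r i x s" d k "rupd r i y s'" c] by (auto split: if_splits)
qed

lemma unread_WhileFalse:
  assumes "\<not> bval b s"
  shows "unread r (bcells r b s) (While b c) s 1 s"
  unfolding unread_def using assms bval_unread exec.WhileFalse by metis

lemma unread_WhileTrue:
  assumes "bval b s" "unread r R c s j s'" "unread r R' (While b c) s' k s''"
  shows "unread r (R \<union> R' \<union> bcells r b s) (While b c) s (j + k + 1) s''"
  unfolding unread_def
proof (intro allI impI)
  fix i x assume i: "i \<notin> R \<union> R' \<union> bcells r b s"
  then obtain y z where "exec c (rupd r i x s) j (rupd r i y s')"
    "exec (While b c) (rupd r i y s') k (rupd r i z s'')"
    using assms unfolding unread_def by (metis UnCI)
  moreover have "bval b (rupd r i x s)" using bval_unread[of i r b s x] i assms(1) by simp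
  ultimately show "\<exists>y. exec (While b c) (rupd r i x s) (j + k + 1) (rupd r i y s'')"
    using exec.WhileTrue by blast
qed

lemma exec_unread: "exec c s k s' \<Longrightarrow> \<exists>R. finite R \<and> card R \<le> csize c * k \<and> unread r R c s k s'"
proof (induction rule: exec.induct)
  case (Skip s)
  have "unread r {} SKIP s 1 s" unfolding unread_def using exec.Skip by blast
  then show ?case by (intro exI[of _ "{}"]) simp
next
  case (NAssign a i e s)
  show ?case by (intro exI[of _ "{}"]) (simp add: unread_NAssign[simplified])
next
  case (RAssign a i e s)
  show ?case
    by (intro exI[of _ "rcells r e s"]) (simp add: unread_RAssign[simplified] finite_rcells card_rcells)
next
  case (Seq c s j s' d k s'')
  then obtain R R' where R: "finite R" "card R \<le> csize c * j" "unread r R c s j s'"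
    and R': "finite R'" "card R' \<le> csize d * k" "unread r R' d s' k s''" by blast
  have "card (R \<union> R') \<le> csize c * j + csize d * k" using R(2) R'(2) card_Un_le[of R R'] by linarith
  also have "\<dots> \<le> csize (Seq c d) * (j + k)" by (simp add: algebra_simps)
  finally show ?case using R R' unread_Seq by (intro exI[of _ "R \<union> R'"]) simp
next
  case (IfTrue b s c k s' d)
  then obtain R where R: "finite R" "card R \<le> csize c * k" "unread r R c s k s'" by blast
  have "card (R \<union> bcells r b s) \<le> csize c * k + bsize b"
    using R(2) card_Un_le[of R "bcells r b s"] card_bcells[of r b s] by linarith
  also have "\<dots> \<le> csize (If b c d) * (k + 1)" by (simp add: algebra_simps)
  finally show ?case
    using R IfTrue.hyps(1) unread_If[of r R b s c d]
    by (intro exI[of _ "R \<union> bcells r b s"]) (simp add: finite_bcells)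
next
  case (IfFalse b s d k s' c)
  then obtain R where R: "finite R" "card R \<le> csize d * k" "unread r R d s k s'" by blast
  have "card (R \<union> bcells r b s) \<le> csize d * k + bsize b"
    using R(2) card_Un_le[of R "bcells r b s"] card_bcells[of r b s] by linarith
  also have "\<dots> \<le> csize (If b c d) * (k + 1)" by (simp add: algebra_simps)
  finally show ?case
    using R IfFalse.hyps(1) unread_If[of r R b s c d]
    by (intro exI[of _ "R \<union> bcells r b s"]) (simp add: finite_bcells)
next
  case (WhileFalse b s c)
  then show ?case
    using card_bcells[of r b s] unread_WhileFalse[of b s r c]
    by (intro exI[of _ "bcells r b s"]) (simp add: finite_bcells)
next
  case (WhileTrue b s c j s' k s'')
  then obtain R R' where R: "finite R" "card R \<le> csize c * j" "unread r R c s j s'"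
    and R': "finite R'" "card R' \<le> csize (While b c) * k" "unread r R' (While b c) s' k s''" by blast
  let ?R = "R \<union> R' \<union> bcells r b s"
  have "card ?R \<le> csize c * j + csize (While b c) * k + bsize b"
    using R(2) R'(2) card_Un_le[of R R'] card_Un_le[of "R \<union> R'" "bcells r b s"]
      card_bcells[of r b s] by linarith
  also have "\<dots> \<le> csize (While b c) * (j + k + 1)" by (simp add: algebra_simps)
  finally show ?case
    using R R' unread_WhileTrue[OF WhileTrue.hyps(1)] by (intro exI[of _ ?R]) (simp add: finite_bcells)
qed

lemma dist_le_weber_cost:
  assumes "a \<in> set A"
  shows "dist a t \<le> weber_cost t A"
proof (rule weber_cost_geI)
  fix p
  have "dist a p \<le> (\<Sum>a\<leftarrow>A. dist a p)" using assms by (intro member_le_sum_list) auto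
  then show "dist a t \<le> star_cost t A p" using dist_triangle[of a t p] by (simp add: star_cost_def)
qed

text \<open>A source that is never read could be moved away without any effect on the output.\<close>

lemma weber_program_linear_time:
  assumes W: "weber_program W T" and "\<epsilon> > 0"
  shows "real n \<le> real (csize W) * T n \<epsilon>" "1 \<le> T n \<epsilon>"
proof -
  define s where "s = \<lparr>nmem = (\<lambda>a i. n), rmem = (\<lambda>a i. if a = 0 \<and> i = 0 then \<epsilon> else 0)\<rparr>"
  let ?A = "replicate n (0, 0) :: point list" and ?t = "(0, 0) :: point"
  have run: "\<exists>k s'. exec W s k s' \<and> real k \<le> T n \<epsilon> \<and> weber_cost t A \<le> rmem s' 3 0 \<and>
      rmem s' 3 0 \<le> (1 + \<epsilon>) * weber_cost t A" if "holds_input \<epsilon> t A s" "length A = n" for t A s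
    using W \<open>\<epsilon> > 0\<close> that unfolding weber_program_def Let_def by (metis order_refl)
  have "holds_input \<epsilon> ?t ?A s" by (simp add: holds_input_def s_def)
  moreover have "weber_cost ?t ?A = 0" by (rule weber_cost_eq_0) (simp add: star_cost_def sum_list_replicate)
  ultimately obtain k s' where ks: "exec W s k s'" "real k \<le> T n \<epsilon>" "rmem s' 3 0 \<le> 0"
    using run[of ?t ?A s] by auto
  obtain R where R: "finite R" "card R \<le> csize W * k" "unread 1 R W s k s'" using exec_unread[OF ks(1)] by blast
  have "i \<in> R" if "i < n" for i
  proof (rule ccontr)
    assume "i \<notin> R"
    then obtain y where y: "exec W (rupd 1 i 1 s) k (rupd 1 i y s')" using R(3) unfolding unread_def by blast
    let ?B = "?A[i := (1, 0)]"
    have "holds_input \<epsilon> ?t ?B (rupd 1 i 1 s)"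
      using that by (auto simp: holds_input_def s_def nth_list_update)
    then obtain k' s'' where "exec W (rupd 1 i 1 s) k' s''" "weber_cost ?t ?B \<le> rmem s'' 3 0"
      using run by (metis length_list_update length_replicate)
    then have "weber_cost ?t ?B \<le> rmem s' 3 0" using exec_deterministic[OF y, of k' s''] by fastforce
    moreover have "dist (1, 0) ?t \<le> weber_cost ?t ?B"
      using that by (intro dist_le_weber_cost set_update_memI) simp
    ultimately show False using ks(3) by (simp add: dist_prod_def)
  qed
  then have "n \<le> card R" using R(1) card_mono[of R "{..<n}"] by auto
  then have "real n \<le> real (csize W) * real k" using R(2) by (metis of_nat_le_iff of_nat_mult order_trans)
  also have "\<dots> \<le> real (csize W) * T n \<epsilon>" using ks(2) by (simp add: mult_left_mono)
  finally show "real n \<le> real (csize W) * T n \<epsilon>" .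
  show "1 \<le> T n \<epsilon>" using exec_pos[OF ks(1)] ks(2) by linarith
qed

section \<open>Total correctness with time bounds\<close>

definition runs :: "com \<Rightarrow> real \<Rightarrow> (state \<Rightarrow> bool) \<Rightarrow> state \<Rightarrow> bool" where
  "runs c B Q s \<longleftrightarrow> (\<exists>k s'. exec c s k s' \<and> real k \<le> B \<and> Q s')"

fun straight :: "com \<Rightarrow> bool" where
  "straight (Seq c d) \<longleftrightarrow> straight c \<and> straight d"
| "straight (If b c d) \<longleftrightarrow> straight c \<and> straight d"
| "straight (While b c) \<longleftrightarrow> False"
| "straight c \<longleftrightarrow> True"

fun result :: "com \<Rightarrow> state \<Rightarrow> state" where
  "result SKIP s = s"
| "result (NAssign a i e) s = nupd a (nval i s) (nval e s) s"
| "result (RAssign a i e) s = rupd a (nval i s) (rval e s) s"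
| "result (Seq c d) s = result d (result c s)"
| "result (If b c d) s = (if bval b s then result c s else result d s)"
| "result (While b c) s = s"

fun steps :: "com \<Rightarrow> real" where
  "steps (Seq c d) = steps c + steps d"
| "steps (If b c d) = max (steps c) (steps d) + 1"
| "steps c = 1"

lemma runs_mono:
  assumes "runs c B Q s" "B \<le> B'" "\<And>s'. frame c s s' \<Longrightarrow> Q s' \<Longrightarrow> Q' s'"
  shows "runs c B' Q' s"
  using assms exec_frame unfolding runs_def by (meson order_trans)

lemma runs_Seq:
  assumes "runs c B P s" "\<And>s'. frame c s s' \<Longrightarrow> P s' \<Longrightarrow> runs d B' Q s'" "B + B' \<le> B''"
  shows "runs (Seq c d) B'' Q s"
proof -
  obtain j s' where j: "exec c s j s'" "real j \<le> B" "P s'" using assms(1) unfolding runs_def by blast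
  then obtain k s'' where k: "exec d s' k s''" "real k \<le> B'" "Q s''"
    using assms(2) exec_frame unfolding runs_def by blast
  have "real (j + k) \<le> B''" using j(2) k(2) assms(3) by simp
  then show ?thesis using exec.Seq[OF j(1) k(1)] k(3) unfolding runs_def by blast
qed

lemma runs_If:
  assumes "bval b s \<Longrightarrow> runs c B Q s" "\<not> bval b s \<Longrightarrow> runs d B Q s" "B + 1 \<le> B'"
  shows "runs (If b c d) B' Q s"
proof -
  obtain k s' where "exec (if bval b s then c else d) s k s'" "real k \<le> B" "Q s'"
    using assms(1,2) unfolding runs_def by (cases "bval b s") auto
  moreover from this have "exec (If b c d) s (k + 1) s'" "real (k + 1) \<le> B'"
    using assms(3) exec.IfTrue exec.IfFalse by (auto split: if_splits)
  ultimately show ?thesis unfolding runs_def by blast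
qed

lemma runs_straight: "straight c \<Longrightarrow> steps c \<le> B \<Longrightarrow> Q (result c s) \<Longrightarrow> runs c B Q s"
proof (induction c arbitrary: B Q s)
  case (Seq c d)
  show ?case
    by (rule runs_Seq[where B = "steps c" and B' = "steps d" and P = "\<lambda>s'. s' = result c s"])
      (use Seq in auto)
next
  case (If b c d)
  show ?case by (rule runs_If[where B = "max (steps c) (steps d)"]) (use If in auto)
qed (auto simp: runs_def intro!: exI[of _ "1::nat"] exec.intros[simplified])

lemma runs_straight_Seq:
  assumes "straight c" "runs d B Q (result c s)" "steps c + B \<le> B'"
  shows "runs (Seq c d) B' Q s"
  by (rule runs_Seq[OF runs_straight[OF assms(1) order_refl, where Q = "\<lambda>s'. s' = result c s"]])
    (use assms in auto)

lemma runs_While: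
  assumes body: "\<And>k s. I (Suc k) s \<Longrightarrow> bval b s \<and> runs c B (I k) s" and exit: "\<And>s. I 0 s \<Longrightarrow> \<not> bval b s"
  shows "I k s \<Longrightarrow> runs (While b c) (real k * (B + 1) + 1) (I 0) s"
proof (induction k arbitrary: s)
  case 0
  then show ?case using exec.WhileFalse[OF exit[OF 0]] unfolding runs_def by force
next
  case (Suc k)
  obtain j s' where j: "exec c s j s'" "real j \<le> B" "I k s'"
    using body[OF Suc.prems] unfolding runs_def by blast
  then obtain l s'' where l: "exec (While b c) s' l s''" "real l \<le> real k * (B + 1) + 1" "I 0 s''"
    using Suc.IH unfolding runs_def by blast
  have "exec (While b c) s (j + l + 1) s''" using exec.WhileTrue body[OF Suc.prems] j(1) l(1) by blast
  moreover have "real (j + l + 1) \<le> real (Suc k) * (B + 1) + 1" using j(2) l(2) by (simp add: algebra_simps)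
  ultimately show ?case using l(3) unfolding runs_def by blast
qed

abbreviation NVar :: "nat \<Rightarrow> nexp" where "NVar a \<equiv> NCell a (NConst 0)"
abbreviation NSet :: "nat \<Rightarrow> nexp \<Rightarrow> com" where "NSet a e \<equiv> NAssign a (NConst 0) e"
abbreviation NInc :: "nat \<Rightarrow> com" where "NInc a \<equiv> NSet a (NAdd (NVar a) (NConst 1))"
abbreviation NLe :: "nexp \<Rightarrow> nexp \<Rightarrow> bexp" where "NLe e f \<equiv> BNot (NLess f e)"
abbreviation NPos :: "nexp \<Rightarrow> bexp" where "NPos e \<equiv> NLess (NConst 0) e"
abbreviation BOr :: "bexp \<Rightarrow> bexp \<Rightarrow> bexp" where "BOr b c \<equiv> BNot (BAnd (BNot b) (BNot c))"
abbreviation Seq_syntax :: "com \<Rightarrow> com \<Rightarrow> com" (infixr ";;" 60) where "c ;; d \<equiv> Seq c d"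

definition For :: "nat \<Rightarrow> nexp \<Rightarrow> com \<Rightarrow> com" where
  "For a h c = NSet a (NConst 0) ;; While (NLess (NVar a) h) (c ;; NInc a)"

definition loop_time :: "nat \<Rightarrow> real \<Rightarrow> real" where
  "loop_time n B = real n * (B + 2) + 2"

lemma nmods_For [simp]: "nmods (For a h c) = insert a (nmods c)"
  and rmods_For [simp]: "rmods (For a h c) = rmods c"
  by (auto simp: For_def)

lemma runs_For:
  assumes a: "a \<notin> nmods c"
    and bound: "\<And>s'. frame (For a h c) s s' \<Longrightarrow> nval h s' = n"
    and init: "J 0 (nupd a 0 0 s)"
    and body: "\<And>i s'. i < n \<Longrightarrow> frame (For a h c) s s' \<Longrightarrow> nmem s' a 0 = i \<Longrightarrow> J i s' \<Longrightarrow>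
      runs c B (\<lambda>s''. J (Suc i) (nupd a 0 (Suc i) s'')) s'"
    and time: "loop_time n B \<le> B'"
    and exit: "\<And>s'. frame (For a h c) s s' \<Longrightarrow> J n s' \<Longrightarrow> Q s'"
  shows "runs (For a h c) B' Q s"
proof -
  define I where "I k s' \<longleftrightarrow> frame (For a h c) s s' \<and> k \<le> n \<and> nmem s' a 0 = n - k \<and> J (n - k) s'" for k s'
  have loop: "runs (While (NLess (NVar a) h) (c ;; NInc a)) (real n * (B + 1 + 1) + 1) (I 0) (nupd a 0 0 s)"
  proof (rule runs_While)
    fix k s' assume I: "I (Suc k) s'"
    then have k: "n - Suc k < n" "Suc (n - Suc k) = n - k" "k \<le> n" by (auto simp: I_def)
    have "nval h s' = n" "nmem s' a 0 = n - Suc k" using I bound by (auto simp: I_def)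
    then have test: "bval (NLess (NVar a) h) s'" using k(1) by simp
    have step: "runs c B (\<lambda>s''. J (n - k) (nupd a 0 (n - k) s'')) s'"
      using body[OF k(1), of s'] I unfolding I_def k(2) by blast
    have "runs (c ;; NInc a) (B + 1) (I k) s'"
    proof (rule runs_Seq[OF step])
      fix s'' assume frame: "frame c s' s''" and J: "J (n - k) (nupd a 0 (n - k) s'')"
      have "nmem s'' a 0 = n - Suc k" using frame_nmem[OF frame a] I by (simp add: I_def)
      then have res: "result (NInc a) s'' = nupd a 0 (n - k) s''" using k(2) by simp
      have "frame (For a h c) s (nupd a 0 (n - k) s'')" using I frame by (auto simp: I_def frame_def)
      then have "I k (result (NInc a) s'')" unfolding res using J k(3) by (simp add: I_def)
      then show "runs (NInc a) 1 (I k) s''" by (intro runs_straight) simp_all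
    qed simp
    then show "bval (NLess (NVar a) h) s' \<and> runs (c ;; NInc a) (B + 1) (I k) s'" using test by blast
  next
    show "\<not> bval (NLess (NVar a) h) s'" if "I 0 s'" for s' using that bound by (simp add: I_def)
    show "I n (nupd a 0 0 s)" using init by (simp add: I_def frame_def)
  qed
  have "runs (For a h c) (loop_time n B) (I 0) s"
    unfolding For_def
  proof (rule runs_straight_Seq)
    show "runs (While (NLess (NVar a) h) (c ;; NInc a)) (real n * (B + 1 + 1) + 1) (I 0)
        (result (NSet a (NConst 0)) s)" using loop by simp
  qed (simp_all add: loop_time_def algebra_simps)
  then show ?thesis using time by (rule runs_mono) (auto simp: I_def exit)
qed

definition clear :: "nat \<Rightarrow> nat \<Rightarrow> nexp \<Rightarrow> com" where
  "clear a b h = For a h (NAssign b (NVar a) (NConst 0))"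

lemma nmods_clear [simp]: "nmods (clear a b h) = {a, b}" and rmods_clear [simp]: "rmods (clear a b h) = {}"
  by (simp_all add: clear_def)

lemma runs_clear:
  assumes "a \<noteq> b" "\<And>s'. frame (clear a b h) s s' \<Longrightarrow> nval h s' = m"
  shows "runs (clear a b h) (3 * real m + 2) (\<lambda>s'. \<forall>i<m. nmem s' b i = 0) s"
  unfolding clear_def
proof (rule runs_For[where J = "\<lambda>k s'. \<forall>i<k. nmem s' b i = 0" and B = 1])
  show "runs (NAssign b (NVar a) (NConst 0)) 1 (\<lambda>s''. \<forall>i<Suc k. nmem (nupd a 0 (Suc k) s'') b i = 0) s'"
    if "nmem s' a 0 = k" "\<forall>i<k. nmem s' b i = 0" for k s'
    using that assms(1) by (intro runs_straight) (auto simp: less_Suc_eq)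
qed (use assms in \<open>auto simp: clear_def loop_time_def\<close>)

lemma runs_For_search:
  fixes \<tau> :: "state \<Rightarrow> 'v"
  assumes a: "a \<notin> nmods c"
    and bound: "\<And>s'. frame (For a h c) s s' \<Longrightarrow> nval h s' = m"
    and view: "\<And>x s. \<tau> (nupd a 0 x s) = \<tau> s"
    and init: "I (\<tau> s)" and refl: "\<And>x. R x x" and trans: "\<And>x y z. R x y \<Longrightarrow> R y z \<Longrightarrow> R x z"
    and stable: "\<And>i x y. P i x \<Longrightarrow> R x y \<Longrightarrow> P i y"
    and body: "\<And>i s'. i < m \<Longrightarrow> frame (For a h c) s s' \<Longrightarrow> nmem s' a 0 = i \<Longrightarrow> I (\<tau> s') \<Longrightarrow>
      runs c B (\<lambda>s''. I (\<tau> s'') \<and> R (\<tau> s') (\<tau> s'') \<and> P i (\<tau> s'')) s'"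
  shows "runs (For a h c) (loop_time m B) (\<lambda>s'. I (\<tau> s') \<and> R (\<tau> s) (\<tau> s') \<and> (\<forall>i<m. P i (\<tau> s'))) s"
proof (rule runs_For[where J = "\<lambda>k s'. I (\<tau> s') \<and> R (\<tau> s) (\<tau> s') \<and> (\<forall>i<k. P i (\<tau> s'))"])
  fix k s' assume "k < m" "frame (For a h c) s s'" "nmem s' a 0 = k"
    and J: "I (\<tau> s') \<and> R (\<tau> s) (\<tau> s') \<and> (\<forall>i<k. P i (\<tau> s'))"
  then have "runs c B (\<lambda>s''. I (\<tau> s'') \<and> R (\<tau> s') (\<tau> s'') \<and> P k (\<tau> s'')) s'" using body by blast
  then show "runs c B (\<lambda>s''. I (\<tau> (nupd a 0 (Suc k) s'')) \<and> R (\<tau> s) (\<tau> (nupd a 0 (Suc k) s'')) \<and>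
      (\<forall>i<Suc k. P i (\<tau> (nupd a 0 (Suc k) s'')))) s'"
    unfolding view
  proof (rule runs_mono)
    fix s'' assume post: "I (\<tau> s'') \<and> R (\<tau> s') (\<tau> s'') \<and> P k (\<tau> s'')"
    then have "P i (\<tau> s'')" if "i < Suc k" for i
      using J stable[of i "\<tau> s'" "\<tau> s''"] that less_Suc_eq by auto
    then show "I (\<tau> s'') \<and> R (\<tau> s) (\<tau> s'') \<and> (\<forall>i<Suc k. P i (\<tau> s''))" using post J trans by blast
  qed simp
qed (use a bound init refl view in auto)

definition Fors :: "nat list \<Rightarrow> nexp \<Rightarrow> com \<Rightarrow> com" where
  "Fors as h c = foldr (\<lambda>a. For a h) as c"

lemma Fors_simps [simp]: "Fors [] h c = c" "Fors (a # as) h c = For a h (Fors as h c)"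
  by (simp_all add: Fors_def)

lemma nmods_Fors [simp]: "nmods (Fors as h c) = set as \<union> nmods c"
  and rmods_Fors [simp]: "rmods (Fors as h c) = rmods c"
  by (induction as) auto

text \<open>
  An exhaustive search that establishes \<open>P is\<close> for all tuples \<open>is\<close> of loop counters. The view \<open>\<tau>\<close> of the
  state has an invariant \<open>I\<close>, and it only changes along \<open>R\<close>, which preserves what was established.
\<close>

lemma runs_Fors:
  fixes \<tau> :: "state \<Rightarrow> 'v"
  assumes "distinct as" "set as \<inter> nmods c = {}"
    and bound: "\<And>s'. frame (Fors as h c) s s' \<Longrightarrow> nval h s' = m"
    and view: "\<And>a x s. a \<in> set as \<Longrightarrow> \<tau> (nupd a 0 x s) = \<tau> s"
    and init: "I (\<tau> s)" and refl: "\<And>x. R x x" and trans: "\<And>x y z. R x y \<Longrightarrow> R y z \<Longrightarrow> R x z"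
    and stable: "\<And>is x y. P is x \<Longrightarrow> R x y \<Longrightarrow> P is y"
    and body: "\<And>is s'. set is \<subseteq> {..<m} \<Longrightarrow> frame (Fors as h c) s s' \<Longrightarrow>
      map (\<lambda>a. nmem s' a 0) as = is \<Longrightarrow> I (\<tau> s') \<Longrightarrow>
      runs c B (\<lambda>s''. I (\<tau> s'') \<and> R (\<tau> s') (\<tau> s'') \<and> P is (\<tau> s'')) s'"
  shows "runs (Fors as h c) ((loop_time m ^^ length as) B)
    (\<lambda>s'. I (\<tau> s') \<and> R (\<tau> s) (\<tau> s') \<and> (\<forall>is. length is = length as \<longrightarrow> set is \<subseteq> {..<m} \<longrightarrow> P is (\<tau> s'))) s"
  using assms(1,2) bound view init stable body
proof (induction as arbitrary: s P)
  case Nil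
  have "runs c B (\<lambda>s''. I (\<tau> s'') \<and> R (\<tau> s) (\<tau> s'') \<and> P [] (\<tau> s'')) s"
    using Nil.prems(5,7) by (simp add: frame_def)
  then show ?case by simp
next
  case (Cons a as)
  note bound = Cons.prems(3) and view = Cons.prems(4) and stable = Cons.prems(6) and body = Cons.prems(7)
  let ?all = "\<lambda>i x. \<forall>is. length is = length as \<longrightarrow> set is \<subseteq> {..<m} \<longrightarrow> P (i # is) x"
  have "runs (For a h (Fors as h c)) (loop_time m ((loop_time m ^^ length as) B))
      (\<lambda>s'. I (\<tau> s') \<and> R (\<tau> s) (\<tau> s') \<and> (\<forall>i<m. ?all i (\<tau> s'))) s"
  proof (rule runs_For_search)
    fix i s' assume i: "i < m" and frame: "frame (For a h (Fors as h c)) s s'" and a: "nmem s' a 0 = i"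
      and "I (\<tau> s')"
    have frame': "frame (Fors (a # as) h c) s s''" if "frame (Fors as h c) s' s''" for s''
      using frame_trans[OF frame that] by auto
    show "runs (Fors as h c) ((loop_time m ^^ length as) B) (\<lambda>s''. I (\<tau> s'') \<and> R (\<tau> s') (\<tau> s'') \<and>
        ?all i (\<tau> s'')) s'"
    proof (rule Cons.IH)
      fix "is" s''
      assume counters: "set is \<subseteq> {..<m}" "map (\<lambda>a. nmem s'' a 0) as = is" "I (\<tau> s'')"
        and frame'': "frame (Fors as h c) s' s''"
      have "nmem s'' a 0 = i" using frame_nmem[OF frame''] Cons.prems(1,2) a by simp
      then show "runs c B (\<lambda>r. I (\<tau> r) \<and> R (\<tau> s'') (\<tau> r) \<and> P (i # is) (\<tau> r)) s''"
        using body[OF _ frame'[OF frame''], of "i # is"] counters i by simp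
    qed (use Cons.prems(1,2) frame' \<open>I (\<tau> s')\<close> bound view in \<open>auto intro: stable\<close>)
  next
    show "?all i y" if "?all i x" "R x y" for i x y using that stable by blast
  qed (use Cons.prems(1-5) refl trans in auto)
  then show ?case
    unfolding Fors_simps
  proof (rule runs_mono)
    fix s' assume post: "I (\<tau> s') \<and> R (\<tau> s) (\<tau> s') \<and> (\<forall>i<m. ?all i (\<tau> s'))"
    have "P is (\<tau> s')" if "length is = length (a # as)" "set is \<subseteq> {..<m}" for "is"
      using post that by (cases "is") auto
    then show "I (\<tau> s') \<and> R (\<tau> s) (\<tau> s') \<and> (\<forall>is. length is = length (a # as) \<longrightarrow> set is \<subseteq> {..<m} \<longrightarrow> P is (\<tau> s'))"
      using post by blast
  qed simp
qed

lemma iterated_loop_time_le: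
  assumes "1 \<le> m" "1 \<le> B"
  shows "1 \<le> (loop_time m ^^ k) B \<and> (loop_time m ^^ k) B \<le> (5 * real m) ^ k * B"
proof (induction k)
  case (Suc k)
  let ?B = "(loop_time m ^^ k) B"
  have B: "1 \<le> ?B" "?B \<le> (5 * real m) ^ k * B" using Suc.IH by blast+
  have "1 * 1 \<le> real m * ?B" "real m * 1 \<le> real m * ?B" using assms(1) B(1) by (intro mult_mono; simp)+
  then have "loop_time m ?B \<le> 5 * real m * ?B" by (simp add: loop_time_def algebra_simps)
  also have "\<dots> \<le> 5 * real m * ((5 * real m) ^ k * B)" using B(2) by (intro mult_left_mono) simp_all
  finally have "loop_time m ?B \<le> (5 * real m) ^ Suc k * B" by (simp add: mult.assoc)
  moreover have "1 \<le> loop_time m ?B" using B(1) by (simp add: loop_time_def)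
  ultimately show ?case by simp
qed (use assms in simp)

section \<open>Tables of solutions\<close>

definition combine :: "nat \<Rightarrow> nat \<Rightarrow> nat \<Rightarrow> nat \<Rightarrow> nat \<Rightarrow> nat \<Rightarrow> solution \<Rightarrow> solution \<Rightarrow> nat \<Rightarrow> point \<Rightarrow> real \<Rightarrow> solution"
  where
  "combine u v u\<^sub>1 v\<^sub>1 u\<^sub>2 v\<^sub>2 S\<^sub>1 S\<^sub>2 m q w =
     \<lparr>label = (\<lambda>p. if p \<in> {u\<^sub>1..<v\<^sub>1} then label S\<^sub>1 p else if p \<in> {u\<^sub>2..<v\<^sub>2} then label S\<^sub>2 p
        else if p \<in> {u..<v} then m else 0),
      site = (\<lambda>p. if p \<in> {u\<^sub>1..<v\<^sub>1} then site S\<^sub>1 p else if p \<in> {u\<^sub>2..<v\<^sub>2} then site S\<^sub>2 p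
        else if p \<in> {u..<v} then q else 0),
      val = w + (val S\<^sub>1 + val S\<^sub>2)\<rparr>"

lemma val_combine [simp]: "val (combine u v u\<^sub>1 v\<^sub>1 u\<^sub>2 v\<^sub>2 S\<^sub>1 S\<^sub>2 m q w) = w + (val S\<^sub>1 + val S\<^sub>2)"
  by (simp add: combine_def)

lemma combine_cases:
  assumes gaps: "gaps u v u\<^sub>1 v\<^sub>1 u\<^sub>2 v\<^sub>2" and S: "S = combine u v u\<^sub>1 v\<^sub>1 u\<^sub>2 v\<^sub>2 S\<^sub>1 S\<^sub>2 m q w"
  shows "p \<in> {u\<^sub>1..<v\<^sub>1} \<Longrightarrow> label S p = label S\<^sub>1 p \<and> site S p = site S\<^sub>1 p"
    "p \<in> {u\<^sub>2..<v\<^sub>2} \<Longrightarrow> label S p = label S\<^sub>2 p \<and> site S p = site S\<^sub>2 p"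
    "p \<in> gapped_interval u v u\<^sub>1 v\<^sub>1 u\<^sub>2 v\<^sub>2 \<Longrightarrow> label S p = m \<and> site S p = q"
  using gaps by (auto simp: S combine_def gaps_def gapped_interval_def)

lemma sum_leaders_combine_le:
  assumes gaps: "gaps u v u\<^sub>1 v\<^sub>1 u\<^sub>2 v\<^sub>2" and S: "S = combine u v u\<^sub>1 v\<^sub>1 u\<^sub>2 v\<^sub>2 S\<^sub>1 S\<^sub>2 m q w"
  shows "(\<Sum>p\<in>leaders u v S. dist (site S p) t) \<le>
    (\<Sum>p\<in>leaders u\<^sub>1 v\<^sub>1 S\<^sub>1. dist (site S\<^sub>1 p) t) + ((\<Sum>p\<in>leaders u\<^sub>2 v\<^sub>2 S\<^sub>2. dist (site S\<^sub>2 p) t) + dist q t)"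
proof -
  define D where "D = gapped_interval u v u\<^sub>1 v\<^sub>1 u\<^sub>2 v\<^sub>2"
  note partition = gaps_partition[OF gaps, folded D_def]
  note cases = combine_cases[OF gaps S, folded D_def]
  have leaders: "leaders u v S = leaders u\<^sub>1 v\<^sub>1 S\<^sub>1 \<union> (leaders u\<^sub>2 v\<^sub>2 S\<^sub>2 \<union> (D \<inter> {m}))"
    unfolding leaders_def partition(1) using cases by auto
  have disjoint: "leaders u\<^sub>1 v\<^sub>1 S\<^sub>1 \<inter> (leaders u\<^sub>2 v\<^sub>2 S\<^sub>2 \<union> (D \<inter> {m})) = {}" "leaders u\<^sub>2 v\<^sub>2 S\<^sub>2 \<inter> (D \<inter> {m}) = {}"
    using partition(2,3) unfolding leaders_def by blast+
  have finite: "finite (leaders a b S')" for a b S' by (simp add: leaders_def)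
  have "(\<Sum>p\<in>leaders u v S. dist (site S p) t) = (\<Sum>p\<in>leaders u\<^sub>1 v\<^sub>1 S\<^sub>1. dist (site S p) t) +
      ((\<Sum>p\<in>leaders u\<^sub>2 v\<^sub>2 S\<^sub>2. dist (site S p) t) + (\<Sum>p\<in>D \<inter> {m}. dist (site S p) t))"
    unfolding leaders using disjoint finite by (simp add: sum.union_disjoint)
  also have "(\<Sum>p\<in>leaders u\<^sub>1 v\<^sub>1 S\<^sub>1. dist (site S p) t) = (\<Sum>p\<in>leaders u\<^sub>1 v\<^sub>1 S\<^sub>1. dist (site S\<^sub>1 p) t)"
    using cases(1) by (intro sum.cong) (auto simp: leaders_def)
  also have "(\<Sum>p\<in>leaders u\<^sub>2 v\<^sub>2 S\<^sub>2. dist (site S p) t) = (\<Sum>p\<in>leaders u\<^sub>2 v\<^sub>2 S\<^sub>2. dist (site S\<^sub>2 p) t)"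
    using cases(2) by (intro sum.cong) (auto simp: leaders_def)
  also have "(\<Sum>p\<in>D \<inter> {m}. dist (site S p) t) \<le> dist q t"
    using cases(3)[of m] by (cases "m \<in> D") simp_all
  finally show ?thesis by simp
qed

lemma valid_combine:
  assumes gaps: "gaps u v u\<^sub>1 v\<^sub>1 u\<^sub>2 v\<^sub>2" and S1: "valid X t u\<^sub>1 v\<^sub>1 S\<^sub>1" and S2: "valid X t u\<^sub>2 v\<^sub>2 S\<^sub>2"
    and D: "D = gapped_interval u v u\<^sub>1 v\<^sub>1 u\<^sub>2 v\<^sub>2" and m: "D \<noteq> {} \<Longrightarrow> m \<in> D"
    and w: "star_cost t (sources_at X D) q \<le> w"
  shows "valid X t u v (combine u v u\<^sub>1 v\<^sub>1 u\<^sub>2 v\<^sub>2 S\<^sub>1 S\<^sub>2 m q w)" (is "valid X t u v ?S")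
proof -
  note partition = gaps_partition[OF gaps, folded D]
  note cases = combine_cases[OF gaps refl, of _ S\<^sub>1 S\<^sub>2 m q w, folded D]
  have "finite D" by (simp add: D gapped_interval_def)
  have "label ?S p \<in> {u..<v} \<and> label ?S (label ?S p) = label ?S p \<and> site ?S (label ?S p) = site ?S p"
    if p: "p \<in> {u..<v}" for p
  proof -
    consider (gap1) "p \<in> {u\<^sub>1..<v\<^sub>1}"
      | (gap2) "p \<in> {u\<^sub>2..<v\<^sub>2}"
      | (group) "p \<in> D" using p unfolding partition(1) by blast
    then show ?thesis
    proof cases
      case gap1
      then show ?thesis unfolding partition(1) using cases(1) validD(1-3)[OF S1 gap1] by simp
    next
      case gap2
      then show ?thesis unfolding partition(1) using cases(2) validD(1-3)[OF S2 gap2] by simp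
    next
      case group
      then have "m \<in> D" using m by blast
      then show ?thesis unfolding partition(1) using cases(3) group by simp
    qed
  qed
  moreover have "(\<Sum>p\<in>{u..<v}. dist (X p) (site ?S p)) =
      (\<Sum>p\<in>{u\<^sub>1..<v\<^sub>1}. dist (X p) (site S\<^sub>1 p)) + ((\<Sum>p\<in>{u\<^sub>2..<v\<^sub>2}. dist (X p) (site S\<^sub>2 p)) + (\<Sum>p\<in>D. dist (X p) q))"
    unfolding partition(1) using partition(2,3) \<open>finite D\<close> cases by (simp add: sum.union_disjoint)
  moreover have "(\<Sum>p\<in>D. dist (X p) q) + dist q t \<le> w"
    using w star_cost_sources_at[OF \<open>finite D\<close>, of t X q] by simp
  ultimately show ?thesis
    using validD(4)[OF S1] validD(4)[OF S2] sum_leaders_combine_le[OF gaps refl, of S\<^sub>1 S\<^sub>2 m q w t]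
    unfolding valid_def val_combine by (intro conjI ballI) (blast+, linarith)
qed

type_synonym table = "nat \<times> nat \<rightharpoonup> solution"

definition offer :: "table \<Rightarrow> nat \<times> nat \<Rightarrow> solution \<Rightarrow> table" where
  "offer x k S = (if \<exists>S'. x k = Some S' \<and> val S' \<le> val S then x else x(k \<mapsto> S))"

definition table_val :: "table \<Rightarrow> nat \<Rightarrow> nat \<Rightarrow> real" where
  "table_val x u v = val (the (x (u, v)))"

definition table_valid :: "(nat \<Rightarrow> point) \<Rightarrow> point \<Rightarrow> nat \<Rightarrow> nat \<Rightarrow> table \<Rightarrow> bool" where
  "table_valid X t n d x \<longleftrightarrow> (\<forall>u v S. x (u, v) = Some S \<longrightarrow> valid X t u v S) \<and>
     (\<forall>u v. u \<le> v \<longrightarrow> v \<le> 2 * n \<longrightarrow> v - u \<le> d \<longrightarrow> x (u, v) \<noteq> None)"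

definition improves :: "nat \<Rightarrow> table \<Rightarrow> table \<Rightarrow> bool" where
  "improves d x y \<longleftrightarrow> (\<forall>u v. if v = u + d + 1
     then \<forall>S. x (u, v) = Some S \<longrightarrow> (\<exists>S'. y (u, v) = Some S' \<and> val S' \<le> val S) else y (u, v) = x (u, v))"

definition table_bounded :: "real \<Rightarrow> point \<Rightarrow> (nat \<Rightarrow> point) \<Rightarrow> nat \<Rightarrow> nat \<Rightarrow> nat \<Rightarrow> nat \<Rightarrow> nat \<Rightarrow> nat \<Rightarrow> nat \<Rightarrow> table \<Rightarrow>
    bool" where
  "table_bounded c t X n u v u\<^sub>1 v\<^sub>1 u\<^sub>2 v\<^sub>2 x \<longleftrightarrow> (v \<le> 2 * n \<longrightarrow> gaps u v u\<^sub>1 v\<^sub>1 u\<^sub>2 v\<^sub>2 \<longrightarrow> x (u, v) \<noteq> None \<and>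
     table_val x u v \<le> table_val x u\<^sub>1 v\<^sub>1 + table_val x u\<^sub>2 v\<^sub>2 +
       c * weber_cost t (sources_at X (gapped_interval u v u\<^sub>1 v\<^sub>1 u\<^sub>2 v\<^sub>2)))"

lemma table_validD:
  assumes "table_valid X t n d x"
  shows "x (u, v) = Some S \<Longrightarrow> valid X t u v S"
    "u \<le> v \<Longrightarrow> v \<le> 2 * n \<Longrightarrow> v - u \<le> d \<Longrightarrow> \<exists>S. x (u, v) = Some S"
  using assms unfolding table_valid_def by blast+

lemma improves_refl: "improves d x x"
  by (simp add: improves_def)

lemma improves_trans: "improves d x y \<Longrightarrow> improves d y z \<Longrightarrow> improves d x z"
  unfolding improves_def by (metis order_trans)

lemma improves_other: "improves d x y \<Longrightarrow> v \<noteq> u + d + 1 \<Longrightarrow> y (u, v) = x (u, v)"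
  unfolding improves_def by metis

lemma improves_table_val:
  assumes "improves d x y" "x (u, v) \<noteq> None"
  shows "y (u, v) \<noteq> None \<and> table_val y u v \<le> table_val x u v"
  using assms unfolding improves_def table_val_def
  by (cases "v = u + d + 1") (metis option.distinct(1) option.exhaust_sel option.sel, metis order_refl)

lemma table_bounded_improves:
  assumes "table_bounded c t X n u (u + d' + 1) u\<^sub>1 v\<^sub>1 u\<^sub>2 v\<^sub>2 x" and y: "improves d x y" and "d' \<le> d"
  shows "table_bounded c t X n u (u + d' + 1) u\<^sub>1 v\<^sub>1 u\<^sub>2 v\<^sub>2 y"
  unfolding table_bounded_def
proof (intro impI)
  assume v: "u + d' + 1 \<le> 2 * n" and gaps: "gaps u (u + d' + 1) u\<^sub>1 v\<^sub>1 u\<^sub>2 v\<^sub>2"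
  then have "v\<^sub>1 \<noteq> u\<^sub>1 + d + 1" "v\<^sub>2 \<noteq> u\<^sub>2 + d + 1" using \<open>d' \<le> d\<close> by (auto simp: gaps_def)
  then have "table_val y u\<^sub>1 v\<^sub>1 = table_val x u\<^sub>1 v\<^sub>1" "table_val y u\<^sub>2 v\<^sub>2 = table_val x u\<^sub>2 v\<^sub>2"
    using improves_other[OF y] by (simp_all add: table_val_def)
  then show "y (u, u + d' + 1) \<noteq> None \<and> table_val y u (u + d' + 1) \<le> table_val y u\<^sub>1 v\<^sub>1 + table_val y u\<^sub>2 v\<^sub>2 +
      c * weber_cost t (sources_at X (gapped_interval u (u + d' + 1) u\<^sub>1 v\<^sub>1 u\<^sub>2 v\<^sub>2))"
    using assms(1) v gaps improves_table_val[OF y, of u "u + d' + 1"] unfolding table_bounded_def by fastforce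
qed

lemma offer_combine:
  assumes x: "table_valid X t n d x" and gaps: "gaps u (u + d + 1) u\<^sub>1 v\<^sub>1 u\<^sub>2 v\<^sub>2"
    and S: "x (u\<^sub>1, v\<^sub>1) = Some S\<^sub>1" "x (u\<^sub>2, v\<^sub>2) = Some S\<^sub>2"
    and D: "D = gapped_interval u (u + d + 1) u\<^sub>1 v\<^sub>1 u\<^sub>2 v\<^sub>2" and m: "D \<noteq> {} \<Longrightarrow> m \<in> D"
    and w: "star_cost t (sources_at X D) q \<le> w" "w \<le> c * weber_cost t (sources_at X D)"
    and y: "y = offer x (u, u + d + 1) (combine u (u + d + 1) u\<^sub>1 v\<^sub>1 u\<^sub>2 v\<^sub>2 S\<^sub>1 S\<^sub>2 m q w)"
  shows "table_valid X t n d y" "improves d x y" "table_bounded c t X n u (u + d + 1) u\<^sub>1 v\<^sub>1 u\<^sub>2 v\<^sub>2 y"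
proof -
  let ?v = "u + d + 1"
  let ?S = "combine u ?v u\<^sub>1 v\<^sub>1 u\<^sub>2 v\<^sub>2 S\<^sub>1 S\<^sub>2 m q w"
  have "valid X t u ?v ?S" using valid_combine gaps table_validD(1)[OF x] S D m w(1) by blast
  moreover have y_cases: "y = x \<or> y = x((u, ?v) \<mapsto> ?S)" unfolding y offer_def by simp
  ultimately show "table_valid X t n d y" using x unfolding table_valid_def by (auto split: if_splits)
  show improves: "improves d x y"
    unfolding improves_def y offer_def by (auto split: if_splits)
  have best: "y (u, ?v) \<noteq> None \<and> table_val y u ?v \<le> val ?S"
    unfolding y offer_def table_val_def by auto
  have "(u\<^sub>1, v\<^sub>1) \<noteq> (u, ?v)" "(u\<^sub>2, v\<^sub>2) \<noteq> (u, ?v)" using gaps by (auto simp: gaps_def)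
  then have "table_val y u\<^sub>1 v\<^sub>1 = val S\<^sub>1" "table_val y u\<^sub>2 v\<^sub>2 = val S\<^sub>2"
    using S y_cases by (auto simp: table_val_def)
  then show "table_bounded c t X n u ?v u\<^sub>1 v\<^sub>1 u\<^sub>2 v\<^sub>2 y"
    unfolding table_bounded_def D[symmetric] using best w(2) by simp
qed

definition table_complete :: "real \<Rightarrow> point \<Rightarrow> (nat \<Rightarrow> point) \<Rightarrow> nat \<Rightarrow> nat \<Rightarrow> table \<Rightarrow> bool" where
  "table_complete c t X n d x \<longleftrightarrow> table_valid X t n d x \<and> (\<forall>u\<le>2 * n. table_val x u u = 0) \<and>
     (\<forall>d'<d. \<forall>u u\<^sub>1 v\<^sub>1 u\<^sub>2 v\<^sub>2. table_bounded c t X n u (u + d' + 1) u\<^sub>1 v\<^sub>1 u\<^sub>2 v\<^sub>2 x)"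

lemma table_complete_Suc:
  assumes x: "table_complete c t X n d x" and y: "table_valid X t n d y" "improves d x y"
    and bounded: "\<And>u u\<^sub>1 v\<^sub>1 u\<^sub>2 v\<^sub>2. table_bounded c t X n u (u + d + 1) u\<^sub>1 v\<^sub>1 u\<^sub>2 v\<^sub>2 y"
  shows "table_complete c t X n (Suc d) y"
proof -
  have "y (u, v) \<noteq> None" if "u \<le> v" "v \<le> 2 * n" "v - u \<le> Suc d" for u v
  proof (cases "v - u \<le> d")
    case True
    then show ?thesis using table_validD(2)[OF y(1)] that by blast
  next
    case False
    then have "v = u + d + 1" using that by simp
    then show ?thesis using bounded[of u u u u u] that by (simp add: table_bounded_def gaps_def)
  qed
  then have "table_valid X t n (Suc d) y" using y(1) unfolding table_valid_def by blast
  moreover have "table_val y u u = 0" if "u \<le> 2 * n" for u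
    using x that improves_other[OF y(2), of u u] by (simp add: table_complete_def table_val_def)
  moreover have "table_bounded c t X n u (u + d' + 1) u\<^sub>1 v\<^sub>1 u\<^sub>2 v\<^sub>2 y" if "d' < Suc d" for d' u u\<^sub>1 v\<^sub>1 u\<^sub>2 v\<^sub>2
  proof (cases "d' = d")
    case False
    then have "table_bounded c t X n u (u + d' + 1) u\<^sub>1 v\<^sub>1 u\<^sub>2 v\<^sub>2 x"
      using x that by (simp add: table_complete_def)
    then show ?thesis by (rule table_bounded_improves) (use y that in auto)
  qed (use bounded in blast)
  ultimately show ?thesis unfolding table_complete_def by blast
qed

lemma table_complete_recurrence:
  assumes "table_complete c t X n n x"
  shows "interval_recurrence c t X n (table_val x)"
  unfolding interval_recurrence_def
proof (intro conjI allI impI)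
  fix u v u\<^sub>1 v\<^sub>1 u\<^sub>2 v\<^sub>2
  assume v: "v \<le> u + n" "v \<le> 2 * n" and gaps: "gaps u v u\<^sub>1 v\<^sub>1 u\<^sub>2 v\<^sub>2"
  define d where "d = v - u - 1"
  have d: "d < n" "v = u + d + 1" using v gaps by (auto simp: d_def gaps_def)
  have "table_bounded c t X n u v u\<^sub>1 v\<^sub>1 u\<^sub>2 v\<^sub>2 x" using assms d unfolding table_complete_def by blast
  then show "table_val x u v \<le> table_val x u\<^sub>1 v\<^sub>1 + table_val x u\<^sub>2 v\<^sub>2 +
      c * weber_cost t (sources_at X (gapped_interval u v u\<^sub>1 v\<^sub>1 u\<^sub>2 v\<^sub>2))"
    using v gaps by (simp add: table_bounded_def)
qed (use assms in \<open>simp add: table_complete_def\<close>)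

section \<open>Filling the table\<close>

lemma mult_add_eq_iff:
  fixes u v M :: nat
  assumes "v < M" "v' < M"
  shows "u * M + v = u' * M + v' \<longleftrightarrow> u = u' \<and> v = v'"
proof
  assume eq: "u * M + v = u' * M + v'"
  have "(u * M + v) div M = u" "(u' * M + v') div M = u'" using assms by auto
  then have "u = u'" using eq by metis
  then show "u = u' \<and> v = v'" using eq by simp
qed simp

definition ix2 :: "nat \<Rightarrow> nat \<Rightarrow> nat \<Rightarrow> nat" where
  "ix2 n u v = u * (2 * n + 1) + v"

definition ix3 :: "nat \<Rightarrow> nat \<Rightarrow> nat \<Rightarrow> nat \<Rightarrow> nat" where
  "ix3 n u v p = ix2 n u v * (2 * n + 1) + p"

lemma ix2_eq_iff: "v \<le> 2 * n \<Longrightarrow> v' \<le> 2 * n \<Longrightarrow> ix2 n u v = ix2 n u' v' \<longleftrightarrow> u = u' \<and> v = v'"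
  unfolding ix2_def by (rule mult_add_eq_iff) simp_all

lemma ix3_eq_iff:
  assumes "v \<le> 2 * n" "v' \<le> 2 * n" "p \<le> 2 * n" "p' \<le> 2 * n"
  shows "ix3 n u v p = ix3 n u' v' p' \<longleftrightarrow> u = u' \<and> v = v' \<and> p = p'"
  using assms mult_add_eq_iff[of p "2 * n + 1" p'] ix2_eq_iff[of v n v'] by (auto simp: ix3_def)

lemma ix2_less:
  assumes "u \<le> 2 * n" "v \<le> 2 * n"
  shows "ix2 n u v < (2 * n + 1) * (2 * n + 1)"
proof -
  have "u * (2 * n + 1) \<le> 2 * n * (2 * n + 1)" using assms(1) by (rule mult_le_mono1)
  then show ?thesis using assms(2) by (simp add: ix2_def)
qed

lemma sorted_list_of_set_Int_lessThan_Suc: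
  "sorted_list_of_set (D \<inter> {..<Suc i}) =
     (if i \<in> D then sorted_list_of_set (D \<inter> {..<i}) @ [i] else sorted_list_of_set (D \<inter> {..<i}))"
proof (cases "i \<in> D")
  case True
  then have "D \<inter> {..<Suc i} = insert i (D \<inter> {..<i})" by auto
  then show ?thesis using True by (simp add: sorted_insort_is_snoc)
next
  case False
  then have "D \<inter> {..<Suc i} = D \<inter> {..<i}" by (auto simp: less_Suc_eq)
  then show ?thesis using False by simp
qed

locale weber_machine =
  fixes W :: com and T :: "nat \<Rightarrow> real \<Rightarrow> real" and K :: nat
  assumes W: "weber_program W T" and K: "\<And>a. a \<in> nmods W \<union> rmods W \<Longrightarrow> a < K"
begin

lemma fresh [simp]: "K + a \<notin> nmods W" "K + a \<notin> rmods W"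
  using K[of "K + a"] by auto

text \<open>
  \<open>W\<close> does not write to the arrays from \<open>K\<close> on. The prefix of a name tells natural scalars (\<open>v\<close>, stored
  in cell 0), natural arrays (\<open>a\<close>) and real arrays (\<open>r\<close>), as well as expressions (\<open>e\<close>) and tests (\<open>b\<close>).
\<close>

abbreviation "vN \<equiv> K + 5"
abbreviation "vI \<equiv> K + 6"
abbreviation "vJ \<equiv> K + 7"
abbreviation "vK \<equiv> K + 8"
abbreviation "vRank \<equiv> K + 9"
abbreviation "vLen \<equiv> K + 10"
abbreviation "vU \<equiv> K + 11"
abbreviation "vU1 \<equiv> K + 12"
abbreviation "vV1 \<equiv> K + 13"
abbreviation "vU2 \<equiv> K + 14"
abbreviation "vV2 \<equiv> K + 15"
abbreviation "vP \<equiv> K + 16"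
abbreviation "vSize \<equiv> K + 17"
abbreviation "vLeader \<equiv> K + 18"
abbreviation "vStart \<equiv> K + 19"
abbreviation "aLower \<equiv> K + 20"
abbreviation "aPerm \<equiv> K + 21"
abbreviation "aFilled \<equiv> K + 22"
abbreviation "aLabel \<equiv> K + 23"
abbreviation "aIndex \<equiv> K + 24"
abbreviation "rParam \<equiv> K + 5"
abbreviation "rX \<equiv> K + 6"
abbreviation "rY \<equiv> K + 7"
abbreviation "rValue \<equiv> K + 8"
abbreviation "rSiteX \<equiv> K + 9"
abbreviation "rSiteY \<equiv> K + 10"
abbreviation "rCand \<equiv> K + 11"

abbreviation "eM \<equiv> NAdd (NMul (NConst 2) (NVar vN)) (NConst 1)"
abbreviation "eIx2 e f \<equiv> NAdd (NMul e eM) f"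
abbreviation "eIx3 e f g \<equiv> NAdd (NMul (eIx2 e f) eM) g"
abbreviation "eV \<equiv> NAdd (NAdd (NVar vU) (NVar vLen)) (NConst 1)"
abbreviation "bPositionIn e f \<equiv> BAnd (NLe e (NVar vP)) (NLess (NVar vP) f)"
abbreviation "bGap1 \<equiv> bPositionIn (NVar vU1) (NVar vV1)"
abbreviation "bGap2 \<equiv> bPositionIn (NVar vU2) (NVar vV2)"

definition collect_step :: com where
  "collect_step =
     If (BAnd (bPositionIn (NVar vU) eV) (BAnd (BNot bGap1) (BNot bGap2)))
       (RAssign 1 (NVar vSize) (RCell rX (NCell aPerm (NVar vP))) ;;
        RAssign 2 (NVar vSize) (RCell rY (NCell aPerm (NVar vP))) ;;
        NInc vSize ;; NSet vLeader (NVar vP)) SKIP"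

definition collect :: com where
  "collect = NSet vSize (NConst 0) ;; For vP eM collect_step"

definition prepare_call :: com where
  "prepare_call = NSet 0 (NVar vSize) ;; RAssign 0 (NConst 0) (RCell rParam (NConst 0)) ;;
     RAssign 0 (NConst 1) (RCell rParam (NConst 1)) ;; RAssign 0 (NConst 2) (RCell rParam (NConst 2))"

definition add_values :: com where
  "add_values = RAssign rCand (NConst 0) (RAdd (RCell 3 (NConst 0))
     (RAdd (RCell rValue (eIx2 (NVar vU1) (NVar vV1))) (RCell rValue (eIx2 (NVar vU2) (NVar vV2)))))"

definition write_slot :: "nexp \<Rightarrow> rexp \<Rightarrow> rexp \<Rightarrow> com" where
  "write_slot l x y = NAssign aLabel (eIx3 (NVar vU) eV (NVar vP)) l ;;
     RAssign rSiteX (eIx3 (NVar vU) eV (NVar vP)) x ;; RAssign rSiteY (eIx3 (NVar vU) eV (NVar vP)) y"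

definition copy_slot :: "nexp \<Rightarrow> nexp \<Rightarrow> com" where
  "copy_slot e f = write_slot (NCell aLabel (eIx3 e f (NVar vP)))
     (RCell rSiteX (eIx3 e f (NVar vP))) (RCell rSiteY (eIx3 e f (NVar vP)))"

definition store_step :: com where
  "store_step = If bGap1 (copy_slot (NVar vU1) (NVar vV1)) (If bGap2 (copy_slot (NVar vU2) (NVar vV2))
     (write_slot (NVar vLeader) (RCell 3 (NConst 1)) (RCell 3 (NConst 2))))"

definition store :: com where
  "store = (NAssign aFilled (eIx2 (NVar vU) eV) (NConst 1) ;;
     RAssign rValue (eIx2 (NVar vU) eV) (RCell rCand (NConst 0))) ;; For vP eM store_step"

definition offer_candidate :: com where
  "offer_candidate = If (BAnd (NPos (NCell aFilled (eIx2 (NVar vU) eV)))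
       (BNot (RLess (RCell rCand (NConst 0)) (RCell rValue (eIx2 (NVar vU) eV))))) SKIP store"

definition candidate :: com where
  "candidate = collect ;; prepare_call ;; W ;; add_values ;; offer_candidate"

definition bGaps :: bexp where
  "bGaps = BAnd (BAnd (NLe (NVar vU) (NVar vU1)) (BAnd (NLe (NVar vU1) (NVar vV1))
       (BAnd (NLe (NVar vV1) (NVar vU2)) (BAnd (NLe (NVar vU2) (NVar vV2)) (NLe (NVar vV2) eV)))))
     (BAnd (BAnd (NLess (NSub (NVar vV1) (NVar vU1)) (NSub eV (NVar vU)))
         (NLess (NSub (NVar vV2) (NVar vU2)) (NSub eV (NVar vU))))
       (NLe eV (NMul (NConst 2) (NVar vN))))"

definition search_step :: com where
  "search_step = If bGaps candidate SKIP"

definition fill_table :: com where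
  "fill_table = For vLen (NVar vN) (Fors [vU, vU1, vV1, vU2, vV2] eM search_step)"

lemma mods_steps [simp]:
  "nmods collect_step = {vSize, vLeader}" "rmods collect_step = {1, 2}"
  "nmods store_step = {aLabel}" "rmods store_step = {rSiteX, rSiteY}"
  by (auto simp: collect_step_def store_step_def copy_slot_def write_slot_def)

lemma mods_search [simp]:
  "nmods collect = {vSize, vLeader, vP}" "rmods collect = {1, 2}"
  "nmods prepare_call = {0}" "rmods prepare_call = {0}"
  "nmods add_values = {}" "rmods add_values = {rCand}"
  "nmods store = {aFilled, aLabel, vP}" "rmods store = {rValue, rSiteX, rSiteY}"
  "nmods offer_candidate = {aFilled, aLabel, vP}" "rmods offer_candidate = {rValue, rSiteX, rSiteY}"
  by (auto simp: collect_def prepare_call_def add_values_def store_def offer_candidate_def)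

lemma mods_search_step [simp]:
  "nmods search_step = {vSize, vLeader, vP, 0, aFilled, aLabel} \<union> nmods W"
  "rmods search_step = {1, 2, 0, rCand, rValue, rSiteX, rSiteY} \<union> rmods W"
  by (auto simp: search_step_def candidate_def)

definition slot :: "state \<Rightarrow> nat \<Rightarrow> nat \<times> point" where
  "slot s k = (nmem s aLabel k, (rmem s rSiteX k, rmem s rSiteY k))"

definition entry :: "nat \<Rightarrow> state \<Rightarrow> nat \<Rightarrow> nat \<Rightarrow> solution" where
  "entry n s u v =
     \<lparr>label = (\<lambda>p. if p \<in> {u..<v} then fst (slot s (ix3 n u v p)) else 0),
      site = (\<lambda>p. if p \<in> {u..<v} then snd (slot s (ix3 n u v p)) else 0),
      val = rmem s rValue (ix2 n u v)\<rparr>"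

definition table :: "nat \<Rightarrow> state \<Rightarrow> table" where
  "table n s = (\<lambda>(u, v). if u \<le> v \<and> v \<le> 2 * n \<and>
      0 < nmem s aFilled (ix2 n u v) then Some (entry n s u v) else None)"

lemma entry_cong:
  "nmem s' aLabel = nmem s aLabel \<Longrightarrow> rmem s' rValue = rmem s rValue \<Longrightarrow> rmem s' rSiteX = rmem s rSiteX \<Longrightarrow>
    rmem s' rSiteY = rmem s rSiteY \<Longrightarrow> entry n s' = entry n s"
  by (simp add: entry_def slot_def fun_eq_iff)

lemma table_cong: "nmem s' aFilled = nmem s aFilled \<Longrightarrow> entry n s' = entry n s \<Longrightarrow> table n s' = table n s"
  by (simp add: table_def fun_eq_iff)

lemma table_frame:
  assumes "frame c s s'" "nmods c \<inter> {aFilled, aLabel} = {}" "rmods c \<inter> {rValue, rSiteX, rSiteY} = {}"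
  shows "entry n s' = entry n s" "table n s' = table n s"
proof -
  show "entry n s' = entry n s" using assms by (intro entry_cong) (simp_all add: frame_def)
  then show "table n s' = table n s" using assms by (intro table_cong) (simp_all add: frame_def)
qed

definition counters :: "nat \<Rightarrow> nat \<Rightarrow> nat \<Rightarrow> nat \<Rightarrow> nat \<Rightarrow> nat \<Rightarrow> nat \<Rightarrow> state \<Rightarrow> bool" where
  "counters n u v u\<^sub>1 v\<^sub>1 u\<^sub>2 v\<^sub>2 s \<longleftrightarrow> nmem s vN 0 = n \<and> nmem s vU 0 = u \<and> u + nmem s vLen 0 + 1 = v \<and>
     nmem s vU1 0 = u\<^sub>1 \<and> nmem s vV1 0 = v\<^sub>1 \<and> nmem s vU2 0 = u\<^sub>2 \<and> nmem s vV2 0 = v\<^sub>2"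

definition holds_positions :: "real \<Rightarrow> point \<Rightarrow> (nat \<Rightarrow> point) \<Rightarrow> nat \<Rightarrow> state \<Rightarrow> bool" where
  "holds_positions \<epsilon> t X n s \<longleftrightarrow>
     nmem s vN 0 = n \<and> rmem s rParam 0 = \<epsilon> \<and> (rmem s rParam 1, rmem s rParam 2) = t \<and>
     (\<forall>p<2 * n. (rmem s rX (nmem s aPerm p), rmem s rY (nmem s aPerm p)) = X p)"

lemma holds_positions_frame:
  assumes "holds_positions \<epsilon> t X n s" "frame c s s'" "nmods c \<inter> {vN, aPerm} = {}"
    "rmods c \<inter> {rParam, rX, rY} = {}"
  shows "holds_positions \<epsilon> t X n s'"
  using assms by (simp add: holds_positions_def frame_def)

definition holds_points :: "point list \<Rightarrow> state \<Rightarrow> bool" where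
  "holds_points A s \<longleftrightarrow> nmem s vSize 0 = length A \<and> (\<forall>i<length A. (rmem s 1 i, rmem s 2 i) = A ! i)"

lemma runs_collect:
  assumes X: "holds_positions \<epsilon> t X n s" and counters: "counters n u v u\<^sub>1 v\<^sub>1 u\<^sub>2 v\<^sub>2 s" and v: "v \<le> 2 * n"
    and D: "D = gapped_interval u v u\<^sub>1 v\<^sub>1 u\<^sub>2 v\<^sub>2"
  shows "runs collect (14 * real n + 10)
    (\<lambda>s'. holds_points (sources_at X D) s' \<and> (D \<noteq> {} \<longrightarrow> nmem s' vLeader 0 \<in> D)) s"
  unfolding collect_def
proof (rule runs_straight_Seq)
  let ?loop = "For vP eM collect_step" and ?s\<^sub>0 = "nupd vSize 0 0 s"
  define J where "J i s' \<longleftrightarrow> holds_points (sources_at X (D \<inter> {..<i})) s' \<and>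
    (D \<inter> {..<i} \<noteq> {} \<longrightarrow> nmem s' vLeader 0 \<in> D)" for i and s' :: state
  have "runs ?loop (14 * real n + 9) (\<lambda>s'. holds_points (sources_at X D) s' \<and>
      (D \<noteq> {} \<longrightarrow> nmem s' vLeader 0 \<in> D)) ?s\<^sub>0"
  proof (rule runs_For[where J = J and n = "2 * n + 1" and B = 5])
    fix i s' assume frame: "frame ?loop ?s\<^sub>0 s'" and i: "nmem s' vP 0 = i" and J: "J i s'"
    have X': "holds_positions \<epsilon> t X n s'" and counters': "counters n u v u\<^sub>1 v\<^sub>1 u\<^sub>2 v\<^sub>2 s'"
      using X counters frame by (simp_all add: frame_def holds_positions_def counters_def)
    have test: "bval (BAnd (bPositionIn (NVar vU) eV) (BAnd (BNot bGap1) (BNot bGap2))) s' \<longleftrightarrow> i \<in> D"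
      using counters' i by (auto simp: counters_def D gapped_interval_def)
    have "(rmem s' rX (nmem s' aPerm i), rmem s' rY (nmem s' aPerm i)) = X i" if "i \<in> D"
      using that X' v by (simp add: holds_positions_def D gapped_interval_def)
    then have "J (Suc i) (nupd vP 0 (Suc i) (result collect_step s'))"
      using J i unfolding collect_step_def result.simps test J_def sources_at_def
        sorted_list_of_set_Int_lessThan_Suc
      by (auto simp: holds_points_def nth_append less_Suc_eq)
    then show "runs collect_step 5 (\<lambda>s''. J (Suc i) (nupd vP 0 (Suc i) s'')) s'"
      by (rule runs_straight[rotated 2]) (simp_all add: collect_step_def)
  next
    have "D \<inter> {..<2 * n + 1} = D" using v by (auto simp: D gapped_interval_def)
    then show "holds_points (sources_at X D) s' \<and> (D \<noteq> {} \<longrightarrow> nmem s' vLeader 0 \<in> D)" if "J (2 * n + 1) s'" for s'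
      using that by (simp add: J_def)
  qed (use counters in \<open>auto simp: J_def holds_points_def sources_at_def frame_def counters_def loop_time_def\<close>)
  then show "runs ?loop (14 * real n + 9) (\<lambda>s'. holds_points (sources_at X D) s' \<and>
      (D \<noteq> {} \<longrightarrow> nmem s' vLeader 0 \<in> D))
    (result (NSet vSize (NConst 0)) s)" by simp
qed simp_all

lemma runs_weber:
  assumes "\<epsilon> > 0" and X: "holds_positions \<epsilon> t X n s" and A: "holds_points A s" "length A \<le> n"
    and continue: "\<And>s'. frame (prepare_call ;; W) s s' \<Longrightarrow> star_cost t A (rmem s' 3 1, rmem s' 3 2) \<le> rmem s' 3 0 \<Longrightarrow>
      rmem s' 3 0 \<le> (1 + \<epsilon>) * weber_cost t A \<Longrightarrow> runs d B Q s'"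
  shows "runs (prepare_call ;; W ;; d) (T n \<epsilon> + B + 4) Q s"
proof (rule runs_straight_Seq)
  let ?s\<^sub>0 = "result prepare_call s"
  have "rmem s 1 i = fst (A ! i) \<and> rmem s 2 i = snd (A ! i)" if "i < length A" for i
    using A(1) that unfolding holds_points_def by (metis fst_conv snd_conv)
  then have "holds_input \<epsilon> t A ?s\<^sub>0"
    using X A(1) by (auto simp: holds_input_def holds_positions_def holds_points_def prepare_call_def)
  then have "runs W (T n \<epsilon>) (\<lambda>s'. star_cost t A (rmem s' 3 1, rmem s' 3 2) \<le> rmem s' 3 0 \<and>
      rmem s' 3 0 \<le> (1 + \<epsilon>) * weber_cost t A) ?s\<^sub>0"
    using W A(2) \<open>\<epsilon> > 0\<close> unfolding weber_program_def runs_def Let_def by blast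
  then show "runs (W ;; d) (T n \<epsilon> + B) Q ?s\<^sub>0"
  proof (rule runs_Seq)
    fix s' assume "frame W ?s\<^sub>0 s'" and w: "star_cost t A (rmem s' 3 1, rmem s' 3 2) \<le> rmem s' 3 0 \<and>
      rmem s' 3 0 \<le> (1 + \<epsilon>) * weber_cost t A"
    then have "frame (prepare_call ;; W) s s'" by (auto simp: frame_def prepare_call_def)
    then show "runs d B Q s'" using continue w by blast
  qed simp
qed (simp_all add: prepare_call_def)

lemma slot_written: "slot (rupd rSiteY k z (rupd rSiteX k y (nupd aLabel k l s))) = (slot s)(k := (l, (y, z)))"
  by (simp add: slot_def fun_eq_iff)

definition merged_slot :: "nat \<Rightarrow> nat \<Rightarrow> nat \<Rightarrow> nat \<Rightarrow> nat \<Rightarrow> state \<Rightarrow> nat \<Rightarrow> nat \<times> point" where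
  "merged_slot n u\<^sub>1 v\<^sub>1 u\<^sub>2 v\<^sub>2 s p =
     (if p \<in> {u\<^sub>1..<v\<^sub>1} then slot s (ix3 n u\<^sub>1 v\<^sub>1 p) else if p \<in> {u\<^sub>2..<v\<^sub>2} then slot s (ix3 n u\<^sub>2 v\<^sub>2 p)
      else (nmem s vLeader 0, (rmem s 3 1, rmem s 3 2)))"

lemma slot_store_step:
  assumes "counters n u v u\<^sub>1 v\<^sub>1 u\<^sub>2 v\<^sub>2 s" "nmem s vP 0 = p"
  shows "slot (result store_step s) = (slot s)(ix3 n u v p := merged_slot n u\<^sub>1 v\<^sub>1 u\<^sub>2 v\<^sub>2 s p)"
  using assms unfolding store_step_def copy_slot_def write_slot_def counters_def merged_slot_def
  by (auto simp: slot_written ix3_def ix2_def) (simp_all add: slot_def)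

lemma runs_store_loop:
  assumes counters: "counters n u v u\<^sub>1 v\<^sub>1 u\<^sub>2 v\<^sub>2 s" and v: "v \<le> 2 * n" and gaps: "gaps u v u\<^sub>1 v\<^sub>1 u\<^sub>2 v\<^sub>2"
  shows "runs (For vP eM store_step) (14 * real n + 9) (\<lambda>s'. \<forall>x y p. y \<le> 2 * n \<longrightarrow> p < y \<longrightarrow>
    slot s' (ix3 n x y p) = (if x = u \<and> y = v then merged_slot n u\<^sub>1 v\<^sub>1 u\<^sub>2 v\<^sub>2 s p else slot s (ix3 n x y p))) s"
proof -
  let ?loop = "For vP eM store_step" and ?new = "merged_slot n u\<^sub>1 v\<^sub>1 u\<^sub>2 v\<^sub>2"
  define J where "J i s' \<longleftrightarrow> (\<forall>x y p. y \<le> 2 * n \<longrightarrow> p \<le> 2 * n \<longrightarrow>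
    slot s' (ix3 n x y p) = (if x = u \<and> y = v \<and> p < i then ?new s p
      else slot s (ix3 n x y p)))" for i and s' :: state
  have bounds: "v\<^sub>1 \<le> 2 * n" "v\<^sub>2 \<le> 2 * n" and distinct: "(u\<^sub>1, v\<^sub>1) \<noteq> (u, v)" "(u\<^sub>2, v\<^sub>2) \<noteq> (u, v)"
    using gaps v by (auto simp: gaps_def)
  show ?thesis
  proof (rule runs_For[where J = J and n = "2 * n + 1" and B = 5])
    fix i s' assume i: "i < 2 * n + 1" "nmem s' vP 0 = i" and frame: "frame ?loop s s'" and J: "J i s'"
    have "slot s' (ix3 n u\<^sub>1 v\<^sub>1 i) = slot s (ix3 n u\<^sub>1 v\<^sub>1 i)" "slot s' (ix3 n u\<^sub>2 v\<^sub>2 i) = slot s (ix3 n u\<^sub>2 v\<^sub>2 i)"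
      using J i(1) bounds distinct unfolding J_def by auto
    moreover have "nmem s' vLeader 0 = nmem s vLeader 0" "rmem s' 3 = rmem s 3"
      using frame by (simp_all add: frame_def)
    ultimately have "?new s' i = ?new s i" by (simp add: merged_slot_def)
    moreover have "counters n u v u\<^sub>1 v\<^sub>1 u\<^sub>2 v\<^sub>2 s'" using counters frame by (simp add: frame_def counters_def)
    ultimately have "slot (result store_step s') = (slot s')(ix3 n u v i := ?new s i)"
      using slot_store_step i(2) by simp
    then have "J (Suc i) (result store_step s')"
      using J i(1) v unfolding J_def by (auto simp: ix3_eq_iff less_Suc_eq)
    then show "runs store_step 5 (\<lambda>s''. J (Suc i) (nupd vP 0 (Suc i) s'')) s'"
      by (intro runs_straight) (simp_all add: J_def slot_def store_step_def copy_slot_def write_slot_def)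
  qed (use counters in \<open>auto simp: J_def slot_def frame_def counters_def loop_time_def\<close>)
qed

lemma table_update:
  assumes v: "u \<le> v" "v \<le> 2 * n" and filled: "nmem s' aFilled = (nmem s aFilled)(ix2 n u v := 1)"
    and val: "rmem s' rValue = (rmem s rValue)(ix2 n u v := val S)"
    and new: "\<And>p. p \<in> {u..<v} \<Longrightarrow> slot s' (ix3 n u v p) = (label S p, site S p)"
    and old: "\<And>x y p. y \<le> 2 * n \<Longrightarrow> p < y \<Longrightarrow> (x, y) \<noteq> (u, v) \<Longrightarrow> slot s' (ix3 n x y p) = slot s (ix3 n x y p)"
    and default: "\<And>p. p \<notin> {u..<v} \<Longrightarrow> label S p = 0 \<and> site S p = 0"
  shows "table n s' = (table n s)((u, v) \<mapsto> S)"
proof -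
  have other: "entry n s' x y = entry n s x y" if "y \<le> 2 * n" "(x, y) \<noteq> (u, v)" for x y
    using old[OF that(1) _ that(2)] that v val by (auto simp: entry_def fun_eq_iff ix2_eq_iff)
  have "entry n s' u v = S"
    using val default by (intro solution.equality) (auto simp: entry_def fun_eq_iff new)
  then show ?thesis
    using filled other v by (auto simp: table_def fun_eq_iff ix2_eq_iff)
qed

lemma runs_store:
  assumes counters: "counters n u v u\<^sub>1 v\<^sub>1 u\<^sub>2 v\<^sub>2 s" and v: "v \<le> 2 * n" and gaps: "gaps u v u\<^sub>1 v\<^sub>1 u\<^sub>2 v\<^sub>2"
    and cand: "rmem s rCand 0 = w + (rmem s rValue (ix2 n u\<^sub>1 v\<^sub>1) + rmem s rValue (ix2 n u\<^sub>2 v\<^sub>2))"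
  shows "runs store (14 * real n + 11) (\<lambda>s'. table n s' = (table n s)((u, v) \<mapsto>
    combine u v u\<^sub>1 v\<^sub>1 u\<^sub>2 v\<^sub>2 (entry n s u\<^sub>1 v\<^sub>1) (entry n s u\<^sub>2 v\<^sub>2) (nmem s vLeader 0)
      (rmem s 3 1, rmem s 3 2) w)) s"
    (is "runs _ _ (\<lambda>s'. _ = _((u, v) \<mapsto> ?S)) _")
  unfolding store_def
proof (rule runs_straight_Seq)
  let ?s\<^sub>0 = "rupd rValue (ix2 n u v) (rmem s rCand 0) (nupd aFilled (ix2 n u v) 1 s)"
  have result: "result (NAssign aFilled (eIx2 (NVar vU) eV) (NConst 1) ;;
      RAssign rValue (eIx2 (NVar vU) eV) (RCell rCand (NConst 0))) s = ?s\<^sub>0"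
    using counters by (simp add: counters_def ix2_def)
  have slot: "slot ?s\<^sub>0 = slot s" by (simp add: slot_def fun_eq_iff)
  then have merged: "merged_slot n u\<^sub>1 v\<^sub>1 u\<^sub>2 v\<^sub>2 ?s\<^sub>0 = merged_slot n u\<^sub>1 v\<^sub>1 u\<^sub>2 v\<^sub>2 s"
    by (simp add: merged_slot_def fun_eq_iff)
  have "counters n u v u\<^sub>1 v\<^sub>1 u\<^sub>2 v\<^sub>2 ?s\<^sub>0" using counters by (simp add: counters_def)
  from runs_store_loop[OF this v gaps]
  have "runs (For vP eM store_step) (14 * real n + 9) (\<lambda>s'. table n s' = (table n s)((u, v) \<mapsto> ?S)) ?s\<^sub>0"
    unfolding slot merged
  proof (rule runs_mono)
    fix s' assume frame: "frame (For vP eM store_step) ?s\<^sub>0 s'" and slots: "\<forall>x y p. y \<le> 2 * n \<longrightarrow> p < y \<longrightarrow>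
      slot s' (ix3 n x y p) = (if x = u \<and> y = v then merged_slot n u\<^sub>1 v\<^sub>1 u\<^sub>2 v\<^sub>2 s p else slot s (ix3 n x y p))"
    show "table n s' = (table n s)((u, v) \<mapsto> ?S)"
    proof (rule table_update)
      show "slot s' (ix3 n u v p) = (label ?S p, site ?S p)" if "p \<in> {u..<v}" for p
        using slots v that by (auto simp: merged_slot_def combine_def entry_def)
    qed (use frame slots v gaps cand in \<open>auto simp: frame_def entry_def combine_def gaps_def\<close>)
  qed simp
  then show "runs (For vP eM store_step) (14 * real n + 9) (\<lambda>s'. table n s' = (table n s)((u, v) \<mapsto> ?S))
      (result (NAssign aFilled (eIx2 (NVar vU) eV) (NConst 1) ;;
        RAssign rValue (eIx2 (NVar vU) eV) (RCell rCand (NConst 0))) s)"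
    unfolding result .
qed simp_all

lemma runs_offer_candidate:
  assumes counters: "counters n u v u\<^sub>1 v\<^sub>1 u\<^sub>2 v\<^sub>2 s" and v: "v \<le> 2 * n" and gaps: "gaps u v u\<^sub>1 v\<^sub>1 u\<^sub>2 v\<^sub>2"
    and cand: "rmem s rCand 0 = w + (rmem s rValue (ix2 n u\<^sub>1 v\<^sub>1) + rmem s rValue (ix2 n u\<^sub>2 v\<^sub>2))"
  shows "runs offer_candidate (14 * real n + 12) (\<lambda>s'. table n s' = offer (table n s) (u, v)
    (combine u v u\<^sub>1 v\<^sub>1 u\<^sub>2 v\<^sub>2 (entry n s u\<^sub>1 v\<^sub>1) (entry n s u\<^sub>2 v\<^sub>2) (nmem s vLeader 0)
      (rmem s 3 1, rmem s 3 2) w)) s"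
    (is "runs _ _ (\<lambda>s'. _ = offer _ _ ?S) _")
  unfolding offer_candidate_def
proof (rule runs_If)
  let ?keep = "BAnd (NPos (NCell aFilled (eIx2 (NVar vU) eV)))
       (BNot (RLess (RCell rCand (NConst 0)) (RCell rValue (eIx2 (NVar vU) eV))))"
  have "val ?S = rmem s rCand 0" using cand by (simp add: entry_def)
  then have test: "bval ?keep s \<longleftrightarrow> (\<exists>S'. table n s (u, v) = Some S' \<and> val S' \<le> val ?S)"
    using counters v by (auto simp: counters_def table_def entry_def ix2_def)
  show "runs SKIP (14 * real n + 11) (\<lambda>s'. table n s' = offer (table n s) (u, v) ?S) s" if "bval ?keep s"
    using that unfolding test offer_def by (intro runs_straight) simp_all
  show "runs store (14 * real n + 11) (\<lambda>s'. table n s' = offer (table n s) (u, v) ?S) s" if "\<not> bval ?keep s"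
    unfolding offer_def if_not_P[OF that[unfolded test]] by (rule runs_store[OF counters v gaps cand])
qed simp

lemma runs_candidate:
  assumes "\<epsilon> > 0" and X: "holds_positions \<epsilon> t X n s" and counters: "counters n u v u\<^sub>1 v\<^sub>1 u\<^sub>2 v\<^sub>2 s"
    and v: "v \<le> 2 * n" "v \<le> u + n" and gaps: "gaps u v u\<^sub>1 v\<^sub>1 u\<^sub>2 v\<^sub>2"
    and D: "D = gapped_interval u v u\<^sub>1 v\<^sub>1 u\<^sub>2 v\<^sub>2"
  shows "runs candidate (28 * real n + T n \<epsilon> + 27) (\<lambda>s'. \<exists>m q w. (D \<noteq> {} \<longrightarrow> m \<in> D) \<and>
    star_cost t (sources_at X D) q \<le> w \<and> w \<le> (1 + \<epsilon>) * weber_cost t (sources_at X D) \<and>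
    table n s' = offer (table n s) (u, v) (combine u v u\<^sub>1 v\<^sub>1 u\<^sub>2 v\<^sub>2 (entry n s u\<^sub>1 v\<^sub>1) (entry n s u\<^sub>2 v\<^sub>2)
      m q w)) s"
    (is "runs _ _ ?Q _")
  unfolding candidate_def
proof (rule runs_Seq[OF runs_collect[OF X counters v(1) D]])
  fix s' assume frame: "frame collect s s'" and A: "holds_points (sources_at X D) s' \<and>
      (D \<noteq> {} \<longrightarrow> nmem s' vLeader 0 \<in> D)"
  have "card D \<le> card {u..<v}" by (rule card_mono) (auto simp: D gapped_interval_def)
  then have size: "length (sources_at X D) \<le> n" using v(2) by (simp add: sources_at_def)
  have X': "holds_positions \<epsilon> t X n s'" by (rule holds_positions_frame[OF X frame]) simp_all
  show "runs (prepare_call ;; W ;; add_values ;; offer_candidate) (T n \<epsilon> + (14 * real n + 13) + 4) ?Q s'"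
  proof (rule runs_weber[OF \<open>\<epsilon> > 0\<close> X' conjunct1[OF A] size], rule runs_straight_Seq)
    fix s'' assume frame': "frame (prepare_call ;; W) s' s''"
      and w: "star_cost t (sources_at X D) (rmem s'' 3 1, rmem s'' 3 2) \<le> rmem s'' 3 0"
        "rmem s'' 3 0 \<le> (1 + \<epsilon>) * weber_cost t (sources_at X D)"
    let ?r = "result add_values s''"
    have unchanged: "nmem ?r aFilled = nmem s aFilled" "nmem ?r aLabel = nmem s aLabel"
      "rmem ?r rValue = rmem s rValue"
      "rmem ?r rSiteX = rmem s rSiteX" "rmem ?r rSiteY = rmem s rSiteY" "nmem ?r vLeader = nmem s' vLeader"
      "rmem ?r 3 1 = rmem s'' 3 1" "rmem ?r 3 2 = rmem s'' 3 2"
      using frame frame' by (simp_all add: add_values_def frame_def)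
    have counters': "counters n u v u\<^sub>1 v\<^sub>1 u\<^sub>2 v\<^sub>2 s''" using counters frame frame' by (simp add: counters_def frame_def)
    then have counters'': "counters n u v u\<^sub>1 v\<^sub>1 u\<^sub>2 v\<^sub>2 ?r" by (simp add: counters_def add_values_def)
    have same: "entry n ?r = entry n s" "table n ?r = table n s"
      using unchanged entry_cong[of ?r s n] table_cong[of ?r s n] by blast+
    have "rmem ?r rCand 0 = rmem s'' 3 0 + (rmem ?r rValue (ix2 n u\<^sub>1 v\<^sub>1) + rmem ?r rValue (ix2 n u\<^sub>2 v\<^sub>2))"
      using counters' by (simp add: add_values_def counters_def ix2_def)
    note runs_offer_candidate[OF counters'' v(1) gaps this, unfolded same unchanged(6-8)]
    then show "runs offer_candidate (14 * real n + 12) ?Q ?r"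
      by (rule runs_mono) (use A w in auto)
  qed (simp_all add: add_values_def)
qed simp

lemma runs_search_step:
  assumes "\<epsilon> > 0" and X: "holds_positions \<epsilon> t X n s" and counters: "counters n u (u + d + 1) u\<^sub>1 v\<^sub>1 u\<^sub>2 v\<^sub>2 s"
    and "d < n" and valid: "table_valid X t n d (table n s)"
  shows "runs search_step (28 * real n + T n \<epsilon> + 28) (\<lambda>s'. table_valid X t n d (table n s') \<and>
    improves d (table n s) (table n s') \<and> table_bounded (1 + \<epsilon>) t X n u (u + d + 1) u\<^sub>1 v\<^sub>1 u\<^sub>2 v\<^sub>2 (table n s')) s"
    (is "runs _ _ ?Q _")
  unfolding search_step_def
proof (rule runs_If)
  let ?v = "u + d + 1"
  have test: "bval bGaps s \<longleftrightarrow> gaps u ?v u\<^sub>1 v\<^sub>1 u\<^sub>2 v\<^sub>2 \<and> ?v \<le> 2 * n"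
    using counters by (auto simp: bGaps_def counters_def gaps_def)
  show "runs candidate (28 * real n + T n \<epsilon> + 27) ?Q s" if "bval bGaps s"
  proof -
    have gaps: "gaps u ?v u\<^sub>1 v\<^sub>1 u\<^sub>2 v\<^sub>2" and v: "?v \<le> 2 * n" "?v \<le> u + n" using that test \<open>d < n\<close> by auto
    have "table n s (x, y) = Some (entry n s x y)" if "x \<le> y" "y \<le> 2 * n" "y - x \<le> d" for x y
      using table_validD(2)[OF valid that] by (auto simp: table_def split: if_splits)
    then have S: "table n s (u\<^sub>1, v\<^sub>1) = Some (entry n s u\<^sub>1 v\<^sub>1)" "table n s (u\<^sub>2, v\<^sub>2) = Some (entry n s u\<^sub>2 v\<^sub>2)"
      using gaps v(1) by (auto simp: gaps_def)
    show ?thesis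
    proof (rule runs_mono[OF runs_candidate[OF \<open>\<epsilon> > 0\<close> X counters v gaps refl] order_refl], elim exE conjE)
      fix s' m q w
      let ?D = "gapped_interval u ?v u\<^sub>1 v\<^sub>1 u\<^sub>2 v\<^sub>2"
      assume "?D \<noteq> {} \<longrightarrow> m \<in> ?D" "star_cost t (sources_at X ?D) q \<le> w"
        "w \<le> (1 + \<epsilon>) * weber_cost t (sources_at X ?D)"
        "table n s' = offer (table n s) (u, ?v)
            (combine u ?v u\<^sub>1 v\<^sub>1 u\<^sub>2 v\<^sub>2 (entry n s u\<^sub>1 v\<^sub>1) (entry n s u\<^sub>2 v\<^sub>2) m q w)"
      note offer_combine[OF valid gaps S refl mp[OF this(1)] this(2-4)]
      then show "?Q s'" by blast
    qed
  qed
  show "runs SKIP (28 * real n + T n \<epsilon> + 27) ?Q s" if "\<not> bval bGaps s"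
  proof (rule runs_straight)
    show "?Q (result SKIP s)"
      using that valid improves_refl unfolding test by (auto simp: table_bounded_def)
    show "steps SKIP \<le> 28 * real n + T n \<epsilon> + 27"
      using weber_program_linear_time(2)[OF W \<open>\<epsilon> > 0\<close>, of n] by simp
  qed simp
qed simp

definition bounded_at :: "real \<Rightarrow> point \<Rightarrow> (nat \<Rightarrow> point) \<Rightarrow> nat \<Rightarrow> nat \<Rightarrow> nat list \<Rightarrow> table \<Rightarrow> bool" where
  "bounded_at c t X n d is x \<longleftrightarrow> (\<forall>u u\<^sub>1 v\<^sub>1 u\<^sub>2 v\<^sub>2. is = [u, u\<^sub>1, v\<^sub>1, u\<^sub>2, v\<^sub>2] \<longrightarrow>
     table_bounded c t X n u (u + d + 1) u\<^sub>1 v\<^sub>1 u\<^sub>2 v\<^sub>2 x)"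

lemma runs_search:
  assumes "\<epsilon> > 0" and X: "holds_positions \<epsilon> t X n s" and d: "d < n" "nmem s vLen 0 = d"
    and complete: "table_complete (1 + \<epsilon>) t X n d (table n s)"
  shows "runs (Fors [vU, vU1, vV1, vU2, vV2] eM search_step)
    ((loop_time (2 * n + 1) ^^ 5) (28 * real n + T n \<epsilon> + 28)) (\<lambda>s'. table_complete (1 + \<epsilon>) t X n (Suc d)
      (table n s')) s"
proof -
  let ?as = "[vU, vU1, vV1, vU2, vV2]" and ?P = "bounded_at (1 + \<epsilon>) t X n d"
  let ?loops = "Fors ?as eM search_step"
  have X': "holds_positions \<epsilon> t X n s'" if "frame ?loops s s'" for s'
    by (rule holds_positions_frame[OF X that]) simp_all
  have "runs ?loops ((loop_time (2 * n + 1) ^^ length ?as) (28 * real n + T n \<epsilon> + 28))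
      (\<lambda>s'. table_valid X t n d (table n s') \<and> improves d (table n s) (table n s') \<and>
        (\<forall>is. length is = length ?as \<longrightarrow> set is \<subseteq> {..<2 * n + 1} \<longrightarrow> ?P is (table n s'))) s"
  proof (rule runs_Fors[where \<tau> = "table n"])
    fix "is" s' assume frame: "frame ?loops s s'" and counters: "map (\<lambda>a. nmem s' a 0) ?as = is"
      and valid: "table_valid X t n d (table n s')"
    obtain u u\<^sub>1 v\<^sub>1 u\<^sub>2 v\<^sub>2 where vars: "is = [u, u\<^sub>1, v\<^sub>1, u\<^sub>2, v\<^sub>2]" using counters by auto
    have "nmem s' vN 0 = n" "nmem s' vLen 0 = d"
      using X'[OF frame] d frame by (simp_all add: holds_positions_def frame_def)
    then have "counters n u (u + d + 1) u\<^sub>1 v\<^sub>1 u\<^sub>2 v\<^sub>2 s'" using counters vars by (simp add: counters_def)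
    from runs_search_step[OF \<open>\<epsilon> > 0\<close> X'[OF frame] this \<open>d < n\<close> valid]
    show "runs search_step (28 * real n + T n \<epsilon> + 28)
        (\<lambda>s''. table_valid X t n d (table n s'') \<and> improves d (table n s') (table n s'')
          \<and> ?P is (table n s'')) s'"
      by (simp add: bounded_at_def vars)
  next
    show "?P is y" if "?P is x" "improves d x y" for "is" x y
      using that table_bounded_improves[OF _ that(2) order_refl] unfolding bounded_at_def by blast
    show "nval eM s' = 2 * n + 1" if "frame ?loops s s'" for s'
      using X'[OF that] by (simp add: holds_positions_def)
    show "table n (nupd a 0 x s') = table n s'" if "a \<in> set ?as" for a x s'
      using that by (intro table_cong entry_cong) auto
    show "table_valid X t n d (table n s)" using complete by (simp add: table_complete_def)
  qed (auto simp: improves_refl intro: improves_trans)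
  then show ?thesis
  proof (rule runs_mono)
    fix s' assume post: "table_valid X t n d (table n s') \<and> improves d (table n s) (table n s') \<and>
        (\<forall>is. length is = length ?as \<longrightarrow> set is \<subseteq> {..<2 * n + 1} \<longrightarrow> ?P is (table n s'))"
    have "table_bounded (1 + \<epsilon>) t X n u (u + d + 1) u\<^sub>1 v\<^sub>1 u\<^sub>2 v\<^sub>2 (table n s')" for u u\<^sub>1 v\<^sub>1 u\<^sub>2 v\<^sub>2
    proof (cases "set [u, u\<^sub>1, v\<^sub>1, u\<^sub>2, v\<^sub>2] \<subseteq> {..<2 * n + 1}")
      case True
      then have "?P [u, u\<^sub>1, v\<^sub>1, u\<^sub>2, v\<^sub>2] (table n s')" using post by simp
      then show ?thesis by (simp add: bounded_at_def)
    qed (auto simp: table_bounded_def gaps_def)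
    then show "table_complete (1 + \<epsilon>) t X n (Suc d) (table n s')"
      using table_complete_Suc[OF complete] post by blast
  qed (simp add: numeral_eq_Suc)
qed

lemma runs_fill_table:
  assumes "\<epsilon> > 0" and X: "holds_positions \<epsilon> t X n s" and init: "table_complete (1 + \<epsilon>) t X n 0 (table n s)"
  shows "runs fill_table (loop_time n ((loop_time (2 * n + 1) ^^ 5) (28 * real n + T n \<epsilon> + 28)))
    (\<lambda>s'. table_complete (1 + \<epsilon>) t X n n (table n s')) s"
  unfolding fill_table_def
proof (rule runs_For[where J = "\<lambda>d s'. table_complete (1 + \<epsilon>) t X n d (table n s')"])
  let ?loops = "Fors [vU, vU1, vV1, vU2, vV2] eM search_step"
  have X': "holds_positions \<epsilon> t X n s'" if "frame (For vLen (NVar vN) ?loops) s s'" for s'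
    by (rule holds_positions_frame[OF X that]) simp_all
  show "nval (NVar vN) s' = n" if "frame (For vLen (NVar vN) ?loops) s s'" for s'
    using X'[OF that] by (simp add: holds_positions_def)
  have set_len: "table n (nupd vLen 0 k s') = table n s'" for k s'
    by (intro table_cong entry_cong) simp_all
  then show "table_complete (1 + \<epsilon>) t X n 0 (table n (nupd vLen 0 0 s))" using init by simp
  fix d s' assume "d < n" "frame (For vLen (NVar vN) ?loops) s s'" "nmem s' vLen 0 = d"
    "table_complete (1 + \<epsilon>) t X n d (table n s')"
  then show "runs ?loops ((loop_time (2 * n + 1) ^^ 5) (28 * real n + T n \<epsilon> + 28))
      (\<lambda>s''. table_complete (1 + \<epsilon>) t X n (Suc d) (table n (nupd vLen 0 (Suc d) s''))) s'"
    unfolding set_len using \<open>\<epsilon> > 0\<close> X' by (intro runs_search)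
qed simp_all


section \<open>Sorting the sources along the hull\<close>

definition copy_input :: com where
  "copy_input = (NSet vN (NVar 0) ;; RAssign rParam (NConst 0) (RCell 0 (NConst 0)) ;;
     RAssign rParam (NConst 1) (RCell 0 (NConst 1)) ;; RAssign rParam (NConst 2) (RCell 0 (NConst 2))) ;;
     For vI (NVar vN) (RAssign rX (NVar vI) (RCell 1 (NVar vI)) ;; RAssign rY (NVar vI) (RCell 2 (NVar vI)))"

definition bLex :: "nexp \<Rightarrow> nexp \<Rightarrow> bexp" where
  "bLex e f = BOr (RLess (RCell rX e) (RCell rX f))
     (BAnd (BNot (RLess (RCell rX f) (RCell rX e))) (RLess (RCell rY e) (RCell rY f)))"

definition bLower :: "nexp \<Rightarrow> nexp \<Rightarrow> nexp \<Rightarrow> bexp" where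
  "bLower e f g = BAnd (BAnd (bLex e f) (bLex f g))
     (RLess (RMul (RSub (RCell rY f) (RCell rY e)) (RSub (RCell rX g) (RCell rX e)))
       (RMul (RSub (RCell rX f) (RCell rX e)) (RSub (RCell rY g) (RCell rY e))))"

definition mark_step :: com where
  "mark_step = If (bLower (NVar vJ) (NVar vI) (NVar vK)) (NAssign aLower (NVar vI) (NConst 1)) SKIP"

definition mark_lower :: com where
  "mark_lower = clear vI aLower (NVar vN) ;; Fors [vI, vJ, vK] (NVar vN) mark_step"

abbreviation "bMarked e \<equiv> NPos (NCell aLower e)"

definition bHull :: "nexp \<Rightarrow> nexp \<Rightarrow> bexp" where
  "bHull e f = BOr (BAnd (bMarked e) (BAnd (bMarked f) (bLex f e)))
      (BAnd (BNot (bMarked e)) (BOr (bMarked f) (bLex e f)))"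

definition bBefore :: "nexp \<Rightarrow> nexp \<Rightarrow> bexp" where
  "bBefore e f = BOr (bHull e f) (BAnd (BAnd (BNot (bLex e f)) (BNot (bLex f e))) (NLess e f))"

definition rank_step :: com where
  "rank_step = If (bBefore (NVar vJ) (NVar vI)) (NInc vRank) SKIP"

definition rank_source :: com where
  "rank_source = NSet vRank (NConst 0) ;; For vJ (NVar vN) rank_step ;;
     NAssign aPerm (NVar vRank) (NVar vI) ;; NAssign aPerm (NAdd (NVar vRank) (NVar vN)) (NVar vI)"

definition sort_sources :: com where
  "sort_sources = For vI (NVar vN) rank_source"

lemma mods_sorting [simp]:
  "nmods copy_input = {vN, vI}" "rmods copy_input = {rParam, rX, rY}"
  "nmods mark_step = {aLower}" "rmods mark_step = {}"
  "nmods mark_lower = {vI, vJ, vK, aLower}" "rmods mark_lower = {}"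
  "nmods rank_step = {vRank}" "rmods rank_step = {}"
  "nmods rank_source = {vJ, vRank, aPerm}" "rmods rank_source = {}"
  "nmods sort_sources = {vI, vJ, vRank, aPerm}" "rmods sort_sources = {}"
  by (auto simp: copy_input_def mark_lower_def mark_step_def sort_sources_def rank_source_def rank_step_def)

definition holds_sources :: "real \<Rightarrow> point \<Rightarrow> point list \<Rightarrow> state \<Rightarrow> bool" where
  "holds_sources \<epsilon> t A s \<longleftrightarrow>
     nmem s vN 0 = length A \<and> rmem s rParam 0 = \<epsilon> \<and> (rmem s rParam 1, rmem s rParam 2) = t \<and>
     (\<forall>i<length A. rmem s rX i = fst (A ! i) \<and> rmem s rY i = snd (A ! i))"

lemma holds_sources_frame:
  assumes "holds_sources \<epsilon> t A s" "frame c s s'" "vN \<notin> nmods c" "rmods c \<inter> {rParam, rX, rY} = {}"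
  shows "holds_sources \<epsilon> t A s'"
  using assms by (simp add: holds_sources_def frame_def)

lemma runs_copy_input:
  assumes "holds_input \<epsilon> t A s"
  shows "runs copy_input (4 * real (length A) + 6) (holds_sources \<epsilon> t A) s"
  unfolding copy_input_def
proof (rule runs_straight_Seq)
  let ?step = "RAssign rX (NVar vI) (RCell 1 (NVar vI)) ;; RAssign rY (NVar vI) (RCell 2 (NVar vI))"
  let ?s\<^sub>0 = "result (NSet vN (NVar 0) ;; RAssign rParam (NConst 0) (RCell 0 (NConst 0)) ;;
     RAssign rParam (NConst 1) (RCell 0 (NConst 1)) ;; RAssign rParam (NConst 2) (RCell 0 (NConst 2))) s"
  define J where "J i s' \<longleftrightarrow> (\<forall>j<i. rmem s' rX j = fst (A ! j) \<and> rmem s' rY j = snd (A ! j))" for i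
    and s' :: state
  show "runs (For vI (NVar vN) ?step) (4 * real (length A) + 2) (holds_sources \<epsilon> t A) ?s\<^sub>0"
  proof (rule runs_For[where J = J and n = "length A" and B = 2])
    fix i s' assume "i < length A" and frame: "frame (For vI (NVar vN) ?step) ?s\<^sub>0 s'"
      and "nmem s' vI 0 = i" "J i s'"
    moreover from this have "rmem s' 1 i = fst (A ! i)" "rmem s' 2 i = snd (A ! i)"
      using assms by (auto simp: frame_def holds_input_def)
    ultimately show "runs ?step 2 (\<lambda>s''. J (Suc i) (nupd vI 0 (Suc i) s'')) s'"
      by (intro runs_straight) (auto simp: J_def less_Suc_eq)
  qed (use assms in \<open>auto simp: J_def frame_def holds_input_def holds_sources_def loop_time_def\<close>)
qed simp_all

lemma bval_bLex:
  assumes "holds_sources \<epsilon> t A s" "nval e s < length A" "nval f s < length A"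
  shows "bval (bLex e f) s \<longleftrightarrow> A ! nval e s <\<^sub>L A ! nval f s"
  using assms by (auto simp: bLex_def holds_sources_def lex_less_def)

lemma bval_bLower:
  assumes "holds_sources \<epsilon> t A s" "nval e s < length A" "nval f s < length A" "nval g s < length A"
  shows "bval (bLower e f g) s \<longleftrightarrow> A ! nval e s <\<^sub>L A ! nval f s \<and> A ! nval f s <\<^sub>L A ! nval g s \<and>
    0 < orient (A ! nval e s) (A ! nval f s) (A ! nval g s)"
  using assms by (auto simp: bLower_def bval_bLex orient_def det2_def holds_sources_def)

definition marks_lower :: "point list \<Rightarrow> state \<Rightarrow> bool" where
  "marks_lower A s \<longleftrightarrow> (\<forall>i<length A. 0 < nmem s aLower i \<longleftrightarrow> lower_chain (set A) (A ! i))"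

lemma marks_lowerI:
  assumes sound: "\<And>i. i < length A \<Longrightarrow> 0 < nmem s aLower i \<Longrightarrow> lower_chain (set A) (A ! i)"
    and complete: "\<And>i j k. {i, j, k} \<subseteq> {..<length A} \<Longrightarrow> A ! j <\<^sub>L A ! i \<Longrightarrow> A ! i <\<^sub>L A ! k \<Longrightarrow>
      0 < orient (A ! j) (A ! i) (A ! k) \<Longrightarrow> 0 < nmem s aLower i"
  shows "marks_lower A s"
  unfolding marks_lower_def
proof (intro allI impI iffI)
  fix i assume i: "i < length A" and "lower_chain (set A) (A ! i)"
  then obtain a c where ac: "a \<in> set A" "c \<in> set A" "a <\<^sub>L A ! i" "A ! i <\<^sub>L c" "0 < orient a (A ! i) c"
    unfolding lower_chain_def by blast
  obtain j k where "j < length A" "A ! j = a" "k < length A" "A ! k = c"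
    using ac(1,2) by (metis in_set_conv_nth)
  then show "0 < nmem s aLower i" using complete[of i j k] ac(3-5) i by simp
qed (rule sound)

definition mark_complete :: "point list \<Rightarrow> nat list \<Rightarrow> (nat \<Rightarrow> nat) \<Rightarrow> bool" where
  "mark_complete A is x \<longleftrightarrow> (\<forall>i j k. is = [i, j, k] \<longrightarrow> A ! j <\<^sub>L A ! i \<longrightarrow> A ! i <\<^sub>L A ! k \<longrightarrow>
     0 < orient (A ! j) (A ! i) (A ! k) \<longrightarrow> 0 < x i)"

lemma runs_mark_step:
  assumes A: "holds_sources \<epsilon> t A s" and counters: "nmem s vI 0 = i" "nmem s vJ 0 = j" "nmem s vK 0 = k"
    and less: "i < length A" "j < length A" "k < length A"
    and sound: "\<forall>i<length A. 0 < nmem s aLower i \<longrightarrow> lower_chain (set A) (A ! i)"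
  shows "runs mark_step 2 (\<lambda>s'. (\<forall>i<length A. 0 < nmem s' aLower i \<longrightarrow> lower_chain (set A) (A ! i)) \<and>
    (\<forall>i. 0 < nmem s aLower i \<longrightarrow> 0 < nmem s' aLower i) \<and> mark_complete A [i, j, k] (nmem s' aLower)) s"
proof (rule runs_straight)
  have test: "bval (bLower (NVar vJ) (NVar vI) (NVar vK)) s \<longleftrightarrow>
      A ! j <\<^sub>L A ! i \<and> A ! i <\<^sub>L A ! k \<and> 0 < orient (A ! j) (A ! i) (A ! k)"
    using bval_bLower[OF A, of "NVar vJ" "NVar vI" "NVar vK"] counters less by simp
  have lower: "lower_chain (set A) (A ! i)" if "A ! j <\<^sub>L A ! i" "A ! i <\<^sub>L A ! k"
    "0 < orient (A ! j) (A ! i) (A ! k)"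
    unfolding lower_chain_def using that less nth_mem by blast
  show "(\<forall>i<length A. 0 < nmem (result mark_step s) aLower i \<longrightarrow> lower_chain (set A) (A ! i)) \<and>
      (\<forall>i. 0 < nmem s aLower i \<longrightarrow> 0 < nmem (result mark_step s) aLower i) \<and>
      mark_complete A [i, j, k] (nmem (result mark_step s) aLower)"
    unfolding mark_step_def result.simps test mark_complete_def using sound lower counters by auto
qed (simp_all add: mark_step_def)

lemma runs_mark_lower:
  assumes A: "holds_sources \<epsilon> t A s" and n: "n = length A"
  shows "runs mark_lower ((loop_time n ^^ 3) 2 + (3 * real n + 2)) (marks_lower A) s"
  unfolding mark_lower_def
proof (rule runs_Seq[OF runs_clear])
  let ?as = "[vI, vJ, vK]"
  let ?loops = "Fors ?as (NVar vN) mark_step"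
  show "nval (NVar vN) s' = n" if "frame (clear vI aLower (NVar vN)) s s'" for s'
    using A n that by (simp add: frame_def holds_sources_def)
  fix s' assume frame: "frame (clear vI aLower (NVar vN)) s s'" and zero: "\<forall>i<n. nmem s' aLower i = 0"
  define sound where "sound x \<longleftrightarrow> (\<forall>i<n. 0 < x i \<longrightarrow> lower_chain (set A) (A ! i))" for x :: "nat \<Rightarrow> nat"
  have A': "holds_sources \<epsilon> t A s'" by (rule holds_sources_frame[OF A frame]) simp_all
  have "runs ?loops ((loop_time n ^^ length ?as) 2) (\<lambda>s''. sound (nmem s'' aLower) \<and>
      (\<forall>i. 0 < nmem s' aLower i \<longrightarrow> 0 < nmem s'' aLower i) \<and>
      (\<forall>is. length is = length ?as \<longrightarrow> set is \<subseteq> {..<n} \<longrightarrow> mark_complete A is (nmem s'' aLower))) s'"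
  proof (rule runs_Fors[where \<tau> = "\<lambda>s. nmem s aLower"])
    fix "is" r assume less: "set is \<subseteq> {..<n}" and frame': "frame ?loops s' r"
      and counters: "map (\<lambda>a. nmem r a 0) ?as = is"
      and inv: "sound (nmem r aLower)"
    obtain i j k where vars: "is = [i, j, k]" using counters by auto
    have "holds_sources \<epsilon> t A r" by (rule holds_sources_frame[OF A' frame']) simp_all
    from runs_mark_step[OF this, of i j k]
    show "runs mark_step 2 (\<lambda>r'. sound (nmem r' aLower) \<and> (\<forall>i. 0 < nmem r aLower i \<longrightarrow> 0 < nmem r' aLower i) \<and>
        mark_complete A is (nmem r' aLower)) r"
      using counters less inv unfolding vars sound_def n by simp
  next
    show "mark_complete A is y" if "mark_complete A is x" "\<forall>i. 0 < x i \<longrightarrow> 0 < y i" for "is" x y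
      using that unfolding mark_complete_def by blast
  qed (use A' zero n in \<open>auto simp: sound_def frame_def holds_sources_def\<close>)
  then show "runs ?loops ((loop_time n ^^ 3) 2) (marks_lower A) s'"
  proof (rule runs_mono)
    fix r :: state
    assume post: "sound (nmem r aLower) \<and> (\<forall>i. 0 < nmem s' aLower i \<longrightarrow> 0 < nmem r aLower i) \<and>
      (\<forall>is. length is = length ?as \<longrightarrow> set is \<subseteq> {..<n} \<longrightarrow> mark_complete A is (nmem r aLower))"
    have "mark_complete A [i, j, k] (nmem r aLower)" if "{i, j, k} \<subseteq> {..<n}" for i j k using post that by simp
    then show "marks_lower A r"
      using post n by (intro marks_lowerI) (auto simp: sound_def mark_complete_def)
  qed (simp add: numeral_eq_Suc)
qed simp_all

lemma bval_bHull:
  assumes "holds_sources \<epsilon> t A s" "marks_lower A s" "nval e s < length A" "nval f s < length A"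
  shows "bval (bHull e f) s \<longleftrightarrow> hull_less (set A) (A ! nval e s) (A ! nval f s)"
  using assms by (auto simp: bHull_def bval_bLex hull_less_def marks_lower_def)

lemma bval_bBefore:
  assumes "holds_sources \<epsilon> t A s" "marks_lower A s" "nval e s < length A" "nval f s < length A"
  shows "bval (bBefore e f) s \<longleftrightarrow> before A (nval e s) (nval f s)"
proof -
  have "A ! nval e s = A ! nval f s \<longleftrightarrow> \<not> A ! nval e s <\<^sub>L A ! nval f s \<and> \<not> A ! nval f s <\<^sub>L A ! nval e s"
    by (auto simp: lex_less_def prod_eq_iff)
  then show ?thesis using assms by (simp add: bBefore_def bval_bHull bval_bLex before_def)
qed

lemma runs_rank:
  assumes A: "holds_sources \<epsilon> t A s" and marks: "marks_lower A s" and i: "nmem s vI 0 = i" "i < length A"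
    and rank: "nmem s vRank 0 = 0"
  shows "runs (For vJ (NVar vN) rank_step) (4 * real (length A) + 2) (\<lambda>s'. nmem s' vRank 0 = hull_rank A i) s"
proof (rule runs_For[where J = "\<lambda>j s'. nmem s' vRank 0 = card {k \<in> {..<j}. before A k i}" and n = "length A"
  and B = 2])
  fix j s' assume j: "j < length A" "nmem s' vJ 0 = j" and frame: "frame (For vJ (NVar vN) rank_step) s s'"
    and J: "nmem s' vRank 0 = card {k \<in> {..<j}. before A k i}"
  have A': "holds_sources \<epsilon> t A s'" by (rule holds_sources_frame[OF A frame]) simp_all
  have "marks_lower A s'" "nmem s' vI 0 = i" using marks i frame by (simp_all add: marks_lower_def frame_def)
  then have test: "bval (bBefore (NVar vJ) (NVar vI)) s' \<longleftrightarrow> before A j i"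
    using bval_bBefore[OF A', of "NVar vJ" "NVar vI"] i(2) j by simp
  have "{k \<in> {..<Suc j}. before A k i} =
      (if before A j i then insert j {k \<in> {..<j}. before A k i} else {k \<in> {..<j}. before A k i})"
    by (auto simp: less_Suc_eq)
  then show "runs rank_step 2 (\<lambda>s''. nmem (nupd vJ 0 (Suc j) s'') vRank 0 =
      card {k \<in> {..<Suc j}. before A k i}) s'"
    unfolding rank_step_def using J test by (intro runs_straight) simp_all
qed (use A rank in \<open>auto simp: frame_def holds_sources_def hull_rank_def loop_time_def\<close>)

definition perm_sorted :: "point list \<Rightarrow> state \<Rightarrow> bool" where
  "perm_sorted A s \<longleftrightarrow> (\<forall>p<2 * length A. nmem s aPerm p = source_at A p)"

lemma perm_sortedI:
  assumes "\<And>i. i < length A \<Longrightarrow> nmem s aPerm (hull_rank A i) = i \<and> nmem s aPerm (hull_rank A i + length A) = i"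
  shows "perm_sorted A s"
  unfolding perm_sorted_def
proof (intro allI impI)
  have first: "nmem s aPerm p = source_at A p \<and> nmem s aPerm (p + length A) = source_at A p"
    if "p < length A" for p
  proof -
    have "p \<in> hull_rank A ` {..<length A}" using bij_betw_hull_rank[of A] that by (simp add: bij_betw_def)
    then obtain i where "i < length A" "p = hull_rank A i" by blast
    then show ?thesis using assms source_at_hull_rank by simp
  qed
  fix p assume p: "p < 2 * length A"
  show "nmem s aPerm p = source_at A p"
  proof (cases "p < length A")
    case False
    then show ?thesis using first[of "p - length A"] source_at_periodic[of A "p - length A"] p by simp
  qed (use first in blast)
qed

lemma holds_positions_hull_seq:
  assumes A: "holds_sources \<epsilon> t A s" and perm: "perm_sorted A s"
  shows "holds_positions \<epsilon> t (hull_seq A) (length A) s"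
proof -
  have "source_at A p < length A" if "p < 2 * length A" for p using that by (intro source_at_less) auto
  then show ?thesis
    using assms by (simp add: holds_sources_def holds_positions_def perm_sorted_def hull_seq_def)
qed

lemma runs_sort_sources:
  assumes A: "holds_sources \<epsilon> t A s" and marks: "marks_lower A s" and n: "n = length A"
  shows "runs sort_sources (4 * real n ^ 2 + 7 * real n + 2) (perm_sorted A) s"
proof -
  define J where "J i s' \<longleftrightarrow> (\<forall>k<i. nmem s' aPerm (hull_rank A k) = k \<and> nmem s' aPerm (hull_rank A k + n) = k)"
    for i and s' :: state
  have step: "runs rank_source (4 * real n + 5) (\<lambda>s''. J (Suc i) (nupd vI 0 (Suc i) s'')) s'"
    if i: "i < n" "nmem s' vI 0 = i" and frame: "frame sort_sources s s'" and J: "J i s'" for i s'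
    unfolding rank_source_def
  proof (rule runs_straight_Seq[where B = "4 * real n + 4", OF _ runs_Seq])
    let ?s\<^sub>0 = "result (NSet vRank (NConst 0)) s'"
    have A': "holds_sources \<epsilon> t A ?s\<^sub>0" and "marks_lower A ?s\<^sub>0"
      using A marks frame by (simp_all add: holds_sources_def marks_lower_def frame_def)
    then show "runs (For vJ (NVar vN) rank_step) (4 * real n + 2) (\<lambda>s''. nmem s'' vRank 0 = hull_rank A i) ?s\<^sub>0"
      unfolding n by (rule runs_rank) (use i n in simp_all)
    fix s'' assume "frame (For vJ (NVar vN) rank_step) ?s\<^sub>0 s''" and rank: "nmem s'' vRank 0 = hull_rank A i"
    then have s'': "nmem s'' vI 0 = i" "nmem s'' vN 0 = n" "nmem s'' aPerm = nmem s' aPerm"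
      using A' i n by (simp_all add: frame_def holds_sources_def)
    have "hull_rank A k \<noteq> hull_rank A i \<and> hull_rank A k \<noteq> hull_rank A i + n \<and> hull_rank A k + n \<noteq> hull_rank A i"
      if "k < i" for k
      using that i(1) n hull_rank_less[of k A] hull_rank_less[of i A]
        inj_on_eq_iff[OF bij_betw_imp_inj_on[OF bij_betw_hull_rank], of k A i] by simp
    then show "runs (NAssign aPerm (NVar vRank) (NVar vI) ;; NAssign aPerm (NAdd (NVar vRank) (NVar vN))
        (NVar vI)) 2
        (\<lambda>s''. J (Suc i) (nupd vI 0 (Suc i) s'')) s''"
      using J rank s'' by (intro runs_straight) (auto simp: J_def less_Suc_eq)
  qed simp_all
  show ?thesis
    unfolding sort_sources_def
  proof (rule runs_For[OF _ _ _ step[unfolded sort_sources_def]])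
    show "perm_sorted A s'" if "J n s'" for s' by (rule perm_sortedI) (use that n in \<open>simp add: J_def\<close>)
  qed (use A n in \<open>auto simp: J_def frame_def holds_sources_def loop_time_def power2_eq_square algebra_simps\<close>)
qed

section \<open>Initialising the table\<close>

definition init_table :: com where
  "init_table = clear vI aFilled (NMul eM eM) ;;
     For vI eM (NAssign aFilled (eIx2 (NVar vI) (NVar vI)) (NConst 1) ;;
       RAssign rValue (eIx2 (NVar vI) (NVar vI)) (RNat (NConst 0)))"

lemma mods_init_table [simp]: "nmods init_table = {vI, aFilled}" "rmods init_table = {rValue}"
  by (auto simp: init_table_def)

lemma table_complete_diagonal:
  assumes diag: "\<And>u. u \<le> 2 * n \<Longrightarrow> \<exists>S. x (u, u) = Some S \<and> val S = 0"
    and off: "\<And>u v. x (u, v) \<noteq> None \<Longrightarrow> u = v \<and> v \<le> 2 * n"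
  shows "table_complete c t X n 0 x"
proof -
  have "valid X t u v S" if "x (u, v) = Some S" for u v S
    using off[of u v] diag[of u] that by (auto simp: valid_def leaders_def)
  moreover have "x (u, v) \<noteq> None" if "u \<le> v" "v \<le> 2 * n" "v - u \<le> 0" for u v using diag[of u] that by auto
  ultimately show ?thesis using diag unfolding table_complete_def table_valid_def table_val_def by fastforce
qed

lemma runs_init_table:
  assumes N: "nmem s vN 0 = n"
  shows "runs init_table (12 * real n ^ 2 + 20 * real n + 11) (\<lambda>s'. table_complete c t X n 0 (table n s')) s"
  unfolding init_table_def
proof (rule runs_Seq[OF runs_clear, where B' = "8 * real n + 6"])
  let ?clear = "clear vI aFilled (NMul eM eM)" and ?M = "(2 * n + 1) * (2 * n + 1)"
  let ?diag = "NAssign aFilled (eIx2 (NVar vI) (NVar vI)) (NConst 1) ;;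
     RAssign rValue (eIx2 (NVar vI) (NVar vI)) (RNat (NConst 0))"
  show "nval (NMul eM eM) s' = ?M" if "frame ?clear s s'" for s' using N that by (simp add: frame_def)
  fix s\<^sub>0 assume frame: "frame ?clear s s\<^sub>0" and zero: "\<forall>k<?M. nmem s\<^sub>0 aFilled k = 0"
  have zero: "nmem s\<^sub>0 aFilled (ix2 n u v) = 0" if "u \<le> 2 * n" "v \<le> 2 * n" for u v
    using zero ix2_less that by blast
  define J where "J i s' \<longleftrightarrow> (\<forall>u v. u \<le> 2 * n \<longrightarrow> v \<le> 2 * n \<longrightarrow> (0 < nmem s' aFilled (ix2 n u v) \<longleftrightarrow> u = v \<and> u < i)) \<and>
     (\<forall>u<i. rmem s' rValue (ix2 n u u) = 0)" for i and s' :: state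
  show "runs (For vI eM ?diag) (8 * real n + 6) (\<lambda>s'. table_complete c t X n 0 (table n s')) s\<^sub>0"
  proof (rule runs_For[where J = J and n = "2 * n + 1" and B = 2])
    fix i s' assume i: "i < 2 * n + 1" "nmem s' vI 0 = i" and frame': "frame (For vI eM ?diag) s\<^sub>0 s'"
      and J: "J i s'"
    have result: "result ?diag s' = rupd rValue (ix2 n i i) 0 (nupd aFilled (ix2 n i i) 1 s')"
      using i(2) N frame frame' by (simp add: frame_def ix2_def)
    have "J (Suc i) (nupd vI 0 (Suc i) (result ?diag s'))"
      unfolding result using J i(1) by (auto simp: J_def less_Suc_eq ix2_eq_iff)
    then show "runs ?diag 2 (\<lambda>s''. J (Suc i) (nupd vI 0 (Suc i) s'')) s'"
      by (rule runs_straight[rotated 2]) simp_all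
  next
    show "table_complete c t X n 0 (table n s')" if "J (2 * n + 1) s'" for s'
    proof (rule table_complete_diagonal)
      show "\<exists>S. table n s' (u, u) = Some S \<and> val S = 0" if "u \<le> 2 * n" for u
        using \<open>J (2 * n + 1) s'\<close> that by (simp add: J_def table_def entry_def)
      show "u = v \<and> v \<le> 2 * n" if "table n s' (u, v) \<noteq> None" for u v
        using \<open>J (2 * n + 1) s'\<close> that by (simp add: J_def table_def split: if_splits)
    qed
    show "J 0 (nupd vI 0 0 s\<^sub>0)" using zero by (simp add: J_def)
  qed (use N frame in \<open>auto simp: frame_def loop_time_def\<close>)
qed (simp_all add: power2_eq_square algebra_simps)


section \<open>Writing the layout\<close>

definition start_step :: com where
  "start_step = If (RLess (RCell rValue (eIx2 (NVar vI) (NAdd (NVar vI) (NVar vN))))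
       (RCell rValue (eIx2 (NVar vStart) (NAdd (NVar vStart) (NVar vN))))) (NSet vStart (NVar vI)) SKIP"

definition choose_start :: com where
  "choose_start = NSet vStart (NConst 0) ;; For vI (NAdd (NVar vN) (NConst 1)) start_step"

abbreviation "eEnd \<equiv> NAdd (NVar vStart) (NVar vN)"
abbreviation "eSlot \<equiv> eIx3 (NVar vStart) eEnd (NVar vP)"
abbreviation "bLeader \<equiv> BAnd (bPositionIn (NVar vStart) eEnd)
  (BAnd (NLe (NCell aLabel eSlot) (NVar vP)) (NLe (NVar vP) (NCell aLabel eSlot)))"

definition number_step :: com where
  "number_step = If bLeader (NAssign aIndex (NVar vP) (NVar 1) ;; RAssign 3 (NVar 1) (RCell rSiteX eSlot) ;;
     RAssign 4 (NVar 1) (RCell rSiteY eSlot) ;; NInc 1) SKIP"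

definition number_groups :: com where
  "number_groups = NSet 1 (NConst 0) ;; For vP eM number_step"

definition link_step :: com where
  "link_step = If (bPositionIn (NVar vStart) eEnd)
     (NAssign 2 (NCell aPerm (NVar vP)) (NAdd (NVar vN) (NCell aIndex (NCell aLabel eSlot)))) SKIP"

definition link_sources :: com where
  "link_sources = For vP eM link_step"

definition link_groups :: com where
  "link_groups = For vP (NVar 1) (NAssign 2 (NAdd (NVar vN) (NVar vP)) (NAdd (NVar vN) (NVar 1)))"

lemma mods_output [simp]:
  "nmods start_step = {vStart}" "rmods start_step = {}"
  "nmods choose_start = {vStart, vI}" "rmods choose_start = {}"
  "nmods number_step = {1, aIndex}" "rmods number_step = {3, 4}"
  "nmods number_groups = {1, vP, aIndex}" "rmods number_groups = {3, 4}"
  "nmods link_step = {2}" "rmods link_step = {}"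
  "nmods link_sources = {2, vP}" "rmods link_sources = {}"
  "nmods link_groups = {2, vP}" "rmods link_groups = {}"
  by (auto simp: start_step_def choose_start_def number_step_def number_groups_def
      link_step_def link_sources_def link_groups_def)

lemma runs_choose_start:
  assumes N: "nmem s vN 0 = n"
  shows "runs choose_start (4 * real n + 7) (\<lambda>s'. nmem s' vStart 0 \<le> n \<and>
    (\<forall>r\<le>n. rmem s rValue (ix2 n (nmem s' vStart 0) (nmem s' vStart 0 + n))
      \<le> rmem s rValue (ix2 n r (r + n)))) s"
  unfolding choose_start_def
proof (rule runs_straight_Seq)
  let ?loop = "For vI (NAdd (NVar vN) (NConst 1)) start_step" and ?s\<^sub>0 = "result (NSet vStart (NConst 0)) s"
  define f where "f r = rmem s rValue (ix2 n r (r + n))" for r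
  define J where "J i s' \<longleftrightarrow> nmem s' vStart 0 \<le> n \<and> (\<forall>r<i. f (nmem s' vStart 0) \<le> f r)" for i and s' :: state
  have "runs ?loop (4 * real n + 6) (J (n + 1)) ?s\<^sub>0"
  proof (rule runs_For[where J = J and n = "n + 1" and B = 2])
    fix i s' assume i: "i < n + 1" "nmem s' vI 0 = i" and frame: "frame ?loop ?s\<^sub>0 s'" and J: "J i s'"
    have "nmem s' vN 0 = n" "rmem s' rValue = rmem s rValue" using N frame by (simp_all add: frame_def)
    then have "result start_step s' = (if f i < f (nmem s' vStart 0) then nupd vStart 0 i s' else s')"
      using i(2) by (simp add: start_step_def f_def ix2_def)
    then have "J (Suc i) (result start_step s')"
      using J i(1) by (auto simp: J_def less_Suc_eq intro: order_trans less_imp_le)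
    then show "runs start_step 2 (\<lambda>s''. J (Suc i) (nupd vI 0 (Suc i) s'')) s'"
      by (intro runs_straight) (simp_all add: J_def start_step_def)
  qed (use N in \<open>auto simp: J_def frame_def loop_time_def\<close>)
  then show "runs ?loop (4 * real n + 6) (\<lambda>s'. nmem s' vStart 0 \<le> n \<and>
      (\<forall>r\<le>n. rmem s rValue (ix2 n (nmem s' vStart 0) (nmem s' vStart 0 + n))
        \<le> rmem s rValue (ix2 n r (r + n)))) ?s\<^sub>0"
    by (rule runs_mono) (simp_all add: J_def f_def less_Suc_eq_le)
qed simp_all

definition numbered :: "nat list \<Rightarrow> solution \<Rightarrow> state \<Rightarrow> bool" where
  "numbered ls S s \<longleftrightarrow> nmem s 1 0 = length ls \<and>
     (\<forall>j<length ls. nmem s aIndex (ls ! j) = j \<and> (rmem s 3 j, rmem s 4 j) = site S (ls ! j))"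

lemma numbered_snoc:
  assumes "numbered ls S s" "p \<notin> set ls" and q: "site S p = (x, y)"
  shows "numbered (ls @ [p]) S
    (nupd 1 0 (Suc (nmem s 1 0)) (rupd 4 (nmem s 1 0) y
      (rupd 3 (nmem s 1 0) x (nupd aIndex p (nmem s 1 0) s))))"
proof -
  have "ls ! j \<noteq> p" if "j < length ls" for j using assms(2) that nth_mem by metis
  then show ?thesis using assms(1) q by (auto simp: numbered_def nth_append less_Suc_eq)
qed

lemma runs_number_groups:
  assumes N: "nmem s vN 0 = n" "nmem s vStart 0 = b" "b \<le> n" and S: "S = entry n s b (b + n)"
  shows "runs number_groups (14 * real n + 10) (numbered (sorted_list_of_set (leaders b (b + n) S)) S) s"
  unfolding number_groups_def
proof (rule runs_straight_Seq)
  let ?L = "leaders b (b + n) S" and ?loop = "For vP eM number_step" and ?s\<^sub>0 = "result (NSet 1 (NConst 0)) s"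
  define ls where "ls i = sorted_list_of_set (?L \<inter> {..<i})" for i
  show "runs ?loop (14 * real n + 9) (numbered (sorted_list_of_set ?L) S) ?s\<^sub>0"
  proof (rule runs_For[where J = "\<lambda>i. numbered (ls i) S" and n = "2 * n + 1" and B = 5])
    fix i s' assume i: "i < 2 * n + 1" "nmem s' vP 0 = i" and frame: "frame ?loop ?s\<^sub>0 s'"
      and J: "numbered (ls i) S s'"
    have same: "nmem s' vN 0 = n" "nmem s' vStart 0 = b" "nmem s' aLabel = nmem s aLabel"
      "rmem s' rSiteX = rmem s rSiteX"
      "rmem s' rSiteY = rmem s rSiteY" using N frame by (simp_all add: frame_def)
    have test: "bval bLeader s' \<longleftrightarrow> i \<in> ?L"
      using same i(2) by (auto simp: leaders_def S entry_def slot_def ix3_def ix2_def)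
    have result: "result number_step s' = (if i \<in> ?L then nupd 1 0 (Suc (nmem s' 1 0))
        (rupd 4 (nmem s' 1 0) (rmem s rSiteY (ix3 n b (b + n) i))
          (rupd 3 (nmem s' 1 0) (rmem s rSiteX (ix3 n b (b + n) i))
          (nupd aIndex i (nmem s' 1 0) s'))) else s')"
      unfolding number_step_def result.simps test using same i(2) by (simp add: ix3_def ix2_def)
    have "numbered (ls (Suc i)) S (result number_step s')"
    proof (cases "i \<in> ?L")
      case True
      then have "site S i = (rmem s rSiteX (ix3 n b (b + n) i), rmem s rSiteY (ix3 n b (b + n) i))"
        by (simp add: leaders_def S entry_def slot_def)
      from numbered_snoc[OF J _ this] show ?thesis
        unfolding result using True by (simp add: ls_def sorted_list_of_set_Int_lessThan_Suc)
    next
      case False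
      then show ?thesis unfolding result using J by (simp add: ls_def sorted_list_of_set_Int_lessThan_Suc)
    qed
    then show "runs number_step 5 (\<lambda>s''. numbered (ls (Suc i)) S (nupd vP 0 (Suc i) s'')) s'"
      by (intro runs_straight) (simp_all add: numbered_def number_step_def)
  next
    have "?L \<inter> {..<2 * n + 1} = ?L" using \<open>b \<le> n\<close> by (auto simp: leaders_def)
    then show "numbered (sorted_list_of_set ?L) S s'" if "numbered (ls (2 * n + 1)) S s'" for s'
      using that by (simp add: ls_def)
  qed (use N in \<open>auto simp: numbered_def ls_def frame_def loop_time_def\<close>)
qed simp_all

lemma runs_link_sources:
  assumes N: "nmem s vN 0 = n" "nmem s vStart 0 = b" "b \<le> n" and n: "n = length A" and perm: "perm_sorted A s"
    and S: "S = entry n s b (b + n)"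
  shows "runs link_sources (8 * real n + 6)
    (\<lambda>s'. \<forall>p\<in>{b..<b + n}. nmem s' 2 (source_at A p) = n + nmem s aIndex (label S p)) s"
  unfolding link_sources_def
proof (rule runs_For[where n = "2 * n + 1" and B = 2])
  let ?J = "\<lambda>i s'. \<forall>p\<in>{b..<b + n} \<inter> {..<i}. nmem s' 2 (source_at A p) = n + nmem s aIndex (label S p)"
  fix i s' assume i: "i < 2 * n + 1" "nmem s' vP 0 = i" and frame: "frame (For vP eM link_step) s s'"
    and J: "?J i s'"
  have same: "nmem s' vN 0 = n" "nmem s' vStart 0 = b" "nmem s' aLabel = nmem s aLabel"
    "nmem s' aPerm = nmem s aPerm"
    "nmem s' aIndex = nmem s aIndex" using N frame by (simp_all add: frame_def)
  have result: "result link_step s' =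
      (if i \<in> {b..<b + n} then nupd 2 (source_at A i) (n + nmem s aIndex (label S i)) s' else s')"
    using same i(2) \<open>b \<le> n\<close> perm n by (auto simp: link_step_def S entry_def slot_def perm_sorted_def
      ix3_def ix2_def)
  have "source_at A p \<noteq> source_at A i" if "p \<in> {b..<b + n}" "i \<in> {b..<b + n}" "p \<noteq> i" for p
    using inj_on_eq_iff[OF bij_betw_imp_inj_on[OF bij_betw_source_at], of p b A i] that n by simp
  then have "?J (Suc i) (result link_step s')" unfolding result using J by (auto simp: less_Suc_eq)
  then show "runs link_step 2 (\<lambda>s''. ?J (Suc i) (nupd vP 0 (Suc i) s'')) s'"
    by (intro runs_straight) (simp_all add: link_step_def)
qed (use N in \<open>auto simp: frame_def loop_time_def\<close>)

lemma runs_link_groups: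
  assumes N: "nmem s vN 0 = n" "nmem s 1 0 = m"
  shows "runs link_groups (3 * real m + 2)
    (\<lambda>s'. (\<forall>i<n. nmem s' 2 i = nmem s 2 i) \<and> (\<forall>j<m. nmem s' 2 (n + j) = n + m)) s"
  unfolding link_groups_def
proof (rule runs_For[where J = "\<lambda>k s'. (\<forall>i<n. nmem s' 2 i = nmem s 2 i) \<and> (\<forall>j<k. nmem s' 2 (n + j) = n + m)"
    and n = m and B = 1])
  let ?step = "NAssign 2 (NAdd (NVar vN) (NVar vP)) (NAdd (NVar vN) (NVar 1))"
  fix k s' assume frame: "frame (For vP (NVar 1) ?step) s s'" and k: "nmem s' vP 0 = k"
    and J: "(\<forall>i<n. nmem s' 2 i = nmem s 2 i) \<and> (\<forall>j<k. nmem s' 2 (n + j) = n + m)"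
  have "nmem s' vN 0 = n" "nmem s' 1 0 = m" using N frame by (simp_all add: frame_def)
  then show "runs ?step 1 (\<lambda>s''. (\<forall>i<n. nmem (nupd vP 0 (Suc k) s'') 2 i = nmem s 2 i) \<and>
      (\<forall>j<Suc k. nmem (nupd vP 0 (Suc k) s'') 2 (n + j) = n + m)) s'"
    using J k by (intro runs_straight) (auto simp: less_Suc_eq)
qed (use N in \<open>auto simp: frame_def loop_time_def\<close>)

definition write_layout :: com where
  "write_layout = choose_start ;; number_groups ;; link_sources ;; link_groups"

lemma runs_write_groups:
  assumes inst: "one_layer_instance I t" and n: "n = length (sources I)" and perm: "perm_sorted (sources I) s"
    and N: "nmem s vN 0 = n" "nmem s vStart 0 = b" "b \<le> n" and S: "S = entry n s b (b + n)"
    and valid: "valid (hull_seq (sources I)) t b (b + n) S"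
  shows "runs (number_groups ;; link_sources ;; link_groups) (25 * real n + 18)
    (\<lambda>s'. is_layout I (output_layout I s') \<and> layout_cost I (output_layout I s') \<le> val S) s"
proof (rule runs_Seq[OF runs_number_groups[OF N S]])
  let ?ls = "sorted_list_of_set (leaders b (b + n) S)" and ?Q = "\<lambda>s'. is_layout I (output_layout I s') \<and>
    layout_cost I (output_layout I s') \<le> val S"
  have "leaders b (b + n) S \<subseteq> {b..<b + n}" by (auto simp: leaders_def)
  then have len: "length ?ls \<le> n" using card_mono[of "{b..<b + n}" "leaders b (b + n) S"] by simp
  fix s\<^sub>1 assume frame1: "frame number_groups s s\<^sub>1" and num: "numbered ?ls S s\<^sub>1"
  have s1: "nmem s\<^sub>1 vN 0 = n" "nmem s\<^sub>1 vStart 0 = b" "perm_sorted (sources I) s\<^sub>1" "S = entry n s\<^sub>1 b (b + n)"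
    using N perm S frame1 table_frame[OF frame1] by (simp_all add: frame_def perm_sorted_def)
  show "runs (link_sources ;; link_groups) (11 * real n + 8) ?Q s\<^sub>1"
  proof (rule runs_Seq[OF runs_link_sources[OF s1(1,2) N(3) n s1(3,4)]])
    fix s\<^sub>2 assume frame2: "frame link_sources s\<^sub>1 s\<^sub>2"
      and src: "\<forall>p\<in>{b..<b + n}. nmem s\<^sub>2 2 (source_at (sources I) p) = n + nmem s\<^sub>1 aIndex (label S p)"
    have s2: "nmem s\<^sub>2 vN 0 = n" "nmem s\<^sub>2 1 0 = length ?ls"
      using s1 num frame2 by (simp_all add: frame_def numbered_def)
    show "runs link_groups (3 * real n + 2) ?Q s\<^sub>2"
    proof (rule runs_mono[OF runs_link_groups[OF s2]])
      fix s' assume frame3: "frame link_groups s\<^sub>2 s'"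
        and out: "(\<forall>i<n. nmem s' 2 i = nmem s\<^sub>2 2 i) \<and> (\<forall>j<length ?ls. nmem s' 2 (n + j) = n + length ?ls)"
      have "nmem s' 1 0 = length ?ls" "rmem s' 3 = rmem s\<^sub>1 3" "rmem s' 4 = rmem s\<^sub>1 4"
        using s2 frame2 frame3 by (simp_all add: frame_def)
      moreover have "source_at (sources I) p < n" if "p \<in> {b..<b + n}" for p
        using that n by (auto intro!: source_at_less)
      ultimately show "?Q s'"
        using one_layer_instance.output_of_solution[OF inst, of b S ?ls s' "nmem s\<^sub>1 aIndex"] valid num src out
        unfolding numbered_def n by simp
    qed (use len in simp)
  qed simp
qed simp

lemma runs_write_layout:
  assumes inst: "one_layer_instance I t" and n: "n = length (sources I)" and perm: "perm_sorted (sources I) s"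
    and N: "nmem s vN 0 = n" and valid: "table_valid (hull_seq (sources I)) t n n (table n s)"
  shows "runs write_layout (29 * real n + 25) (\<lambda>s'. is_layout I (output_layout I s') \<and>
    (\<forall>r\<le>n. layout_cost I (output_layout I s') \<le> table_val (table n s) r (r + n))) s"
  unfolding write_layout_def
proof (rule runs_Seq[OF runs_choose_start[OF N]])
  fix s' assume frame: "frame choose_start s s'" and start: "nmem s' vStart 0 \<le> n \<and>
    (\<forall>r\<le>n. rmem s rValue (ix2 n (nmem s' vStart 0) (nmem s' vStart 0 + n)) \<le> rmem s rValue (ix2 n r (r + n)))"
  define b where "b = nmem s' vStart 0"
  have s': "nmem s' vN 0 = n" "perm_sorted (sources I) s'" "table n s' = table n s" "entry n s' = entry n s"
    using N perm frame table_frame[OF frame] by (simp_all add: frame_def perm_sorted_def)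
  have entry: "table n s (r, r + n) = Some (entry n s r (r + n))" if "r \<le> n" for r
    using table_validD(2)[OF valid, of r "r + n"] that by (auto simp: table_def split: if_splits)
  have b: "b \<le> n" "nmem s' vStart 0 = b" using start by (simp_all add: b_def)
  have "valid (hull_seq (sources I)) t b (b + n) (entry n s b (b + n))"
    using table_validD(1)[OF valid entry] b(1) by blast
  from runs_write_groups[OF inst n s'(2,1) b(2,1) _ this]
  have "runs (number_groups ;; link_sources ;; link_groups) (25 * real n + 18)
      (\<lambda>s''. is_layout I (output_layout I s'') \<and>
    layout_cost I (output_layout I s'') \<le> val (entry n s b (b + n))) s'" using s'(4) by simp
  then show "runs (number_groups ;; link_sources ;; link_groups) (25 * real n + 18)
      (\<lambda>s'. is_layout I (output_layout I s') \<and>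
    (\<forall>r\<le>n. layout_cost I (output_layout I s') \<le> table_val (table n s) r (r + n))) s'"
  proof (rule runs_mono)
    fix s'' assume out: "is_layout I (output_layout I s'') \<and>
        layout_cost I (output_layout I s'') \<le> val (entry n s b (b + n))"
    have "val (entry n s b (b + n)) \<le> table_val (table n s) r (r + n)" if "r \<le> n" for r
      using start that unfolding table_val_def entry[OF that] b_def by (simp add: entry_def)
    then show "is_layout I (output_layout I s'') \<and>
        (\<forall>r\<le>n. layout_cost I (output_layout I s'') \<le> table_val (table n s) r (r + n))"
      using out order_trans by blast
  qed simp
qed simp

section \<open>The complete program\<close>

definition prepare :: com where
  "prepare = copy_input ;; mark_lower ;; sort_sources ;; init_table"

lemma runs_prepare:
  assumes inp: "holds_input \<epsilon> t A s" and n: "n = length A"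
  shows "runs prepare (4 * real n ^ 3 + 20 * real n ^ 2 + 38 * real n + 23) (\<lambda>s'. perm_sorted A s' \<and>
    holds_positions \<epsilon> t (hull_seq A) n s' \<and> table_complete c t (hull_seq A) n 0 (table n s'))
      s" (is "runs _ _ ?Q _")
  unfolding prepare_def
proof (rule runs_Seq[OF runs_copy_input[OF inp]])
  let ?B\<^sub>1 = "12 * real n ^ 2 + 20 * real n + 11"
  let ?B\<^sub>2 = "(4 * real n ^ 2 + 7 * real n + 2) + ?B\<^sub>1"
  fix s\<^sub>1 assume s1: "holds_sources \<epsilon> t A s\<^sub>1"
  show "runs (mark_lower ;; sort_sources ;; init_table) (((loop_time n ^^ 3) 2 + (3 * real n + 2)) + ?B\<^sub>2) ?Q s\<^sub>1"
  proof (rule runs_Seq[OF runs_mark_lower[OF s1 n]])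
    fix s\<^sub>2 assume frame2: "frame mark_lower s\<^sub>1 s\<^sub>2" and marks: "marks_lower A s\<^sub>2"
    have s2: "holds_sources \<epsilon> t A s\<^sub>2" by (rule holds_sources_frame[OF s1 frame2]) simp_all
    show "runs (sort_sources ;; init_table) ?B\<^sub>2 ?Q s\<^sub>2"
    proof (rule runs_Seq[OF runs_sort_sources[OF s2 marks n]])
      fix s\<^sub>3 assume frame3: "frame sort_sources s\<^sub>2 s\<^sub>3" and perm: "perm_sorted A s\<^sub>3"
      have s3: "holds_sources \<epsilon> t A s\<^sub>3" by (rule holds_sources_frame[OF s2 frame3]) simp_all
      have X: "holds_positions \<epsilon> t (hull_seq A) n s\<^sub>3" unfolding n by (rule holds_positions_hull_seq[OF s3 perm])
      have "nmem s\<^sub>3 vN 0 = n" using X by (simp add: holds_positions_def)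
      from runs_init_table[OF this] show "runs init_table ?B\<^sub>1 ?Q s\<^sub>3"
      proof (rule runs_mono)
        fix s' assume frame: "frame init_table s\<^sub>3 s'" and "table_complete c t (hull_seq A) n 0 (table n s')"
        moreover have "holds_positions \<epsilon> t (hull_seq A) n s'" by (rule holds_positions_frame[OF X frame]) simp_all
        moreover have "perm_sorted A s'" using perm frame by (simp add: perm_sorted_def frame_def)
        ultimately show "?Q s'" by blast
      qed simp
    qed simp
  qed simp
qed (simp add: n loop_time_def numeral_3_eq_3 power2_eq_square power3_eq_cube algebra_simps)

definition solver :: com where
  "solver = prepare ;; fill_table ;; write_layout"

definition solver_time :: "nat \<Rightarrow> real \<Rightarrow> real" where
  "solver_time n \<epsilon> = (4 * real n ^ 3 + 20 * real n ^ 2 + 38 * real n + 23) +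
     (loop_time n ((loop_time (2 * n + 1) ^^ 5) (28 * real n + T n \<epsilon> + 28)) + (29 * real n + 25))"

lemma mods_fill_table [simp]:
  "nmods fill_table = {vLen, vU, vU1, vV1, vU2, vV2} \<union> nmods search_step" "rmods fill_table = rmods search_step"
  by (auto simp: fill_table_def)

lemma runs_solver:
  assumes "\<epsilon> > 0" and inst: "one_layer_instance I t" and convex: "convex_instance I"
    and inp: "holds_input \<epsilon> t (sources I) s"
  shows "runs solver (solver_time (length (sources I)) \<epsilon>) (\<lambda>s'. is_layout I (output_layout I s') \<and>
    layout_cost I (output_layout I s') \<le> (1 + \<epsilon>) * min_cost I) s" (is "runs _ _ ?Q _")
  unfolding solver_def solver_time_def
proof (rule runs_Seq[OF runs_prepare[OF inp refl] _ order_refl])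
  let ?X = "hull_seq (sources I)" and ?n = "length (sources I)"
  let ?B = "loop_time ?n ((loop_time (2 * ?n + 1) ^^ 5) (28 * real ?n + T ?n \<epsilon> + 28))"
  fix s\<^sub>1 assume s1: "perm_sorted (sources I) s\<^sub>1 \<and> holds_positions \<epsilon> t ?X ?n s\<^sub>1 \<and>
      table_complete (1 + \<epsilon>) t ?X ?n 0 (table ?n s\<^sub>1)"
  then have "runs fill_table ?B (\<lambda>s'. table_complete (1 + \<epsilon>) t ?X ?n ?n (table ?n s')) s\<^sub>1"
    using runs_fill_table[OF \<open>\<epsilon> > 0\<close>] by blast
  then show "runs (fill_table ;; write_layout) (?B + (29 * real ?n + 25)) ?Q s\<^sub>1"
  proof (rule runs_Seq[OF _ _ order_refl])
    fix s\<^sub>2 assume frame: "frame fill_table s\<^sub>1 s\<^sub>2" and complete: "table_complete (1 + \<epsilon>) t ?X ?n ?n (table ?n s\<^sub>2)"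
    have s2: "perm_sorted (sources I) s\<^sub>2" "nmem s\<^sub>2 vN 0 = ?n" "table_valid ?X t ?n ?n (table ?n s\<^sub>2)"
      using s1 frame complete by (simp_all add: perm_sorted_def holds_positions_def table_complete_def frame_def)
    from runs_write_layout[OF inst refl s2] show "runs write_layout (29 * real ?n + 25) ?Q s\<^sub>2"
    proof (rule runs_mono)
      fix s' assume out: "is_layout I (output_layout I s') \<and>
        (\<forall>r\<le>?n. layout_cost I (output_layout I s') \<le> table_val (table ?n s\<^sub>2) r (r + ?n))"
      have "layout_cost I (output_layout I s') \<le> (1 + \<epsilon>) * layout_cost I L" if "is_layout I L" for L
        using one_layer_instance.recurrence_le_layout_cost[OF inst convex that
          table_complete_recurrence[OF complete]]
          \<open>\<epsilon> > 0\<close> out by (meson add_nonneg_nonneg less_imp_le order_trans zero_le_one)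
      then have "layout_cost I (output_layout I s') / (1 + \<epsilon>) \<le> min_cost I"
        unfolding min_cost_def using out \<open>\<epsilon> > 0\<close> by (intro cInf_greatest) (auto simp: divide_le_eq mult.commute)
      then show "?Q s'" using out \<open>\<epsilon> > 0\<close> by (simp add: divide_le_eq mult.commute)
    qed simp
  qed
qed

lemma fill_time_le:
  assumes "\<epsilon> > 0" "1 \<le> n"
  shows "loop_time n ((loop_time (2 * n + 1) ^^ 5) (28 * real n + T n \<epsilon> + 28)) \<le>
    3796875 * (28 * real (csize W) + 29) * (real n ^ 6 * T n \<epsilon>)"
proof -
  let ?B = "28 * real n + T n \<epsilon> + 28" and ?c = "28 * real (csize W) + 29"
  note T = weber_program_linear_time[OF W \<open>\<epsilon> > 0\<close>, of n]
  have B: "1 \<le> ?B" using T(2) by simp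
  have "?B \<le> ?c * T n \<epsilon>" using T by (simp add: algebra_simps)
  note iterated = iterated_loop_time_le[OF _ B, of "2 * n + 1" 5]
  have inner_ge_1: "1 \<le> (loop_time (2 * n + 1) ^^ 5) ?B" using iterated by simp
  have "(loop_time (2 * n + 1) ^^ 5) ?B \<le> (5 * real (2 * n + 1)) ^ 5 * ?B" using iterated by simp
  also have "\<dots> \<le> (15 * real n) ^ 5 * (?c * T n \<epsilon>)"
  proof (rule mult_mono)
    have "5 * real (2 * n + 1) \<le> 15 * real n" using \<open>1 \<le> n\<close> by simp
    then show "(5 * real (2 * n + 1)) ^ 5 \<le> (15 * real n) ^ 5" by (rule power_mono) simp
  qed (use B \<open>?B \<le> ?c * T n \<epsilon>\<close> in simp_all)
  finally have inner: "(loop_time (2 * n + 1) ^^ 5) ?B \<le> (15 * real n) ^ 5 * (?c * T n \<epsilon>)" .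
  have "loop_time n ((loop_time (2 * n + 1) ^^ 5) ?B) \<le> 5 * real n * ((loop_time (2 * n + 1) ^^ 5) ?B)"
    using iterated_loop_time_le[OF \<open>1 \<le> n\<close> inner_ge_1, of 1] by simp
  also have "\<dots> \<le> 5 * real n * ((15 * real n) ^ 5 * (?c * T n \<epsilon>))" using inner by (intro mult_left_mono) simp_all
  also have "\<dots> = 3796875 * ?c * (real n ^ 6 * T n \<epsilon>)" by (simp add: power_mult_distrib power_numeral_reduce)
  finally show ?thesis .
qed

lemma solver_time_le:
  assumes "\<epsilon> > 0" "1 \<le> n"
  shows "solver_time n \<epsilon> \<le> (3796875 * (28 * real (csize W) + 29) + 139) * (real n ^ 6 * T n \<epsilon>)"
proof -
  have power: "real n ^ k \<le> real n ^ 6 * T n \<epsilon>" if "k \<le> 6" for k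
  proof -
    have "real n ^ k * 1 \<le> real n ^ 6 * T n \<epsilon>"
      using \<open>1 \<le> n\<close> weber_program_linear_time(2)[OF W \<open>\<epsilon> > 0\<close>, of n] that
      by (intro mult_mono power_increasing) simp_all
    then show ?thesis by simp
  qed
  show ?thesis
    using fill_time_le[OF assms] power[of 0] power[of 1] power[of 2] power[of 3]
    unfolding solver_time_def distrib_right by simp
qed

end

theorem theorem32:
  fixes T_Weber :: "nat \<Rightarrow> real \<Rightarrow> real"
  assumes "\<exists>W. weber_program W T_Weber"
  shows "\<exists>P. \<exists>C::real. \<forall>\<epsilon>>0. \<forall>I t s.
           sinks I = [t] \<and> layers I = 1 \<and> alpha I = 0 \<and> convex_instance I \<and>
           holds_input \<epsilon> t (sources I) s \<longrightarrow>
           (\<exists>k s'. exec P s k s' \<and>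
              is_layout I (output_layout I s') \<and>
              layout_cost I (output_layout I s') \<le> (1 + \<epsilon>) * min_cost I \<and>
              (let n = length (sources I) in
                 1 \<le> n \<longrightarrow> real k \<le> C * (real n ^ 6 * T_Weber n \<epsilon>)))"
proof -
  obtain W where W: "weber_program W T_Weber" using assms by blast
  obtain K where K: "\<And>a. a \<in> nmods W \<union> rmods W \<Longrightarrow> a < K"
    using finite_nat_set_iff_bounded[of "nmods W \<union> rmods W"] finite_nmods[of W] finite_rmods[of W] by auto
  interpret weber_machine W T_Weber K by unfold_locales (use W K in auto)
  let ?C = "3796875 * (28 * real (csize W) + 29) + 139"
  show ?thesis
  proof (intro exI[of _ solver] exI[of _ ?C] allI impI, elim conjE)
    fix \<epsilon> :: real and I t s
    assume \<epsilon>: "0 < \<epsilon>" and I: "sinks I = [t]" "layers I = 1" "alpha I = 0" "convex_instance I"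
      and inp: "holds_input \<epsilon> t (sources I) s"
    have "one_layer_instance I t" using I by unfold_locales
    from runs_solver[OF \<epsilon> this I(4) inp]
    show "\<exists>k s'. exec solver s k s' \<and> is_layout I (output_layout I s') \<and>
        layout_cost I (output_layout I s') \<le> (1 + \<epsilon>) * min_cost I \<and>
        (let n = length (sources I) in 1 \<le> n \<longrightarrow> real k \<le> ?C * (real n ^ 6 * T_Weber n \<epsilon>))"
      using solver_time_le[OF \<epsilon>, of "length (sources I)"] unfolding runs_def Let_def by (meson order_trans)
  qed
qed

end
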